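(* Let $\theta_1,\theta_2>0$, $\theta:=\theta_1+\theta_2$, and $\mathcal{E}(u):=\mathcal{E}_{P(\theta_1,\theta_2)}^{\theta_1,\theta_2}(u)$. There exists a constant $C\ge0$, depending only on $\theta_1,\theta_2$, $n$, $\Omega$ and $\rho$, such that for every $u\in L^1_{loc}(\Omega)$ and every $\varphi\in C^\infty_c(\Omega,\mathbf{R}^{n_1\times n_2})$: (a) if $\theta=1$, or if $\theta<1$ and $\|u\|_\infty\le 1$, then $$\langle\mu[u],\varphi\rangle\le C\,\mathcal{E}(u)\,\|\varphi\|_\infty;$$ (b) if $\theta\ge 1$ and $\theta_1\le 1$, then $$\langle\mu[u],\varphi\rangle\le C\,\mathcal{E}(u)^{1/\theta}\,\|\nabla_1\varphi\|_1^{1-1/\theta}\,\|\varphi\|_\infty^{1/\theta};$$ (c) if $\theta_1,\theta_2>1$ and $\theta_1\le\theta_2$, then $$\langle\mu[u],\varphi\rangle\le C\,\mathcal{E}(u)^{1/\theta}\,\|\nabla_1\varphi\|_1^{\theta_2/\theta}\,\|\varphi\|_\infty^{\theta_1/\theta}.$$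
   Context: Setting: $n_1,n_2\ge 1$, $n=n_1+n_2$, $\mathbf{R}^n=X_1\oplus X_2$ with $X_1\perp X_2$ and $\dim X_l=n_l$; each $x\in\mathbf{R}^n$ is written $x=x_1+x_2$ with $x_l\in X_l$. For $l=1,2$, $\Omega_l\subset X_l$ is a non-empty bounded connected open subset of $X_l$, and $\Omega:=\Omega_1+\Omega_2\subset\mathbf{R}^n$. $L(U)$ denotes the space of real-valued Lebesgue-measurable functions on $U$. $(e_1,\dots,e_{n_1})$ and $(f_1,\dots,f_{n_2})$ are orthonormal bases of $X_1$ and $X_2$. For $l=1,2$, $\nabla_l$ is the (distributional) gradient with respect to the variables in $X_l$. For $u\in L^1_{loc}(\Omega)$, $\mu[u]:=\nabla_1\nabla_2u$ is the matrix-valued distribution with entries $\mu_{i,j}=\partial_{e_i}\partial_{f_j}u$, so that $\langle\mu[u],\varphi\rangle=\sum_{i,j}\int_\Omega u\,\partial_{e_i}\partial_{f_j}\varphi_{i,j}\,dx$. Kernel: $\rho\in L^1(\mathbf{R}^n,[0,\infty))$ is a fixed radial function with $\int\rho=1$ and $\operatorname{supp}\rho\subset B_1$; $\rho_\varepsilon(z):=\varepsilon^{-n}\rho(z/\varepsilon)$. Energies: for $\varepsilon>0$, $\Omega_l^\varepsilon:=\bigcap_{z_l\in X_l,\,|z_l|<\varepsilon}(\Omega_l-z_l)$ and $\Omega^\varepsilon:=\Omega_1^\varepsilon+\Omega_2^\varepsilon$. For $p,\theta_1,\theta_2>0$ and $u\in L(\Omega)$, $$\mathcal{E}_{\varepsilon,p}^{\theta_1,\theta_2}(u):=\int_{\mathbf{R}^n}\rho_\varepsilon(z)\int_{\Omega^\varepsilon}\frac{|u(x+z_1)-u(x)|^{\theta_1}\,|u(x+z_2)-u(x)|^{\theta_2}}{|z|^p}\,dx\,dz,\qquad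 \mathcal{E}_p^{\theta_1,\theta_2}(u):=\liminf_{\varepsilon\downarrow 0}\mathcal{E}_{\varepsilon,p}^{\theta_1,\theta_2}(u)\in[0,\infty].$$ The estimates carry no information when $\mathcal{E}(u)=\infty$. Exponent: $P(\theta_1,\theta_2):=2$ if $\theta\le 1$; $P(\theta_1,\theta_2):=1+\theta$ if $\theta\ge 1$ and $\min(\theta_1,\theta_2)\le 1$; $P(\theta_1,\theta_2):=\min(\theta_1,\theta_2)+\theta$ if $\theta_1,\theta_2>1$. *)

theory Defs
  imports "HOL-Analysis.Analysis"
begin

text \<open>If the space is the direct sum of \<open>X\<close> and \<open>Y\<close>, this is the component in \<open>X\<close> of the
  decomposition \<open>z = x + y\<close> with \<open>x \<in> X\<close> and \<open>y \<in> Y\<close>.\<close>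

definition component :: "'a::ab_group_add set \<Rightarrow> 'a set \<Rightarrow> 'a \<Rightarrow> 'a" where
  "component X Y z = (THE x. x \<in> X \<and> z - x \<in> Y)"

definition orthonormal_basis :: "('i \<Rightarrow> 'a::euclidean_space) \<Rightarrow> 'a set \<Rightarrow> bool" where
  "orthonormal_basis b X \<longleftrightarrow>
     (\<forall>i j. b i \<bullet> b j = (if i = j then 1 else 0)) \<and> span (range b) = X"

definition L1loc :: "'a::euclidean_space set \<Rightarrow> ('a \<Rightarrow> real) \<Rightarrow> bool" where
  "L1loc U u \<longleftrightarrow> (\<forall>K. compact K \<and> K \<subseteq> U \<longrightarrow> u absolutely_integrable_on K)"


definition dir_deriv :: "'a \<Rightarrow> ('a::euclidean_space \<Rightarrow> 'b::real_normed_vector) \<Rightarrow> 'a \<Rightarrow> 'b" where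
  "dir_deriv v f x = frechet_derivative f (at x) v"

primrec C_diff :: "nat \<Rightarrow> ('a::euclidean_space \<Rightarrow> 'b::real_normed_vector) \<Rightarrow> bool" where
  "C_diff 0 f \<longleftrightarrow> continuous_on UNIV f"
| "C_diff (Suc k) f \<longleftrightarrow> f differentiable_on UNIV \<and> (\<forall>v. C_diff k (dir_deriv v f))"

text \<open>\<open>C\<^sub>c\<^sup>\<infinity>(U)\<close>; its elements are identified with their extension by zero to the whole space.\<close>

definition test_function :: "'a::euclidean_space set \<Rightarrow> ('a \<Rightarrow> 'b::real_normed_vector) \<Rightarrow> bool" where
  "test_function U \<phi> \<longleftrightarrow> (\<forall>k. C_diff k \<phi>) \<and>
     compact (closure {x. \<phi> x \<noteq> 0}) \<and> closure {x. \<phi> x \<noteq> 0} \<subseteq> U"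

text \<open>Matrix-valued functions take values in \<open>real^'n2^'n1\<close> (rows indexed by \<open>'n1\<close>), whose norm
  is the Euclidean (Frobenius) norm.\<close>

definition sup_norm :: "'a set \<Rightarrow> ('a \<Rightarrow> 'b::real_normed_vector) \<Rightarrow> real" where
  "sup_norm U \<phi> = (SUP x\<in>U. norm (\<phi> x))"

text \<open>The \<open>L\<^sup>1\<close> norm of the gradient in the directions of the subspace with orthonormal basis \<open>b\<close>,
  measured pointwise in the Euclidean norm.\<close>

definition grad_L1_norm ::
  "'a::euclidean_space set \<Rightarrow> ('i::finite \<Rightarrow> 'a) \<Rightarrow> ('a \<Rightarrow> 'b::real_normed_vector) \<Rightarrow> real" where
  "grad_L1_norm U b \<phi> = (LINT x:U|lebesgue. sqrt (\<Sum>k\<in>UNIV. (norm (dir_deriv (b k) \<phi> x))\<^sup>2))"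

text \<open>The distribution \<open>\<partial>\<^sub>v\<partial>\<^sub>w u\<close>, and the pairing of \<open>\<mu>[u]\<close> with a matrix-valued test function.\<close>

definition deriv2_distr :: "'a::euclidean_space set \<Rightarrow> ('a \<Rightarrow> real) \<Rightarrow> 'a \<Rightarrow> 'a \<Rightarrow> ('a \<Rightarrow> real) \<Rightarrow> real" where
  "deriv2_distr U u v w \<psi> = (LINT x:U|lebesgue. u x * dir_deriv v (dir_deriv w \<psi>) x)"

definition mu_pairing ::
  "'a::euclidean_space set \<Rightarrow> ('n1::finite \<Rightarrow> 'a) \<Rightarrow> ('n2::finite \<Rightarrow> 'a) \<Rightarrow>
     ('a \<Rightarrow> real) \<Rightarrow> ('a \<Rightarrow> real^'n2^'n1) \<Rightarrow> real" where
  "mu_pairing U e f u \<phi> =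
     (\<Sum>i\<in>UNIV. \<Sum>j\<in>UNIV. deriv2_distr U u (e i) (f j) (\<lambda>x. \<phi> x $ i $ j))"


text \<open>The kernels \<open>\<rho>\<close>; \<open>B\<^sub>1\<close> is read as the closed unit ball, which admits at least as many kernels
  as the open one.\<close>

definition radial_kernel :: "(real^'n \<Rightarrow> real) \<Rightarrow> bool" where
  "radial_kernel \<rho> \<longleftrightarrow> integrable lebesgue \<rho> \<and> (\<forall>z. \<rho> z \<ge> 0) \<and> (\<exists>g. \<forall>z. \<rho> z = g (norm z)) \<and>
     integral\<^sup>L lebesgue \<rho> = 1 \<and> closure {z. \<rho> z \<noteq> 0} \<subseteq> cball 0 1"

definition rescaled_kernel :: "(real^'n \<Rightarrow> real) \<Rightarrow> real \<Rightarrow> real^'n \<Rightarrow> real" where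
  "rescaled_kernel \<rho> \<epsilon> z = \<rho> (z /\<^sub>R \<epsilon>) / \<epsilon> ^ CARD('n)"

definition shrink :: "'a::real_normed_vector set \<Rightarrow> real \<Rightarrow> 'a set \<Rightarrow> 'a set" where
  "shrink X \<epsilon> U = (\<Inter>z\<in>{z\<in>X. norm z < \<epsilon>}. (\<lambda>x. x - z) ` U)"

text \<open>Where \<open>\<rho>\<^sub>\<epsilon>(z) \<noteq> 0\<close> and \<open>|z| \<noteq> \<epsilon>\<close>, hence for almost every relevant \<open>z\<close>, the points \<open>x + z\<^sub>1\<close> and
  \<open>x + z\<^sub>2\<close> lie in \<open>\<Omega>\<^sub>1 + \<Omega>\<^sub>2\<close>, so the values of \<open>u\<close> outside this set do not matter.\<close>

definition energy_eps ::
  "(real^'n) set \<Rightarrow> (real^'n) set \<Rightarrow> (real^'n) set \<Rightarrow> (real^'n) set \<Rightarrow> (real^'n \<Rightarrow> real) \<Rightarrow>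
     real \<Rightarrow> real \<Rightarrow> real \<Rightarrow> real \<Rightarrow> (real^'n \<Rightarrow> real) \<Rightarrow> ennreal" where
  "energy_eps X1 X2 \<Omega>1 \<Omega>2 \<rho> \<theta>1 \<theta>2 p \<epsilon> u =
     (\<integral>\<^sup>+z. ennreal (rescaled_kernel \<rho> \<epsilon> z) *
        (\<integral>\<^sup>+x\<in>shrink X1 \<epsilon> \<Omega>1 + shrink X2 \<epsilon> \<Omega>2.
           ennreal (\<bar>u (x + component X1 X2 z) - u x\<bar> powr \<theta>1 *
                    \<bar>u (x + component X2 X1 z) - u x\<bar> powr \<theta>2 / norm z powr p) \<partial>lebesgue) \<partial>lebesgue)"

definition energy ::
  "(real^'n) set \<Rightarrow> (real^'n) set \<Rightarrow> (real^'n) set \<Rightarrow> (real^'n) set \<Rightarrow> (real^'n \<Rightarrow> real) \<Rightarrow>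
     real \<Rightarrow> real \<Rightarrow> real \<Rightarrow> (real^'n \<Rightarrow> real) \<Rightarrow> ennreal" where
  "energy X1 X2 \<Omega>1 \<Omega>2 \<rho> \<theta>1 \<theta>2 p u =
     Liminf (at_right 0) (\<lambda>\<epsilon>. energy_eps X1 X2 \<Omega>1 \<Omega>2 \<rho> \<theta>1 \<theta>2 p \<epsilon> u)"

definition crit_exp :: "real \<Rightarrow> real \<Rightarrow> real" where
  "crit_exp \<theta>1 \<theta>2 =
     (if \<theta>1 + \<theta>2 \<le> 1 then 2
      else if min \<theta>1 \<theta>2 \<le> 1 then 1 + (\<theta>1 + \<theta>2)
      else min \<theta>1 \<theta>2 + (\<theta>1 + \<theta>2))"

end

theory Submission
  imports Defs
begin

text \<open>The mixed derivative of \<open>u\<close> is the limit of averages of second differences.  Write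
  \<open>D\<close> for the second difference of \<open>u\<close> over the rectangle with the corners \<open>x\<close>, \<open>x + z\<^sub>1\<close>,
  \<open>x + z\<^sub>2\<close>, \<open>x + z\<close>.  Since the kernel is radial, weighting with the coordinates of \<open>z\<close> over
  \<open>|z|\<^sup>4\<close> isolates one entry of the mixed Hessian of a test function, up to a positive constant
  that does not depend on the bases (\<open>second_moment_eq\<close>, \<open>moment\<close>, \<open>averaged_tendsto\<close>).  So it
  suffices to bound the average of \<open>\<integral> D \<psi> / |z|\<^sup>2\<close>.

  Radial symmetry also shows that the energy controls the sum of its density over all four
  corners of the rectangle.  This sum is
  \<open>(|a| powr \<theta>1 + |a'| powr \<theta>1) * (|b| powr \<theta>2 + |b'| powr \<theta>2)\<close>, where \<open>a\<close>, \<open>a'\<close> are the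
  differences along the two edges in the first direction and \<open>b\<close>, \<open>b'\<close> those in the second, and
  \<open>D = a' - a = b' - b\<close> (\<open>corner_sum\<close>, \<open>corner_products_bound\<close>).

  To prove (a) one compares \<open>D\<close> directly with this sum.  For (b) and (c) the differences \<open>b\<close> are
  first truncated at the slope \<open>l\<close>, that is, at \<open>l * |z|\<close>.  For the truncated part the
  first difference is moved to the test function, which gives \<open>l * \<parallel>\<nabla>\<^sub>1\<phi>\<parallel>\<^sub>1\<close>.  The remaining part
  vanishes unless \<open>|b|\<close> or \<open>|b'|\<close> is greater than \<open>l * |z|\<close>, and then it is controlled by the
  density, with a negative power of \<open>l\<close> as a factor (\<open>excess_bound_mixed\<close>,
  \<open>excess_bound_supercritical\<close>).  The resulting bound (\<open>single_displacement_bound\<close>,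
  \<open>pairing_bound\<close>) holds for every \<open>l > 0\<close>, in case (c) also for every value of a second
  parameter \<open>k > 0\<close> that takes the place of Hoelder's inequality, and choosing these
  parameters optimally gives the products of powers in the theorem.\<close>

section \<open>Isometric involutions and Lebesgue measure\<close>

lemma nn_integral_lborel_plus:
  fixes f :: "'a::euclidean_space \<Rightarrow> ennreal"
  assumes [measurable]: "f \<in> borel_measurable borel"
  shows "(\<integral>\<^sup>+x. f (x + c) \<partial>lborel) = (\<integral>\<^sup>+x. f x \<partial>lborel)"
proof -
  have "(\<integral>\<^sup>+x. f x \<partial>lborel) = (\<integral>\<^sup>+x. f x \<partial>distr lborel borel ((+) c))"
    by (simp add: lborel_distr_plus)
  also have "\<dots> = (\<integral>\<^sup>+x. f (c + x) \<partial>lborel)" by (subst nn_integral_distr) auto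
  finally show ?thesis by (simp add: add.commute)
qed

lemma nn_integral_lborel_scale:
  fixes f :: "'a::euclidean_space \<Rightarrow> ennreal"
  assumes [measurable]: "f \<in> borel_measurable borel" and "c \<noteq> 0"
  shows "(\<integral>\<^sup>+x. f x \<partial>lborel) = ennreal (\<bar>c\<bar>^DIM('a)) * (\<integral>\<^sup>+x. f (c *\<^sub>R x) \<partial>lborel)"
proof -
  have "(\<integral>\<^sup>+x. f x \<partial>lborel) = (\<integral>\<^sup>+x. f x \<partial>density (distr lborel borel (\<lambda>x. 0 + c *\<^sub>R x)) (\<lambda>_. ennreal (\<bar>c\<bar>^DIM('a))))"
    using lborel_affine[OF \<open>c \<noteq> 0\<close>, of "0::'a"] by simp
  also have "\<dots> = (\<integral>\<^sup>+x. ennreal (\<bar>c\<bar>^DIM('a)) * f (c *\<^sub>R x) \<partial>lborel)"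
    by (subst nn_integral_density; (subst nn_integral_distr)?) (auto)
  also have "\<dots> = ennreal (\<bar>c\<bar>^DIM('a)) * (\<integral>\<^sup>+x. f (c *\<^sub>R x) \<partial>lborel)"
    by (rule nn_integral_cmult) auto
  finally show ?thesis .
qed

lemma nn_integral_lborel_reflect:
  fixes f :: "'a::euclidean_space \<Rightarrow> ennreal"
  assumes [measurable]: "f \<in> borel_measurable borel"
  shows "(\<integral>\<^sup>+x. f (c - x) \<partial>lborel) = (\<integral>\<^sup>+x. f x \<partial>lborel)"
proof -
  have "(\<integral>\<^sup>+x. f (c - x) \<partial>lborel) = (\<integral>\<^sup>+x. f (- x) \<partial>lborel)"
    using nn_integral_lborel_plus[of "\<lambda>x. f (c - x)" c] by simp
  also have "\<dots> = (\<integral>\<^sup>+x. f x \<partial>lborel)"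
    using nn_integral_lborel_scale[of f "-1"] by simp
  finally show ?thesis .
qed

text \<open>An involutive linear isometry: an orthogonal reflection, the antipodal map, or the change of sign
  of one component of an orthogonal splitting.\<close>

definition isometric_involution :: "('a::euclidean_space \<Rightarrow> 'a) \<Rightarrow> bool" where
  "isometric_involution R \<longleftrightarrow> linear R \<and> (\<forall>x. R (R x) = x) \<and> (\<forall>x. norm (R x) = norm x)"

lemma isometric_involution_measurable:
  assumes "isometric_involution R" shows "R \<in> borel_measurable borel"
  using assms unfolding isometric_involution_def
  by (intro borel_measurable_continuous_onI linear_continuous_on) (simp add: linear_conv_bounded_linear)

text \<open>Lebesgue measure is invariant under \<open>R\<close> by the argument that proves uniqueness of Haar measure:
  Fubini and translation invariance give
  \<open>(\<integral>f) (\<integral>g \<circ> R) = (\<integral>f \<circ> R) (\<integral>g)\<close>, and the indicator function of the unit ball is a \<open>g\<close>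
  with \<open>g \<circ> R = g\<close> and a finite non-zero integral.\<close>

lemma nn_integral_lborel_isometric_involution:
  fixes f :: "'a::euclidean_space \<Rightarrow> ennreal"
  assumes R: "isometric_involution R" and f[measurable]: "f \<in> borel_measurable borel"
  shows "(\<integral>\<^sup>+x. f (R x) \<partial>lborel) = (\<integral>\<^sup>+x. f x \<partial>lborel)"
proof -
  have [measurable]: "R \<in> borel_measurable borel" by (rule isometric_involution_measurable[OF R])
  interpret linear R using R by (simp add: isometric_involution_def)
  have RR[simp]: "R (R x) = x" for x using R by (simp add: isometric_involution_def)
  define g :: "'a \<Rightarrow> ennreal" where "g = indicator (ball 0 1)"
  have [measurable]: "g \<in> borel_measurable borel" unfolding g_def by (intro borel_measurable_indicator) auto
  have gR: "g (R x) = g x" for x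
    using R by (simp add: g_def isometric_involution_def indicator_def)
  define G where "G = (\<integral>\<^sup>+x. g x \<partial>lborel)"
  have Geq: "G = emeasure lborel (ball (0::'a) 1)" by (simp add: G_def g_def)
  have G: "G \<noteq> 0" "G \<noteq> top"
  proof -
    show "G \<noteq> top" unfolding Geq using emeasure_bounded_finite[of "ball (0::'a) 1"] by (simp add: less_top)
    show "G \<noteq> 0" unfolding Geq
      using open_not_negligible[of "ball (0::'a) 1"] negligible_iff_null_sets[of "ball (0::'a) 1"]
      by (auto simp: null_sets_def)
  qed
  have "(\<integral>\<^sup>+x. f x \<partial>lborel) * G = (\<integral>\<^sup>+y. (\<integral>\<^sup>+x. f x \<partial>lborel) * g (R y) \<partial>lborel)"
    unfolding gR G_def by (rule nn_integral_cmult[symmetric]) auto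
  also have "\<dots> = (\<integral>\<^sup>+y. (\<integral>\<^sup>+x. f (x + R y) * g (R y) \<partial>lborel) \<partial>lborel)"
    by (subst nn_integral_multc) (auto simp: nn_integral_lborel_plus)
  also have "\<dots> = (\<integral>\<^sup>+x. (\<integral>\<^sup>+y. f (x + R y) * g (R y) \<partial>lborel) \<partial>lborel)"
    by (rule lborel_pair.Fubini') measurable
  also have "\<dots> = (\<integral>\<^sup>+x. (\<integral>\<^sup>+y. f (R y) * g (R y - x) \<partial>lborel) \<partial>lborel)"
  proof (rule nn_integral_cong)
    fix x
    show "(\<integral>\<^sup>+y. f (x + R y) * g (R y) \<partial>lborel) = (\<integral>\<^sup>+y. f (R y) * g (R y - x) \<partial>lborel)"
      using nn_integral_lborel_plus[of "\<lambda>y. f (x + R y) * g (R y)" "- R x"]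
      by (simp add: add diff neg)
  qed
  also have "\<dots> = (\<integral>\<^sup>+y. (\<integral>\<^sup>+x. f (R y) * g (R y - x) \<partial>lborel) \<partial>lborel)"
    by (rule lborel_pair.Fubini') measurable
  also have "\<dots> = (\<integral>\<^sup>+y. f (R y) * G \<partial>lborel)"
    unfolding G_def
    by (intro nn_integral_cong) (subst nn_integral_cmult, auto simp: nn_integral_lborel_reflect)
  also have "\<dots> = (\<integral>\<^sup>+y. f (R y) \<partial>lborel) * G" by (rule nn_integral_multc) auto
  finally show ?thesis using G ennreal_mult_cancel_left[of G] by (auto simp: mult.commute)
qed

lemma lborel_distr_isometric_involution:
  assumes R: "isometric_involution R"
  shows "distr lborel borel R = lborel"
proof (rule measure_eqI)
  fix A assume "A \<in> sets (distr lborel borel R)"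
  then have [measurable]: "A \<in> sets borel" by simp
  have [measurable]: "R \<in> borel_measurable borel" by (rule isometric_involution_measurable[OF R])
  have "emeasure (distr lborel borel R) A = (\<integral>\<^sup>+x. indicator A x \<partial>distr lborel borel R)" by simp
  also have "\<dots> = (\<integral>\<^sup>+x. indicator A (R x) \<partial>lborel)" by (rule nn_integral_distr) auto
  also have "\<dots> = emeasure lborel A"
    by (subst nn_integral_lborel_isometric_involution[OF R]) auto
  finally show "emeasure (distr lborel borel R) A = emeasure lborel A" .
qed simp

text \<open>What the argument needs of the radial kernel: a Borel probability density on the closed unit
  ball that is invariant, up to null sets, under all isometric involutions.  Invariance is only
  required almost everywhere because a Borel representative of a Lebesgue measurable radial
  function need not be radial.\<close>
locale reflection_invariant_kernel =
  fixes r :: "'a::euclidean_space \<Rightarrow> real"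
  assumes kernel_measurable[measurable]: "r \<in> borel_measurable borel"
    and kernel_nonneg: "r z \<ge> 0"
    and kernel_support: "norm z > 1 \<Longrightarrow> r z = 0"
    and kernel_mass: "(\<integral>\<^sup>+z. ennreal (r z) \<partial>lborel) = 1"
    and kernel_invariant: "isometric_involution R \<Longrightarrow> AE z in lborel. r (R z) = r z"
begin

lemma nn_integral_kernel_invariant:
  assumes R: "isometric_involution R" and [measurable]: "h \<in> borel_measurable borel"
  shows "(\<integral>\<^sup>+z. ennreal (r z) * h (R z) \<partial>lborel) = (\<integral>\<^sup>+z. ennreal (r z) * h z \<partial>lborel)"
proof -
  have [measurable]: "R \<in> borel_measurable borel" by (rule isometric_involution_measurable[OF R])
  have "(\<integral>\<^sup>+z. ennreal (r z) * h (R z) \<partial>lborel) = (\<integral>\<^sup>+z. ennreal (r (R z)) * h (R z) \<partial>lborel)"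
    using kernel_invariant[OF R] by (intro nn_integral_cong_AE) auto
  also have "\<dots> = (\<integral>\<^sup>+z. ennreal (r z) * h z \<partial>lborel)"
    by (rule nn_integral_lborel_isometric_involution[OF R]) measurable
  finally show ?thesis .
qed

lemma kernel_integrable: "integrable lborel r"
  by (rule integrableI_nonneg) (auto simp: kernel_nonneg kernel_mass)

lemma integrable_kernel_mult:
  fixes h :: "'a \<Rightarrow> real"
  assumes [measurable]: "h \<in> borel_measurable borel" and h: "\<And>z. \<bar>h z\<bar> \<le> M"
  shows "integrable lborel (\<lambda>z. r z * h z)"
proof (rule Bochner_Integration.integrable_bound[OF integrable_mult_left[OF kernel_integrable, of M]])
  show "AE z in lborel. norm (r z * h z) \<le> norm (r z * M)"
  proof (rule AE_I2)
    fix z have "\<bar>h z\<bar> \<le> \<bar>M\<bar>" using h[of z] by linarith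
    then show "norm (r z * h z) \<le> norm (r z * M)"
      by (simp add: abs_mult mult_left_mono)
  qed
qed measurable

lemma integral_kernel_invariant:
  fixes h :: "'a \<Rightarrow> real"
  assumes R: "isometric_involution R" and [measurable]: "h \<in> borel_measurable borel"
  shows "(\<integral>z. r z * h (R z) \<partial>lborel) = (\<integral>z. r z * h z \<partial>lborel)"
proof -
  have [measurable]: "R \<in> borel_measurable borel" by (rule isometric_involution_measurable[OF R])
  have "(\<integral>z. r z * h (R z) \<partial>lborel) = (\<integral>z. r (R z) * h (R z) \<partial>lborel)"
    using kernel_invariant[OF R] by (intro integral_cong_AE) auto
  also have "\<dots> = (\<integral>z. r z * h z \<partial>distr lborel borel R)"
    by (rule integral_distr[symmetric]) auto
  finally show ?thesis by (simp add: lborel_distr_isometric_involution[OF R])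
qed

end

lemma lborel_integral_plus:
  fixes f :: "'a::euclidean_space \<Rightarrow> real"
  assumes [measurable]: "f \<in> borel_measurable borel"
  shows "(\<integral>x. f (x + c) \<partial>lborel) = (\<integral>x. f x \<partial>lborel)"
proof -
  have "(\<integral>x. f x \<partial>lborel) = (\<integral>x. f x \<partial>distr lborel borel ((+) c))"
    by (simp add: lborel_distr_plus)
  also have "\<dots> = (\<integral>x. f (c + x) \<partial>lborel)" by (subst integral_distr) auto
  finally show ?thesis by (simp add: add.commute)
qed

lemma lborel_integrable_plus:
  fixes f :: "'a::euclidean_space \<Rightarrow> real"
  assumes "integrable lborel f"
  shows "integrable lborel (\<lambda>x. f (x + c))"
proof -
  have [measurable]: "f \<in> borel_measurable borel" using assms by auto
  have "integrable (distr lborel borel ((+) c)) f" using assms by (simp add: lborel_distr_plus)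
  then have "integrable lborel (\<lambda>x. f (c + x))" by (subst (asm) integrable_distr_eq) auto
  then show ?thesis by (simp add: add.commute)
qed

lemma integrable_mult_bounded:
  fixes f g :: "'a \<Rightarrow> real"
  assumes f: "integrable M f" and [measurable]: "g \<in> borel_measurable M" and g: "\<And>x. \<bar>g x\<bar> \<le> B"
  shows "integrable M (\<lambda>x. f x * g x)"
proof (rule Bochner_Integration.integrable_bound[OF integrable_mult_left[OF f, of B]])
  show "AE z in M. norm (f z * g z) \<le> norm (f z * B)"
  proof (rule AE_I2)
    fix z have "\<bar>g z\<bar> \<le> \<bar>B\<bar>" using g[of z] by linarith
    then show "norm (f z * g z) \<le> norm (f z * B)"
      by (simp add: abs_mult mult_left_mono)
  qed
qed (use f in measurable)

section \<open>Directional derivatives and second differences\<close>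

lemma has_real_derivative_dir_deriv:
  fixes \<psi> :: "'a::euclidean_space \<Rightarrow> real"
  assumes "\<psi> differentiable_on UNIV"
  shows "((\<lambda>t. \<psi> (x + t *\<^sub>R v)) has_real_derivative dir_deriv v \<psi> (x + t *\<^sub>R v)) (at t)"
proof -
  have "(\<psi> has_derivative frechet_derivative \<psi> (at (x + t *\<^sub>R v))) (at (x + t *\<^sub>R v))"
    using assms by (simp add: frechet_derivative_works[symmetric] differentiable_on_def)
  moreover have "((\<lambda>t. x + t *\<^sub>R v) has_derivative (\<lambda>h. h *\<^sub>R v)) (at t)"
    by (auto intro!: derivative_eq_intros)
  ultimately have "((\<psi> \<circ> (\<lambda>t. x + t *\<^sub>R v)) has_derivative
      frechet_derivative \<psi> (at (x + t *\<^sub>R v)) \<circ> (\<lambda>h. h *\<^sub>R v)) (at t)"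
    using diff_chain_at by blast
  moreover have "linear (frechet_derivative \<psi> (at (x + t *\<^sub>R v)))"
    using assms by (intro linear_frechet_derivative) (simp add: differentiable_on_def)
  ultimately have "((\<lambda>t. \<psi> (x + t *\<^sub>R v)) has_derivative
      (\<lambda>h. h * frechet_derivative \<psi> (at (x + t *\<^sub>R v)) v)) (at t)"
    by (simp add: o_def linear_scale)
  then show ?thesis
    unfolding has_field_derivative_def dir_deriv_def
    by (rule has_derivative_eq_rhs) (simp add: fun_eq_iff mult.commute)
qed

lemma dir_deriv_linear:
  assumes "\<psi> differentiable_on UNIV"
  shows "linear (\<lambda>v. dir_deriv v \<psi> x)"
  unfolding dir_deriv_def using assms
  by (intro linear_frechet_derivative) (simp add: differentiable_on_def)

lemma dir_deriv_eq_0: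
  assumes "compact S" "\<And>x. x \<notin> S \<Longrightarrow> \<psi> x = 0" "x \<notin> S"
  shows "dir_deriv v \<psi> x = 0"
proof -
  have "open (- S)" using assms(1) by (simp add: compact_imp_closed open_Compl)
  have "(\<psi> has_derivative (\<lambda>_. 0)) (at x)"
  proof (rule has_derivative_transform_within_open)
    show "((\<lambda>_. 0) has_derivative (\<lambda>_. 0)) (at x)" by (rule has_derivative_const)
    show "open (- S)" by fact
    show "x \<in> - S" using assms(3) by simp
    show "0 = \<psi> y" if "y \<in> - S" for y using that assms(2)[of y] by simp
  qed
  from frechet_derivative_at[OF this, symmetric]
  show ?thesis by (simp add: dir_deriv_def)
qed

text \<open>The mixed second difference of \<open>\<psi>\<close> with steps \<open>- v\<close> and \<open>- w\<close>.  The steps are negative because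
  it arises as the adjoint of the second difference of \<open>u\<close> with steps \<open>v\<close> and \<open>w\<close>.\<close>
definition diff2 :: "('a::ab_group_add \<Rightarrow> real) \<Rightarrow> 'a \<Rightarrow> 'a \<Rightarrow> 'a \<Rightarrow> real" where
  "diff2 \<psi> v w x = \<psi> (x - v - w) - \<psi> (x - v) - \<psi> (x - w) + \<psi> x"

lemma diff2_mean_value:
  fixes \<psi> :: "'a::euclidean_space \<Rightarrow> real"
  assumes d: "\<psi> differentiable_on UNIV" "dir_deriv w \<psi> differentiable_on UNIV" and t: "0 < t"
  obtains \<xi> \<eta> where "0 < \<xi>" "\<xi> < t" "0 < \<eta>" "\<eta> < t"
    "diff2 \<psi> (t *\<^sub>R v) (t *\<^sub>R w) x = t\<^sup>2 * dir_deriv v (dir_deriv w \<psi>) (x - \<xi> *\<^sub>R v - \<eta> *\<^sub>R w)"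
proof -
  have der: "((\<lambda>s. k (y - s *\<^sub>R q)) has_real_derivative - dir_deriv q k (y - s *\<^sub>R q)) (at s)"
    if "k differentiable_on UNIV" for k :: "'a \<Rightarrow> real" and y q s
    using DERIV_chain2[OF has_real_derivative_dir_deriv[OF that, of y q "-s"] DERIV_minus[OF DERIV_ident]] by simp
  define h where "h s = \<psi> (x - t *\<^sub>R v - s *\<^sub>R w) - \<psi> (x - s *\<^sub>R w)" for s
  have "(h has_real_derivative - dir_deriv w \<psi> (x - t *\<^sub>R v - s *\<^sub>R w) - - dir_deriv w \<psi> (x - s *\<^sub>R w)) (at s)" for s
    unfolding h_def by (intro DERIV_diff der d)
  from MVT2[OF t this] obtain \<eta> where \<eta>: "0 < \<eta>" "\<eta> < t" and
    1: "h t - h 0 = t * (dir_deriv w \<psi> (x - \<eta> *\<^sub>R w) - dir_deriv w \<psi> (x - t *\<^sub>R v - \<eta> *\<^sub>R w))"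
    by auto
  have "((\<lambda>s. dir_deriv w \<psi> ((x - \<eta> *\<^sub>R w) - s *\<^sub>R v)) has_real_derivative
      - dir_deriv v (dir_deriv w \<psi>) ((x - \<eta> *\<^sub>R w) - s *\<^sub>R v)) (at s)" for s
    by (intro der d)
  from MVT2[OF t this] obtain \<xi> where \<xi>: "0 < \<xi>" "\<xi> < t" and
    2: "dir_deriv w \<psi> ((x - \<eta> *\<^sub>R w) - t *\<^sub>R v) - dir_deriv w \<psi> (x - \<eta> *\<^sub>R w)
       = t * (- dir_deriv v (dir_deriv w \<psi>) ((x - \<eta> *\<^sub>R w) - \<xi> *\<^sub>R v))"
    by auto
  have "diff2 \<psi> (t *\<^sub>R v) (t *\<^sub>R w) x = h t - h 0"
    by (simp add: diff2_def h_def)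
  also have "\<dots> = t * (t * dir_deriv v (dir_deriv w \<psi>) ((x - \<eta> *\<^sub>R w) - \<xi> *\<^sub>R v))"
  proof -
    have a: "x - t *\<^sub>R v - \<eta> *\<^sub>R w = x - \<eta> *\<^sub>R w - t *\<^sub>R v" by simp
    have "dir_deriv w \<psi> (x - \<eta> *\<^sub>R w) - dir_deriv w \<psi> (x - \<eta> *\<^sub>R w - t *\<^sub>R v)
        = t * dir_deriv v (dir_deriv w \<psi>) ((x - \<eta> *\<^sub>R w) - \<xi> *\<^sub>R v)"
      using 2 by linarith
    then show ?thesis unfolding 1 a by (simp only:)
  qed
  also have "x - \<eta> *\<^sub>R w - \<xi> *\<^sub>R v = x - \<xi> *\<^sub>R v - \<eta> *\<^sub>R w" by simp
  finally show ?thesis using that \<xi> \<eta> by (simp add: power2_eq_square mult.assoc)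
qed

text \<open>The \<open>L\<^sup>1\<close> norm of a difference is at most the \<open>L\<^sup>1\<close> norm of the directional derivative: integrate
  the derivative along the segment and exchange the integrals.\<close>

lemma nn_integral_difference_le:
  fixes \<psi> :: "'a::euclidean_space \<Rightarrow> real"
  assumes d: "\<psi> differentiable_on UNIV" and c: "continuous_on UNIV (dir_deriv v \<psi>)"
  shows "(\<integral>\<^sup>+x. ennreal \<bar>\<psi> (x + v) - \<psi> x\<bar> \<partial>lborel) \<le> (\<integral>\<^sup>+x. ennreal \<bar>dir_deriv v \<psi> x\<bar> \<partial>lborel)"
proof -
  have [measurable]: "dir_deriv v \<psi> \<in> borel_measurable borel"
    by (rule borel_measurable_continuous_onI[OF c])
  have "(\<integral>\<^sup>+x. ennreal \<bar>\<psi> (x + v) - \<psi> x\<bar> \<partial>lborel)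
      \<le> (\<integral>\<^sup>+x. (\<integral>\<^sup>+t. ennreal \<bar>dir_deriv v \<psi> (x + t *\<^sub>R v)\<bar> * indicator {0..1::real} t \<partial>lborel) \<partial>lborel)"
  proof (rule nn_integral_mono)
    fix x
    have cont: "continuous_on UNIV (\<lambda>t. dir_deriv v \<psi> (x + t *\<^sub>R v))"
      by (intro continuous_on_compose2[OF c] continuous_intros) auto
    have hb: "has_bochner_integral lborel (\<lambda>t. dir_deriv v \<psi> (x + t *\<^sub>R v) * indicator {0..1} t)
        (\<psi> (x + 1 *\<^sub>R v) - \<psi> (x + 0 *\<^sub>R v))"
      by (rule has_bochner_integral_FTC_Icc_real)
        (use cont in \<open>auto simp: continuous_on_eq_continuous_at intro!: has_real_derivative_dir_deriv d\<close>)
    then have "ennreal \<bar>\<psi> (x + v) - \<psi> x\<bar> 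
        = ennreal (norm (\<integral>t. dir_deriv v \<psi> (x + t *\<^sub>R v) * indicator {0..1} t \<partial>lborel))"
      by (simp add: has_bochner_integral_iff)
    also have "\<dots> \<le> (\<integral>\<^sup>+t. norm (dir_deriv v \<psi> (x + t *\<^sub>R v) * indicator {0..1} t) \<partial>lborel)"
      using hb by (intro integral_norm_bound_ennreal) (simp add: has_bochner_integral_iff)
    also have "\<dots> = (\<integral>\<^sup>+t. ennreal \<bar>dir_deriv v \<psi> (x + t *\<^sub>R v)\<bar> * indicator {0..1::real} t \<partial>lborel)"
      by (intro nn_integral_cong) (auto simp: indicator_def)
    finally show "ennreal \<bar>\<psi> (x + v) - \<psi> x\<bar> \<le> \<dots>" .
  qed
  also have "\<dots> = (\<integral>\<^sup>+t. (\<integral>\<^sup>+x. ennreal \<bar>dir_deriv v \<psi> (x + t *\<^sub>R v)\<bar> * indicator {0..1::real} t \<partial>lborel) \<partial>lborel)"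
    by (rule lborel_pair.Fubini') measurable
  also have "\<dots> = (\<integral>\<^sup>+t. (\<integral>\<^sup>+x. ennreal \<bar>dir_deriv v \<psi> x\<bar> \<partial>lborel) * indicator {0..1::real} t \<partial>lborel)"
    by (intro nn_integral_cong, subst nn_integral_multc)
      (auto simp: nn_integral_lborel_plus[of "\<lambda>x. ennreal \<bar>dir_deriv v \<psi> x\<bar>"])
  also have "\<dots> = (\<integral>\<^sup>+x. ennreal \<bar>dir_deriv v \<psi> x\<bar> \<partial>lborel)"
    by (subst nn_integral_cmult_indicator) auto
  finally show ?thesis .
qed

lemma nn_integral_shift_le:
  fixes g :: "'a::euclidean_space \<Rightarrow> ennreal"
  assumes [measurable]: "g \<in> borel_measurable borel" "S \<in> sets borel" "K \<in> sets borel"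
   and "\<And>x. x \<in> S \<Longrightarrow> x + c \<in> K"
  shows "(\<integral>\<^sup>+x. g (x + c) * indicator S x \<partial>lborel) \<le> (\<integral>\<^sup>+x. g x * indicator K x \<partial>lborel)"
proof -
  have "(\<integral>\<^sup>+x. g (x + c) * indicator S x \<partial>lborel) \<le> (\<integral>\<^sup>+x. g (x + c) * indicator K (x + c) \<partial>lborel)"
    using assms(4) by (intro nn_integral_mono) (auto simp: indicator_def)
  also have "\<dots> = (\<integral>\<^sup>+x. g x * indicator K x \<partial>lborel)"
    by (rule nn_integral_lborel_plus) measurable
  finally show ?thesis .
qed

section \<open>Orthogonal splittings\<close>

text \<open>The vectors \<open>e\<close> and \<open>f\<close> together form an orthonormal basis of the whole space.\<close>

locale orthonormal_split =
  fixes e :: "'i::finite \<Rightarrow> 'a::euclidean_space" and f :: "'j::finite \<Rightarrow> 'a"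
  assumes ee: "e i \<bullet> e i' = (if i = i' then 1 else 0)"
    and ff: "f j \<bullet> f j' = (if j = j' then 1 else 0)"
    and ef: "e i \<bullet> f j = 0"
    and split: "x = (\<Sum>i\<in>UNIV. (x \<bullet> e i) *\<^sub>R e i) + (\<Sum>j\<in>UNIV. (x \<bullet> f j) *\<^sub>R f j)"
begin

text \<open>The orthogonal projections onto the spans of \<open>e\<close> and of \<open>f\<close>.\<close>

definition p1 :: "'a \<Rightarrow> 'a" where "p1 x = (\<Sum>i\<in>UNIV. (x \<bullet> e i) *\<^sub>R e i)"
definition p2 :: "'a \<Rightarrow> 'a" where "p2 x = (\<Sum>j\<in>UNIV. (x \<bullet> f j) *\<^sub>R f j)"

lemma fe: "f j \<bullet> e i = 0" using ef[of i j] by (simp add: inner_commute)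

lemma p1_p2: "p1 x + p2 x = x" using split[of x] by (simp add: p1_def p2_def)

lemma p2_p1: "p2 x + p1 x = x" using p1_p2[of x] by (simp add: add.commute)

lemma linear_p1: "linear p1" and linear_p2: "linear p2"
  unfolding p1_def p2_def
  by (auto intro!: linearI simp: inner_add_left scaleR_add_left sum.distrib scaleR_sum_right)

lemma p_measurable[measurable]: "p1 \<in> borel_measurable borel" "p2 \<in> borel_measurable borel"
  unfolding p1_def p2_def by measurable

lemma p1_e: "p1 x \<bullet> e i = x \<bullet> e i" and p2_f: "p2 x \<bullet> f j = x \<bullet> f j"
  and p1_f: "p1 x \<bullet> f j = 0" and p2_e: "p2 x \<bullet> e i = 0"
  by (simp_all add: p1_def p2_def inner_sum_left ee ff ef fe if_distrib cong: if_cong)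

lemma p1_p1[simp]: "p1 (p1 x) = p1 x" and p2_p2[simp]: "p2 (p2 x) = p2 x"
  and p1_p2_0[simp]: "p1 (p2 x) = 0" and p2_p1_0[simp]: "p2 (p1 x) = 0"
  by (simp_all add: p1_def[of "p1 x"] p1_def[of "p2 x"] p2_def[of "p1 x"] p2_def[of "p2 x"] p1_e p2_f p1_f p2_e)
    (simp_all add: p1_def p2_def)

lemma p1_add: "p1 (x + y) = p1 x + p1 y" and p2_add: "p2 (x + y) = p2 x + p2 y"
  and p1_diff: "p1 (x - y) = p1 x - p1 y" and p2_diff: "p2 (x - y) = p2 x - p2 y"
  and p1_minus: "p1 (- x) = - p1 x" and p2_minus: "p2 (- x) = - p2 x"
  and p1_scale: "p1 (c *\<^sub>R x) = c *\<^sub>R p1 x" and p2_scale: "p2 (c *\<^sub>R x) = c *\<^sub>R p2 x"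
  using linear_p1 linear_p2
  by (simp_all add: linear_add linear_diff linear_neg linear_scale)

lemma p1_p2_orthogonal: "p1 x \<bullet> p2 y = 0"
  by (simp add: p2_def inner_sum_right p1_f)

lemma norm_split: "(norm x)\<^sup>2 = (norm (p1 x))\<^sup>2 + (norm (p2 x))\<^sup>2"
  using norm_add_Pythagorean[of "p1 x" "p2 x"] by (simp add: orthogonal_def p1_p2_orthogonal p1_p2)

lemma norm_p1: "norm (p1 x) \<le> norm x" and norm_p2: "norm (p2 x) \<le> norm x"
  by (rule power2_le_imp_le; simp add: norm_split[of x])+

lemma norm_p1_sq: "(norm (p1 x))\<^sup>2 = (\<Sum>i\<in>UNIV. (x \<bullet> e i)\<^sup>2)"
proof -
  have "p1 x \<bullet> p1 x = (\<Sum>i\<in>UNIV. (x \<bullet> e i) * (p1 x \<bullet> e i))"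
    using inner_sum_right[of "p1 x" "\<lambda>i. (x \<bullet> e i) *\<^sub>R e i" UNIV] by (simp add: p1_def[symmetric])
  then show ?thesis unfolding power2_norm_eq_inner by (simp add: p1_e power2_eq_square)
qed

text \<open>Changing the sign of one of the two components is an isometry; it moves one corner of the
  rectangle spanned by \<open>p1 z\<close> and \<open>p2 z\<close> to another.\<close>

lemma isometric_involution_flip1: "isometric_involution (\<lambda>z. p2 z - p1 z)"
proof -
  have "norm (p2 z - p1 z) = norm z" for z
    by (rule power2_eq_imp_eq) (simp_all add: norm_split[of z] norm_split[of "p2 z - p1 z"] p1_diff p2_diff)
  then show ?thesis
    using linear_p1 linear_p2 
    by (auto simp: isometric_involution_def p1_diff p2_diff p1_p2 linear_compose_sub p2_p1)
qed

lemma isometric_involution_flip2: "isometric_involution (\<lambda>z. p1 z - p2 z)"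
proof -
  have "norm (p1 z - p2 z) = norm z" for z
    by (rule power2_eq_imp_eq) (simp_all add: norm_split[of z] norm_split[of "p1 z - p2 z"] p1_diff p2_diff)
  then show ?thesis
    using linear_p1 linear_p2 
    by (auto simp: isometric_involution_def p1_diff p2_diff p1_p2 linear_compose_sub)
qed

lemma dir_deriv_p1_le:
  fixes \<psi> :: "'a \<Rightarrow> real"
  assumes "\<psi> differentiable_on UNIV"
  shows "\<bar>dir_deriv (p1 z) \<psi> x\<bar> \<le> norm (p1 z) * sqrt (\<Sum>i\<in>UNIV. (dir_deriv (e i) \<psi> x)\<^sup>2)"
proof -
  interpret l: linear "\<lambda>v. dir_deriv v \<psi> x" by (rule dir_deriv_linear[OF assms])
  have "dir_deriv (p1 z) \<psi> x = (\<Sum>i\<in>UNIV. (z \<bullet> e i) * dir_deriv (e i) \<psi> x)"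
    by (simp add: p1_def l.sum l.scale)
  also have "\<bar>\<dots>\<bar> \<le> L2_set (\<lambda>i. z \<bullet> e i) UNIV * L2_set (\<lambda>i. dir_deriv (e i) \<psi> x) UNIV"
    by (rule order_trans[OF sum_abs]) (simp add: abs_mult L2_set_mult_ineq)
  also have "L2_set (\<lambda>i. z \<bullet> e i) UNIV = norm (p1 z)"
    unfolding L2_set_def norm_p1_sq[symmetric] by simp
  finally show ?thesis by (simp add: L2_set_def)
qed

end

section \<open>Truncated vertical differences and the estimate for one displacement\<close>

text \<open>The truncation of \<open>b\<close> at the levels \<open>t\<close> and \<open>- t\<close>.\<close>

definition trunc :: "real \<Rightarrow> real \<Rightarrow> real" where "trunc t b = max (- t) (min t b)"

lemma trunc_le: "0 \<le> t \<Longrightarrow> \<bar>trunc t b\<bar> \<le> t" and trunc_le': "0 \<le> t \<Longrightarrow> \<bar>trunc t b\<bar> \<le> \<bar>b\<bar>"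
  by (auto simp: trunc_def)

lemma trunc_measurable[measurable]: "trunc t \<in> borel_measurable borel"
  unfolding trunc_def by measurable

text \<open>The part of \<open>b\<close> beyond the levels \<open>t\<close> and \<open>- t\<close>.\<close>

definition excess :: "real \<Rightarrow> real \<Rightarrow> real" where "excess t b = b - trunc t b"

lemma excess_measurable[measurable]: "excess t \<in> borel_measurable borel"
  unfolding excess_def by measurable

text \<open>The pointwise inequality that links the energy to the second difference.  The numbers \<open>u0\<close>,
  \<open>u1\<close>, \<open>u2\<close>, \<open>u3\<close> stand for the values of a function at \<open>x\<close>, \<open>x + p1 z\<close>, \<open>x + p2 z\<close> and
  \<open>x + z\<close>, and \<open>t\<close> for \<open>norm z\<close>.  The difference, in the first direction, of the excess of the
  vertical difference over the slope \<open>l\<close> is bounded by a constant \<open>\<alpha>\<close> plus \<open>\<beta>\<close> times the sum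
  over the four corners of the energy density.  The set \<open>V\<close> contains the values that are
  allowed: all reals, or an interval if the function is bounded.\<close>

definition excess_bound :: "real set \<Rightarrow> real \<Rightarrow> real \<Rightarrow> real \<Rightarrow> real \<Rightarrow> real \<Rightarrow> real \<Rightarrow> bool" where
  "excess_bound V \<theta>1 \<theta>2 p l \<alpha> \<beta> \<longleftrightarrow> (\<forall>u0\<in>V. \<forall>u1\<in>V. \<forall>u2\<in>V. \<forall>u3\<in>V. \<forall>t>0.
     \<bar>excess (l * t) (u3 - u1) - excess (l * t) (u2 - u0)\<bar> / t\<^sup>2 \<le> \<alpha> + \<beta> *
       ((\<bar>u1 - u0\<bar> powr \<theta>1 + \<bar>u3 - u2\<bar> powr \<theta>1) * (\<bar>u2 - u0\<bar> powr \<theta>2 + \<bar>u3 - u1\<bar> powr \<theta>2) / t powr p))"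

lemma integral_alternating4:
  fixes f1 :: "'a \<Rightarrow> real"
  assumes "integrable M f1" "integrable M f2" "integrable M f3" "integrable M f4"
  shows "(\<integral>x. f1 x - f2 x - f3 x + f4 x \<partial>M) = integral\<^sup>L M f1 - integral\<^sup>L M f2 - integral\<^sup>L M f3 + integral\<^sup>L M f4"
  using assms by simp

context orthonormal_split
begin

text \<open>The integrand of the energy at \<open>x\<close>: the product of the two edges at the corner \<open>x\<close> of the
  rectangle spanned by \<open>p1 z\<close> and \<open>p2 z\<close>; and its integral over \<open>K\<close> for a fixed displacement \<open>z\<close>.\<close>

definition edge_product :: "real \<Rightarrow> real \<Rightarrow> real \<Rightarrow> ('a \<Rightarrow> real) \<Rightarrow> 'a \<Rightarrow> 'a \<Rightarrow> ennreal" where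
  "edge_product \<theta>1 \<theta>2 p u z x =
     ennreal (\<bar>u (x + p1 z) - u x\<bar> powr \<theta>1 * \<bar>u (x + p2 z) - u x\<bar> powr \<theta>2 / norm z powr p)"

definition slice_energy :: "real \<Rightarrow> real \<Rightarrow> real \<Rightarrow> ('a \<Rightarrow> real) \<Rightarrow> 'a set \<Rightarrow> 'a \<Rightarrow> ennreal" where
  "slice_energy \<theta>1 \<theta>2 p u K z = (\<integral>\<^sup>+x. edge_product \<theta>1 \<theta>2 p u z x * indicator K x \<partial>lborel)"

lemma edge_product_measurable:
  assumes [measurable]: "u \<in> borel_measurable borel"
  shows "(\<lambda>(z, x). edge_product \<theta>1 \<theta>2 p u z x) \<in> borel_measurable (borel \<Otimes>\<^sub>M borel)"
  unfolding edge_product_def by measurable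

lemma edge_product_slice_measurable[measurable]:
  assumes [measurable]: "u \<in> borel_measurable borel"
  shows "edge_product \<theta>1 \<theta>2 p u z \<in> borel_measurable borel"
  unfolding edge_product_def by measurable

lemma slice_energy_measurable[measurable]:
  assumes [measurable]: "u \<in> borel_measurable borel" "K \<in> sets borel"
  shows "slice_energy \<theta>1 \<theta>2 p u K \<in> borel_measurable borel"
proof -
  have "(\<lambda>x. edge_product \<theta>1 \<theta>2 p u (fst x) (snd x)) \<in> borel_measurable (borel \<Otimes>\<^sub>M borel)"
    using edge_product_measurable[OF assms(1)] by (simp add: split_beta')
  moreover have "(\<lambda>x. indicator K (snd x) :: ennreal) \<in> borel_measurable (borel \<Otimes>\<^sub>M borel)"
    by (rule measurable_compose[OF measurable_snd borel_measurable_indicator[OF assms(2)]])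
  ultimately have "(\<lambda>x. edge_product \<theta>1 \<theta>2 p u (fst x) (snd x) * indicator K (snd x))
      \<in> borel_measurable (borel \<Otimes>\<^sub>M borel)"
    by (rule borel_measurable_times_ennreal)
  then have "case_prod (\<lambda>z x. edge_product \<theta>1 \<theta>2 p u z x * indicator K x) \<in> borel_measurable (borel \<Otimes>\<^sub>M lborel)"
    by (simp add: split_beta' cong: measurable_cong_sets sets_pair_measure_cong)
  from lborel.borel_measurable_nn_integral[OF this]
  show ?thesis by (simp add: slice_energy_def[abs_def])
qed

text \<open>A rectangle has two edges in each direction, and every pair of edges in different directions
  meets in exactly one corner.  So the product of the sums over the edges in each direction is the
  sum over the four corners of the integrands, read with \<open>z\<close> up to the signs of its components.\<close>
lemma corner_sum:
  assumes "z \<noteq> 0"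
  shows "ennreal ((\<bar>u (x + p1 z) - u x\<bar> powr \<theta>1 + \<bar>u (x + z) - u (x + p2 z)\<bar> powr \<theta>1) *
      (\<bar>u (x + p2 z) - u x\<bar> powr \<theta>2 + \<bar>u (x + z) - u (x + p1 z)\<bar> powr \<theta>2) / norm z powr p) =
     edge_product \<theta>1 \<theta>2 p u z x + edge_product \<theta>1 \<theta>2 p u (p2 z - p1 z) (x + p1 z) +
     edge_product \<theta>1 \<theta>2 p u (p1 z - p2 z) (x + p2 z) + edge_product \<theta>1 \<theta>2 p u (- z) (x + z)"
proof -
  have n: "norm (p2 z - p1 z) = norm z" "norm (p1 z - p2 z) = norm z"
    using isometric_involution_flip1 isometric_involution_flip2 by (auto simp: isometric_involution_def)
  have c: "x + p1 z + p2 z = x + z" "x + p2 z + p1 z = x + z" "x + z - p1 z = x + p2 z" "x + z - p2 z = x + p1 z"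
    using p1_p2[of z] by (simp_all add: algebra_simps)
  have s: "\<bar>u x - u (x + p1 z)\<bar> = \<bar>u (x + p1 z) - u x\<bar>" "\<bar>u x - u (x + p2 z)\<bar> = \<bar>u (x + p2 z) - u x\<bar>"
    "\<bar>u (x + p2 z) - u (x + z)\<bar> = \<bar>u (x + z) - u (x + p2 z)\<bar>" "\<bar>u (x + p1 z) - u (x + z)\<bar> = \<bar>u (x + z) - u (x + p1 z)\<bar>"
    by simp_all
  show ?thesis
    unfolding edge_product_def
    by (simp add: p1_diff p2_diff p1_minus p2_minus n c s ennreal_plus[symmetric] del: ennreal_plus)
      (simp add: algebra_simps add_divide_distrib)
qed

lemma integrable_plus_bounded:
  fixes u \<psi> :: "'a \<Rightarrow> real"
  assumes u: "integrable lborel u" and [measurable]: "\<psi> \<in> borel_measurable borel" and B: "\<And>x. \<bar>\<psi> x\<bar> \<le> B"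
  shows "integrable lborel (\<lambda>x. u (x + c) * \<psi> x)"
  by (rule integrable_mult_bounded[OF lborel_integrable_plus[OF u] _ B]) auto

lemma integral_shift_mult:
  fixes u \<psi> :: "'a \<Rightarrow> real"
  assumes u: "integrable lborel u" and [measurable]: "\<psi> \<in> borel_measurable borel" and B: "\<And>x. \<bar>\<psi> x\<bar> \<le> B"
  shows "integrable lborel (\<lambda>x. u x * \<psi> (x - c))"
    and "(\<integral>x. u x * \<psi> (x - c) \<partial>lborel) = (\<integral>x. u (x + c) * \<psi> x \<partial>lborel)"
proof -
  have [measurable]: "u \<in> borel_measurable borel" using u by auto
  show "integrable lborel (\<lambda>x. u x * \<psi> (x - c))"
    by (rule integrable_mult_bounded[OF u _ B]) auto
  show "(\<integral>x. u x * \<psi> (x - c) \<partial>lborel) = (\<integral>x. u (x + c) * \<psi> x \<partial>lborel)"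
    using lborel_integral_plus[of "\<lambda>x. u x * \<psi> (x - c)" c] by simp
qed

text \<open>The second difference of \<open>u\<close> is the difference in direction \<open>p1 z\<close> of the vertical difference
  \<open>b\<close>.  The truncation of \<open>b\<close> is at most \<open>l * norm z\<close>, and moving the horizontal difference to \<open>\<psi>\<close>
  costs the \<open>L\<^sup>1\<close> norm of the horizontal gradient.  The excess of \<open>b\<close> is controlled by the energy
  density at the four corners, and shifting each corner to \<open>x\<close> enlarges the support \<open>S\<close> of \<open>\<psi>\<close> to
  \<open>K\<close>.\<close>
lemma single_displacement_bound:
  fixes u \<psi> :: "'a \<Rightarrow> real"
  assumes u: "integrable lborel u" and uV: "\<And>x. u x \<in> V"
    and d: "\<psi> differentiable_on UNIV" and c: "\<And>v. continuous_on UNIV (dir_deriv v \<psi>)"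
    and B: "\<And>x. \<bar>\<psi> x\<bar> \<le> B" and S[measurable]: "S \<in> sets borel" and S0: "\<And>x. x \<notin> S \<Longrightarrow> \<psi> x = 0"
    and m: "emeasure lborel S \<le> ennreal m" and m0: "0 \<le> m"
    and A: "(\<integral>\<^sup>+x. ennreal (sqrt (\<Sum>i\<in>UNIV. (dir_deriv (e i) \<psi> x)\<^sup>2)) \<partial>lborel) \<le> ennreal A" and A0: "0 \<le> A"
    and K[measurable]: "K \<in> sets borel"
    and SK: "\<And>x. x \<in> S \<Longrightarrow> x \<in> K \<and> x + p1 z \<in> K \<and> x + p2 z \<in> K \<and> x + z \<in> K"
    and l: "0 \<le> l" "0 \<le> \<alpha>" "0 \<le> \<beta>" and eb: "excess_bound V \<theta>1 \<theta>2 p l \<alpha> \<beta>"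
    and z: "z \<noteq> 0"
  shows "ennreal (\<bar>\<integral>x. u x * diff2 \<psi> (p1 z) (p2 z) x \<partial>lborel\<bar> / (norm z)\<^sup>2) \<le>
     ennreal (l * A + B * \<alpha> * m) + ennreal (B * \<beta>) *
       (slice_energy \<theta>1 \<theta>2 p u K z + slice_energy \<theta>1 \<theta>2 p u K (p2 z - p1 z) +
        slice_energy \<theta>1 \<theta>2 p u K (p1 z - p2 z) + slice_energy \<theta>1 \<theta>2 p u K (- z))"
proof -
  define t where "t = l * norm z"
  have t0: "0 \<le> t" using l by (simp add: t_def)
  have B0: "0 \<le> B" using B[of 0] by linarith
  have nz: "norm z > 0" using z by simp
  have [measurable]: "u \<in> borel_measurable borel" using u by auto
  have \<psi>c: "continuous_on UNIV \<psi>" using d by (rule differentiable_imp_continuous_on)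
  then have [measurable]: "\<psi> \<in> borel_measurable borel" by (rule borel_measurable_continuous_onI)
  have [measurable]: "dir_deriv v \<psi> \<in> borel_measurable borel" for v
    by (rule borel_measurable_continuous_onI[OF c])
  define b where "b x = u (x + p2 z) - u x" for x
  have b: "integrable lborel b" unfolding b_def using u by (intro Bochner_Integration.integrable_diff lborel_integrable_plus)
  have [measurable]: "b \<in> borel_measurable borel" using b by auto
  have T: "integrable lborel (\<lambda>x. trunc t (b x))"
    by (rule Bochner_Integration.integrable_bound[OF b]) (auto simp: trunc_le' t0)
  have E: "integrable lborel (\<lambda>x. excess t (b x))"
    unfolding excess_def by (intro Bochner_Integration.integrable_diff b T)
  have zz: "x + p1 z + p2 z = x + z" for x using p1_p2[of z] by (simp add: algebra_simps)
  note sh = integral_shift_mult[OF u _ B] and sh' = integrable_plus_bounded[OF u _ B]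
  have x0: "(\<integral>x. u x * diff2 \<psi> (p1 z) (p2 z) x \<partial>lborel) =
     (\<integral>x. u x * \<psi> (x - z) - u x * \<psi> (x - p1 z) - u x * \<psi> (x - p2 z) + u x * \<psi> (x - 0) \<partial>lborel)"
  proof -
    have zm: "x - p1 z - p2 z = x - z" for x using p1_p2[of z] by (simp add: algebra_simps)
    show ?thesis by (simp add: diff2_def algebra_simps zm[unfolded diff_diff_eq])
  qed
  also have "\<dots> = (\<integral>x. u x * \<psi> (x - z) \<partial>lborel) - (\<integral>x. u x * \<psi> (x - p1 z) \<partial>lborel)
      - (\<integral>x. u x * \<psi> (x - p2 z) \<partial>lborel) + (\<integral>x. u x * \<psi> (x - 0) \<partial>lborel)"
    by (intro integral_alternating4 sh) measurable
  also have "\<dots> = (\<integral>x. u (x + z) * \<psi> x \<partial>lborel) - (\<integral>x. u (x + p1 z) * \<psi> x \<partial>lborel)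
      - (\<integral>x. u (x + p2 z) * \<psi> x \<partial>lborel) + (\<integral>x. u (x + 0) * \<psi> x \<partial>lborel)"
    by (intro arg_cong2[where f = "(+)"] arg_cong2[where f = "(-)"] sh(2)) measurable
  also have "\<dots> = (\<integral>x. u (x + z) * \<psi> x - u (x + p1 z) * \<psi> x - u (x + p2 z) * \<psi> x + u (x + 0) * \<psi> x \<partial>lborel)"
    by (intro integral_alternating4[symmetric] sh') measurable
  also have "\<dots> = (\<integral>x. (trunc t (b (x + p1 z)) * \<psi> x - trunc t (b x) * \<psi> x) +
      (excess t (b (x + p1 z)) * \<psi> x - excess t (b x) * \<psi> x) \<partial>lborel)"
    by (rule Bochner_Integration.integral_cong) (simp_all add: excess_def b_def p1_p2 algebra_simps)
  also have "\<dots> = (\<integral>x. trunc t (b (x + p1 z)) * \<psi> x - trunc t (b x) * \<psi> x \<partial>lborel) +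
      (\<integral>x. excess t (b (x + p1 z)) * \<psi> x - excess t (b x) * \<psi> x \<partial>lborel)"
    using integrable_plus_bounded[OF T _ B] integrable_plus_bounded[OF E _ B]
      integrable_plus_bounded[OF T _ B, where c = 0] integrable_plus_bounded[OF E _ B, where c = 0]
    by (intro Bochner_Integration.integral_add Bochner_Integration.integrable_diff) auto
  also have "(\<integral>x. trunc t (b (x + p1 z)) * \<psi> x - trunc t (b x) * \<psi> x \<partial>lborel) =
      (\<integral>x. trunc t (b x) * (\<psi> (x - p1 z) - \<psi> x) \<partial>lborel)"
  proof -
    have "(\<integral>x. trunc t (b (x + p1 z)) * \<psi> x - trunc t (b x) * \<psi> x \<partial>lborel) =
      (\<integral>x. trunc t (b (x + p1 z)) * \<psi> x \<partial>lborel) - (\<integral>x. trunc t (b x) * \<psi> x \<partial>lborel)"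
      using integrable_plus_bounded[OF T _ B] integrable_plus_bounded[OF T _ B, where c = 0]
      by (intro Bochner_Integration.integral_diff) auto
    also have "\<dots> = (\<integral>x. trunc t (b x) * \<psi> (x - p1 z) \<partial>lborel) - (\<integral>x. trunc t (b x) * \<psi> x \<partial>lborel)"
      by (subst integral_shift_mult(2)[OF T _ B]) auto
    also have "\<dots> = (\<integral>x. trunc t (b x) * \<psi> (x - p1 z) - trunc t (b x) * \<psi> x \<partial>lborel)"
      using integral_shift_mult(1)[OF T _ B] integral_shift_mult(1)[OF T _ B, where c = 0]
      by (intro Bochner_Integration.integral_diff[symmetric]) auto
    finally show ?thesis by (simp add: right_diff_distrib)
  qed
  finally have I: "(\<integral>x. u x * diff2 \<psi> (p1 z) (p2 z) x \<partial>lborel) =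
      (\<integral>x. trunc t (b x) * (\<psi> (x - p1 z) - \<psi> x) \<partial>lborel) +
      (\<integral>x. excess t (b (x + p1 z)) * \<psi> x - excess t (b x) * \<psi> x \<partial>lborel)" (is "_ = ?I1 + ?I2") .
  have I1: "ennreal \<bar>?I1\<bar> \<le> ennreal ((norm z)\<^sup>2 * (l * A))"
  proof -
    have "integrable lborel (\<lambda>x. trunc t (b x) * (\<psi> (x - p1 z) - \<psi> x))"
    proof (rule integrable_mult_bounded[OF T])
      show "\<bar>\<psi> (x - p1 z) - \<psi> x\<bar> \<le> B + B" for x using B[of "x - p1 z"] B[of x] by linarith
    qed measurable
    then have "ennreal \<bar>?I1\<bar> \<le> (\<integral>\<^sup>+x. ennreal \<bar>trunc t (b x) * (\<psi> (x - p1 z) - \<psi> x)\<bar> \<partial>lborel)"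
      using integral_norm_bound_ennreal by (metis (no_types, lifting) real_norm_def nn_integral_cong)
    also have "\<dots> \<le> (\<integral>\<^sup>+x. ennreal t * ennreal \<bar>\<psi> (x + p1 (- z)) - \<psi> x\<bar> \<partial>lborel)"
      by (intro nn_integral_mono) (auto simp: abs_mult ennreal_mult[symmetric] t0 trunc_le p1_minus intro!: ennreal_leI mult_right_mono)
    also have "\<dots> = ennreal t * (\<integral>\<^sup>+x. ennreal \<bar>\<psi> (x + p1 (- z)) - \<psi> x\<bar> \<partial>lborel)"
      by (rule nn_integral_cmult) measurable
    also have "\<dots> \<le> ennreal t * (\<integral>\<^sup>+x. ennreal \<bar>dir_deriv (p1 (- z)) \<psi> x\<bar> \<partial>lborel)"
      by (intro mult_left_mono nn_integral_difference_le d c) auto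
    also have "\<dots> \<le> ennreal t * (\<integral>\<^sup>+x. ennreal (norm z) * ennreal (sqrt (\<Sum>i\<in>UNIV. (dir_deriv (e i) \<psi> x)\<^sup>2)) \<partial>lborel)"
    proof (intro mult_left_mono nn_integral_mono)
      fix x
      have "\<bar>dir_deriv (p1 (- z)) \<psi> x\<bar> \<le> norm (p1 (- z)) * sqrt (\<Sum>i\<in>UNIV. (dir_deriv (e i) \<psi> x)\<^sup>2)"
        by (rule dir_deriv_p1_le[OF d])
      also have "\<dots> \<le> norm z * sqrt (\<Sum>i\<in>UNIV. (dir_deriv (e i) \<psi> x)\<^sup>2)"
        using norm_p1[of "- z"] by (intro mult_right_mono) (auto intro: sum_nonneg)
      finally show "ennreal \<bar>dir_deriv (p1 (- z)) \<psi> x\<bar> \<le> ennreal (norm z) * ennreal (sqrt (\<Sum>i\<in>UNIV. (dir_deriv (e i) \<psi> x)\<^sup>2))"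
        by (simp add: ennreal_mult[symmetric] sum_nonneg ennreal_leI)
    qed auto
    also have "\<dots> = ennreal t * (ennreal (norm z) * (\<integral>\<^sup>+x. ennreal (sqrt (\<Sum>i\<in>UNIV. (dir_deriv (e i) \<psi> x)\<^sup>2)) \<partial>lborel))"
      by (subst nn_integral_cmult) auto
    also have "\<dots> \<le> ennreal t * (ennreal (norm z) * ennreal A)"
      by (intro mult_left_mono A) auto
    also have "\<dots> = ennreal ((norm z)\<^sup>2 * (l * A))"
      using l A0 by (simp add: t_def ennreal_mult[symmetric] power2_eq_square mult_ac)
    finally show ?thesis .
  qed
  define W where "W x = edge_product \<theta>1 \<theta>2 p u z x + edge_product \<theta>1 \<theta>2 p u (p2 z - p1 z) (x + p1 z) +
     edge_product \<theta>1 \<theta>2 p u (p1 z - p2 z) (x + p2 z) + edge_product \<theta>1 \<theta>2 p u (- z) (x + z)" for x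
  define G where "G = slice_energy \<theta>1 \<theta>2 p u K z + slice_energy \<theta>1 \<theta>2 p u K (p2 z - p1 z) +
        slice_energy \<theta>1 \<theta>2 p u K (p1 z - p2 z) + slice_energy \<theta>1 \<theta>2 p u K (- z)"
  have [measurable]: "W \<in> borel_measurable borel" unfolding W_def by measurable
  have WG: "(\<integral>\<^sup>+x. W x * indicator S x \<partial>lborel) \<le> G"
  proof -
    have "(\<integral>\<^sup>+x. W x * indicator S x \<partial>lborel) = (\<integral>\<^sup>+x. edge_product \<theta>1 \<theta>2 p u z (x + 0) * indicator S x \<partial>lborel)
     + (\<integral>\<^sup>+x. edge_product \<theta>1 \<theta>2 p u (p2 z - p1 z) (x + p1 z) * indicator S x \<partial>lborel)
     + (\<integral>\<^sup>+x. edge_product \<theta>1 \<theta>2 p u (p1 z - p2 z) (x + p2 z) * indicator S x \<partial>lborel)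
     + (\<integral>\<^sup>+x. edge_product \<theta>1 \<theta>2 p u (- z) (x + z) * indicator S x \<partial>lborel)"
      unfolding W_def by (simp add: distrib_right nn_integral_add)
    also have "\<dots> \<le> G"
      unfolding G_def slice_energy_def
      by (intro add_mono nn_integral_shift_le) (use SK in auto)
    finally show ?thesis .
  qed
  have I2: "ennreal \<bar>?I2\<bar> \<le> ennreal ((norm z)\<^sup>2) * (ennreal (B * \<alpha> * m) + ennreal (B * \<beta>) * G)"
  proof -
    have "integrable lborel (\<lambda>x. excess t (b (x + p1 z)) * \<psi> x - excess t (b x) * \<psi> x)"
      using integrable_plus_bounded[OF E _ B] integrable_plus_bounded[OF E _ B, where c = 0]
      by (intro Bochner_Integration.integrable_diff) auto
    then have "ennreal \<bar>?I2\<bar> \<le> (\<integral>\<^sup>+x. ennreal \<bar>excess t (b (x + p1 z)) * \<psi> x - excess t (b x) * \<psi> x\<bar> \<partial>lborel)"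
      using integral_norm_bound_ennreal by (metis (no_types, lifting) real_norm_def nn_integral_cong)
    also have "\<dots> \<le> (\<integral>\<^sup>+x. ennreal ((norm z)\<^sup>2) * (ennreal (B * \<alpha>) * indicator S x + ennreal (B * \<beta>) * (W x * indicator S x)) \<partial>lborel)"
    proof (rule nn_integral_mono)
      fix x
      define w where "w = (\<bar>u (x + p1 z) - u x\<bar> powr \<theta>1 + \<bar>u (x + z) - u (x + p2 z)\<bar> powr \<theta>1) *
      (\<bar>u (x + p2 z) - u x\<bar> powr \<theta>2 + \<bar>u (x + z) - u (x + p1 z)\<bar> powr \<theta>2) / norm z powr p"
      have w0: "0 \<le> w" unfolding w_def by (intro divide_nonneg_nonneg mult_nonneg_nonneg) auto
      have Ww: "W x = ennreal w" unfolding W_def w_def corner_sum[OF z] ..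
      show "ennreal \<bar>excess t (b (x + p1 z)) * \<psi> x - excess t (b x) * \<psi> x\<bar> \<le>
        ennreal ((norm z)\<^sup>2) * (ennreal (B * \<alpha>) * indicator S x + ennreal (B * \<beta>) * (W x * indicator S x))"
      proof (cases "x \<in> S")
        case True
        have "\<bar>excess t (b (x + p1 z)) - excess t (b x)\<bar> / (norm z)\<^sup>2 \<le> \<alpha> + \<beta> * w"
          using eb nz uV unfolding excess_bound_def w_def b_def t_def zz by blast
        then have 1: "\<bar>excess t (b (x + p1 z)) - excess t (b x)\<bar> \<le> (norm z)\<^sup>2 * (\<alpha> + \<beta> * w)"
          using nz by (simp add: field_simps)
        have "\<bar>excess t (b (x + p1 z)) * \<psi> x - excess t (b x) * \<psi> x\<bar> = \<bar>excess t (b (x + p1 z)) - excess t (b x)\<bar> * \<bar>\<psi> x\<bar>"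
          by (simp add: abs_mult[symmetric] left_diff_distrib)
        also have "\<dots> \<le> (norm z)\<^sup>2 * (\<alpha> + \<beta> * w) * B"
          by (intro mult_mono 1 B) (use l w0 in auto)
        finally have "ennreal \<bar>excess t (b (x + p1 z)) * \<psi> x - excess t (b x) * \<psi> x\<bar> \<le> ennreal ((norm z)\<^sup>2 * (B * \<alpha> + B * \<beta> * w))"
          by (intro ennreal_leI) (simp add: algebra_simps)
        also have "\<dots> = ennreal ((norm z)\<^sup>2) * (ennreal (B * \<alpha>) + ennreal (B * \<beta>) * W x)"
          using l B0 w0 by (simp add: Ww ennreal_mult[symmetric] ennreal_plus[symmetric] del: ennreal_plus)
        finally show ?thesis using True by simp
      qed (simp add: S0)
    qed
    also have "\<dots> = ennreal ((norm z)\<^sup>2) * (ennreal (B * \<alpha>) * emeasure lborel S + ennreal (B * \<beta>) * (\<integral>\<^sup>+x. W x * indicator S x \<partial>lborel))"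
      by (simp add: nn_integral_cmult nn_integral_add)
    also have "\<dots> \<le> ennreal ((norm z)\<^sup>2) * (ennreal (B * \<alpha>) * ennreal m + ennreal (B * \<beta>) * G)"
      by (intro mult_left_mono add_mono m WG) auto
    finally show ?thesis using l B0 m0 by (simp add: ennreal_mult[symmetric])
  qed
  have "ennreal \<bar>\<integral>x. u x * diff2 \<psi> (p1 z) (p2 z) x \<partial>lborel\<bar> \<le> ennreal \<bar>?I1\<bar> + ennreal \<bar>?I2\<bar>"
    unfolding I by (simp add: ennreal_plus[symmetric] ennreal_leI abs_triangle_ineq del: ennreal_plus)
  also have "\<dots> \<le> ennreal ((norm z)\<^sup>2 * (l * A)) + ennreal ((norm z)\<^sup>2) * (ennreal (B * \<alpha> * m) + ennreal (B * \<beta>) * G)"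
    by (intro add_mono I1 I2)
  also have "\<dots> = ennreal ((norm z)\<^sup>2) * (ennreal (l * A + B * \<alpha> * m) + ennreal (B * \<beta>) * G)"
    using l A0 B0 m0 by (simp add: ennreal_mult distrib_left add.assoc)
  finally have "ennreal (1 / (norm z)\<^sup>2) * ennreal \<bar>\<integral>x. u x * diff2 \<psi> (p1 z) (p2 z) x \<partial>lborel\<bar>
    \<le> ennreal (1 / (norm z)\<^sup>2) * (ennreal ((norm z)\<^sup>2) * (ennreal (l * A + B * \<alpha> * m) + ennreal (B * \<beta>) * G))"
    by (intro mult_left_mono) auto
  also have "\<dots> = ennreal (l * A + B * \<alpha> * m) + ennreal (B * \<beta>) * G"
    using nz by (simp add: mult.assoc[symmetric] ennreal_mult[symmetric])
  also have "ennreal (1 / (norm z)\<^sup>2) * ennreal \<bar>\<integral>x. u x * diff2 \<psi> (p1 z) (p2 z) x \<partial>lborel\<bar> =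
     ennreal (\<bar>\<integral>x. u x * diff2 \<psi> (p1 z) (p2 z) x \<partial>lborel\<bar> / (norm z)\<^sup>2)"
    by (simp add: ennreal_mult[symmetric])
  finally show ?thesis unfolding G_def .
qed

end

section \<open>Averaging over the kernel\<close>

lemma isometric_involution_uminus: "isometric_involution uminus"
  by (auto simp: isometric_involution_def intro!: linearI)

lemma isometric_involution_reflection:
  assumes "v \<bullet> v = 1"
  shows "isometric_involution (\<lambda>y. y - (2 * (y \<bullet> v)) *\<^sub>R v)"
proof -
  have "norm (y - (2 * (y \<bullet> v)) *\<^sub>R v) = norm y" for y
    unfolding norm_eq_sqrt_inner using assms
    by (simp add: inner_diff_left inner_diff_right inner_commute algebra_simps)
  then show ?thesis
    using assms by (auto simp: isometric_involution_def inner_diff_left inner_add_left algebra_simps intro!: linearI)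
qed

lemma reflection_inner:
  assumes "norm a = 1" "norm a' = 1" "a \<noteq> a'" "v = (a - a') /\<^sub>R norm (a - a')"
  shows "v \<bullet> v = 1" "(y - (2 * (y \<bullet> v)) *\<^sub>R v) \<bullet> a = y \<bullet> a'"
proof -
  define n where "n = norm (a - a')"
  have n: "n > 0" using assms by (simp add: n_def)
  have v: "v = (a - a') /\<^sub>R n" using assms by (simp add: n_def)
  have nn: "n\<^sup>2 = 2 - 2 * (a \<bullet> a')"
    using assms by (simp add: n_def power2_norm_eq_inner inner_diff_left inner_diff_right norm_eq_1 inner_commute)
  have "(a - a') \<bullet> (a - a') = n\<^sup>2" by (simp add: n_def power2_norm_eq_inner)
  then show "v \<bullet> v = 1" using n by (simp add: v power2_eq_square) (simp add: field_simps)
  have "2 * (v \<bullet> a) = n"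
  proof -
    have "2 * (v \<bullet> a) = (2 - 2 * (a \<bullet> a')) / n"
      using assms by (simp add: v inner_diff_left norm_eq_1 inner_commute divide_inverse algebra_simps)
    also have "\<dots> = n" using n unfolding nn[symmetric] by (simp add: power2_eq_square)
    finally show ?thesis .
  qed
  then have "(y - (2 * (y \<bullet> v)) *\<^sub>R v) \<bullet> a = y \<bullet> a - (y \<bullet> v) * n"
    by (simp add: inner_diff_left algebra_simps)
  also have "\<dots> = y \<bullet> a'" using n by (simp add: v inner_diff_right field_simps)
  finally show "(y - (2 * (y \<bullet> v)) *\<^sub>R v) \<bullet> a = y \<bullet> a'" .
qed

lemma inner_sq_le: "norm a = 1 \<Longrightarrow> \<bar>y \<bullet> a\<bar> \<le> norm y"
  using Cauchy_Schwarz_ineq2[of y a] by simp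

lemma weight_bound:
  fixes y a b c d :: "'a::real_inner"
  assumes "norm a = 1" "norm b = 1" "norm c = 1" "norm d = 1"
  shows "\<bar>(y \<bullet> a) * (y \<bullet> b) / norm y ^ 4 * ((y \<bullet> c) * (y \<bullet> d))\<bar> \<le> 1"
proof (cases "y = 0")
  case False
  have "\<bar>(y \<bullet> a) * (y \<bullet> b)\<bar> * \<bar>(y \<bullet> c) * (y \<bullet> d)\<bar> \<le> (norm y * norm y) * (norm y * norm y)"
    unfolding abs_mult by (intro mult_mono inner_sq_le assms) auto
  then show ?thesis using False by (simp add: abs_mult field_simps power4_eq_xxxx)
qed simp

context reflection_invariant_kernel
begin

text \<open>The normalising constant of the averaging.  By reflection invariance it is the same for all
  orthogonal pairs of unit vectors (\<open>second_moment_eq\<close>).\<close>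

definition second_moment :: "'a \<Rightarrow> 'a \<Rightarrow> real" where
  "second_moment a b = (\<integral>y. r y * ((y \<bullet> a) * (y \<bullet> b) / norm y ^ 4 * ((y \<bullet> a) * (y \<bullet> b))) \<partial>lborel)"

lemma second_moment_commute: "second_moment a b = second_moment b a"
  by (simp add: second_moment_def mult_ac)

lemma second_moment_eq1:
  assumes "norm a = 1" "norm a' = 1" "a \<bullet> b = 0" "a' \<bullet> b = 0"
  shows "second_moment a b = second_moment a' b"
proof (cases "a = a'")
  case False
  define v where "v = (a - a') /\<^sub>R norm (a - a')"
  define R where "R = (\<lambda>y. y - (2 * (y \<bullet> v)) *\<^sub>R v)"
  note v = reflection_inner[OF assms(1,2) False v_def]
  have R: "isometric_involution R" unfolding R_def by (rule isometric_involution_reflection[OF v(1)])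
  have b: "R y \<bullet> b = y \<bullet> b" for y
    using assms by (simp add: R_def v_def inner_diff_left)
  have a: "R y \<bullet> a = y \<bullet> a'" for y using v(2) by (simp add: R_def)
  have n: "norm (R y) = norm y" for y using R by (simp add: isometric_involution_def)
  show ?thesis
    using integral_kernel_invariant[OF R, of "\<lambda>y. (y \<bullet> a) * (y \<bullet> b) / norm y ^ 4 * ((y \<bullet> a) * (y \<bullet> b))"]
    by (simp add: second_moment_def a b n)
qed simp

lemma second_moment_eq:
  assumes "norm a = 1" "norm a' = 1" "norm b = 1" "norm b' = 1" "a \<bullet> b = 0" "a' \<bullet> b = 0" "a' \<bullet> b' = 0"
  shows "second_moment a b = second_moment a' b'"
proof -
  have "second_moment a b = second_moment a' b" using assms by (intro second_moment_eq1)
  also have "\<dots> = second_moment b a'" by (rule second_moment_commute)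
  also have "\<dots> = second_moment b' a'" using assms by (intro second_moment_eq1) (simp_all add: inner_commute)
  finally show ?thesis by (simp add: second_moment_commute)
qed

lemma second_moment_pos:
  assumes "norm a = 1" "norm b = 1"
  shows "second_moment a b > 0"
proof -
  let ?g = "\<lambda>y. r y * ((y \<bullet> a) * (y \<bullet> b) / norm y ^ 4 * ((y \<bullet> a) * (y \<bullet> b)))"
  have g0: "0 \<le> ?g y" for y
  proof -
    have "?g y = r y * (((y \<bullet> a) * (y \<bullet> b))\<^sup>2 / norm y ^ 4)" by (simp add: power2_eq_square)
    then show ?thesis by (simp add: kernel_nonneg)
  qed
  have int: "integrable lborel ?g"
    by (rule integrable_kernel_mult[OF _ weight_bound]) (use assms in auto)
  have "second_moment a b \<noteq> 0"
  proof
    assume "second_moment a b = 0"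
    then have ae: "AE y in lborel. ?g y = 0"
      using integral_nonneg_eq_0_iff_AE[OF int] g0 by (simp add: second_moment_def)
    have hyp: "AE y in lborel. y \<bullet> c \<noteq> 0" if "norm c = 1" for c :: 'a
    proof -
      have "c \<noteq> 0" using that by auto
      then have "negligible {x. c \<bullet> x = 0}" by (intro negligible_hyperplane) auto
      then have "{x. c \<bullet> x = 0} \<in> null_sets lebesgue" by (simp add: negligible_iff_null_sets)
      moreover have "{x. c \<bullet> x = 0} \<in> sets lborel" 
        using closed_hyperplane[of c 0] by simp
      ultimately have "{x. c \<bullet> x = 0} \<in> null_sets lborel" by (auto simp: null_sets_def)
      then show ?thesis by (rule AE_I'[of "{x. c \<bullet> x = 0}"]) (auto simp: inner_commute)
    qed
    have "AE y in lborel. r y = 0"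
      using ae hyp[OF assms(1)] hyp[OF assms(2)]
    proof eventually_elim
      case (elim y)
      then have "norm y \<noteq> 0" by auto
      then show ?case using elim by auto
    qed
    then have "(\<integral>\<^sup>+y. ennreal (r y) \<partial>lborel) = (\<integral>\<^sup>+y. 0 \<partial>(lborel :: 'a measure))"
      by (intro nn_integral_cong_AE) auto
    then show False by (simp add: kernel_mass)
  qed
  moreover have "second_moment a b \<ge> 0"
    unfolding second_moment_def using g0 by (intro Bochner_Integration.integral_nonneg) 
  ultimately show ?thesis by simp
qed

end

locale split_kernel = orthonormal_split e f + reflection_invariant_kernel r
  for e :: "'i::finite \<Rightarrow> 'a::euclidean_space" and f :: "'j::finite \<Rightarrow> 'a" and r :: "'a \<Rightarrow> real"
begin

text \<open>Averaging a second difference against this weight extracts the entry with index \<open>(i, j)\<close> of the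
  mixed Hessian: the bilinear form \<open>(y \<bullet> e k) * (y \<bullet> f l)\<close> has average zero for all other indices, as
  a reflection changes its sign (\<open>moment\<close>).\<close>

definition weight :: "'i \<Rightarrow> 'j \<Rightarrow> 'a \<Rightarrow> real" where
  "weight i j y = (y \<bullet> e i) * (y \<bullet> f j) / norm y ^ 4"

lemma weight_measurable[measurable]: "weight i j \<in> borel_measurable borel"
  unfolding weight_def by measurable

lemma norm_e: "norm (e i) = 1" and norm_f: "norm (f j) = 1"
  by (simp_all add: norm_eq_1 ee ff)

lemma weight_le: "\<bar>weight i j y\<bar> \<le> 1 / (norm y)\<^sup>2"
proof (cases "y = 0")
  case False
  have "\<bar>(y \<bullet> e i) * (y \<bullet> f j)\<bar> \<le> norm y * norm y"
    unfolding abs_mult by (intro mult_mono inner_sq_le norm_e norm_f) auto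
  then show ?thesis using False
    by (simp add: weight_def field_simps power2_eq_square power4_eq_xxxx)
qed (simp add: weight_def)

lemma moment:
  "(\<integral>y. r y * (weight i j y * ((y \<bullet> e k) * (y \<bullet> f l))) \<partial>lborel) =
    (if k = i \<and> l = j then second_moment (e i) (f j) else 0)"
proof -
  have odd: "(\<integral>y. r y * h y \<partial>lborel) = 0"
    if R: "isometric_involution R" and [measurable]: "h \<in> borel_measurable borel" and hR: "\<And>y. h (R y) = - h y"
    for R and h :: "'a \<Rightarrow> real"
    using integral_kernel_invariant[OF R, of h] by (simp add: hR)
  have mh: "(\<lambda>y. weight i j y * ((y \<bullet> e k) * (y \<bullet> f l))) \<in> borel_measurable borel" by measurable
  consider "k \<noteq> i" | "l \<noteq> j" | "k = i" "l = j" by blast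
  then show ?thesis
  proof cases
    case 1
    let ?R = "\<lambda>y. y - (2 * (y \<bullet> e i)) *\<^sub>R e i"
    have R: "isometric_involution ?R" by (rule isometric_involution_reflection) (simp add: ee)
    then have n: "norm (?R y) = norm y" for y by (simp add: isometric_involution_def)
    have "(\<integral>y. r y * (weight i j y * ((y \<bullet> e k) * (y \<bullet> f l))) \<partial>lborel) = 0"
      by (rule odd[OF R mh]) (use 1 in \<open>simp add: weight_def n inner_diff_left ee ef algebra_simps\<close>)
    then show ?thesis using 1 by simp
  next
    case 2
    let ?R = "\<lambda>y. y - (2 * (y \<bullet> f j)) *\<^sub>R f j"
    have R: "isometric_involution ?R" by (rule isometric_involution_reflection) (simp add: ff)
    then have n: "norm (?R y) = norm y" for y by (simp add: isometric_involution_def)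
    have "(\<integral>y. r y * (weight i j y * ((y \<bullet> e k) * (y \<bullet> f l))) \<partial>lborel) = 0"
      by (rule odd[OF R mh]) (use 2 in \<open>simp add: weight_def n inner_diff_left ff fe algebra_simps\<close>)
    then show ?thesis using 2 by simp
  next
    case 3
    then show ?thesis by (simp add: second_moment_def weight_def)
  qed
qed

text \<open>The regularised pairing of \<open>u\<close> with \<open>\<psi>\<close> at scale \<open>\<epsilon>\<close>, written in the rescaled displacement
  \<open>y = z / \<epsilon>\<close>.\<close>

definition averaged :: "'i \<Rightarrow> 'j \<Rightarrow> ('a \<Rightarrow> real) \<Rightarrow> ('a \<Rightarrow> real) \<Rightarrow> real \<Rightarrow> real" where
  "averaged i j u \<psi> \<epsilon> = (\<integral>y. r y * (weight i j y *
     (\<integral>x. u x * (diff2 \<psi> (\<epsilon> *\<^sub>R p1 y) (\<epsilon> *\<^sub>R p2 y) x / \<epsilon>\<^sup>2) \<partial>lborel)) \<partial>lborel)"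

text \<open>Each of the four corners contributes the same average, because the kernel is invariant under
  the changes of sign of the two components; this is the factor 4.\<close>
lemma averaged_bound:
  fixes u \<psi> :: "'a \<Rightarrow> real"
  assumes u: "integrable lborel u" and uV: "\<And>x. u x \<in> V"
    and d: "\<psi> differentiable_on UNIV" and c: "\<And>v. continuous_on UNIV (dir_deriv v \<psi>)"
    and B: "\<And>x. \<bar>\<psi> x\<bar> \<le> B" and S: "S \<in> sets borel" and S0: "\<And>x. x \<notin> S \<Longrightarrow> \<psi> x = 0"
    and m: "emeasure lborel S \<le> ennreal m" and m0: "0 \<le> m"
    and A: "(\<integral>\<^sup>+x. ennreal (sqrt (\<Sum>i\<in>UNIV. (dir_deriv (e i) \<psi> x)\<^sup>2)) \<partial>lborel) \<le> ennreal A" and A0: "0 \<le> A"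
    and K[measurable]: "K \<in> sets borel"
    and SK: "\<And>x v. x \<in> S \<Longrightarrow> norm v \<le> \<epsilon> \<Longrightarrow> x + v \<in> K" and \<epsilon>: "0 < \<epsilon>"
    and l: "0 \<le> l" "0 \<le> \<alpha>" "0 \<le> \<beta>" and eb: "excess_bound V \<theta>1 \<theta>2 p l \<alpha> \<beta>"
    and En: "(\<integral>\<^sup>+y. ennreal (r y) * slice_energy \<theta>1 \<theta>2 p u K (\<epsilon> *\<^sub>R y) \<partial>lborel) \<le> ennreal En" and En0: "0 \<le> En"
  shows "\<bar>averaged i j u \<psi> \<epsilon>\<bar> \<le> l * A + B * \<alpha> * m + B * \<beta> * (4 * En)"
proof -
  have B0: "0 \<le> B" using B[of 0] by linarith
  have [measurable]: "u \<in> borel_measurable borel" using u by auto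
  define h where "h y = slice_energy \<theta>1 \<theta>2 p u K (\<epsilon> *\<^sub>R y)" for y
  have [measurable]: "h \<in> borel_measurable borel" unfolding h_def by measurable
  define c0 where "c0 = l * A + B * \<alpha> * m"
  have c0: "0 \<le> c0" unfolding c0_def using l A0 B0 m0 by simp
  define I where "I y = (\<integral>x. u x * (diff2 \<psi> (\<epsilon> *\<^sub>R p1 y) (\<epsilon> *\<^sub>R p2 y) x / \<epsilon>\<^sup>2) \<partial>lborel)" for y
  have "ennreal \<bar>averaged i j u \<psi> \<epsilon>\<bar> \<le> (\<integral>\<^sup>+y. ennreal \<bar>r y * (weight i j y * I y)\<bar> \<partial>lborel)"
  proof (cases "integrable lborel (\<lambda>y. r y * (weight i j y * I y))")
    case True
    from integral_norm_bound_ennreal[OF this] show ?thesis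
      unfolding averaged_def I_def[symmetric] by simp
  next
    case False
    then have "(\<integral>y. r y * (weight i j y * I y) \<partial>lborel) = 0" by (rule not_integrable_integral_eq)
    then show ?thesis unfolding averaged_def I_def[symmetric] by simp
  qed
  also have "\<dots> \<le> (\<integral>\<^sup>+y. ennreal c0 * ennreal (r y) + ennreal (B * \<beta>) * (ennreal (r y) * h y + ennreal (r y) * h (p2 y - p1 y)
      + ennreal (r y) * h (p1 y - p2 y) + ennreal (r y) * h (- y)) \<partial>lborel)"
  proof (rule nn_integral_mono)
    fix y :: 'a
    consider "y = 0" | "norm y > 1" | "y \<noteq> 0" "norm y \<le> 1" by fastforce
    then show "ennreal \<bar>r y * (weight i j y * I y)\<bar> \<le> ennreal c0 * ennreal (r y) +
       ennreal (B * \<beta>) * (ennreal (r y) * h y + ennreal (r y) * h (p2 y - p1 y)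
      + ennreal (r y) * h (p1 y - p2 y) + ennreal (r y) * h (- y))"
    proof cases
      case 1 then show ?thesis by (simp add: weight_def)
    next
      case 2 then show ?thesis by (simp add: kernel_support)
    next
      case 3
      have SK': "x \<in> K \<and> x + p1 (\<epsilon> *\<^sub>R y) \<in> K \<and> x + p2 (\<epsilon> *\<^sub>R y) \<in> K \<and> x + \<epsilon> *\<^sub>R y \<in> K" if "x \<in> S" for x
      proof -
        have ny: "norm (\<epsilon> *\<^sub>R y) \<le> \<epsilon>" using 3 \<epsilon> by (simp add: mult_left_le)
        show ?thesis
          using SK[OF that, of 0] SK[OF that, of "\<epsilon> *\<^sub>R y"] SK[OF that, of "p1 (\<epsilon> *\<^sub>R y)"] SK[OF that, of "p2 (\<epsilon> *\<^sub>R y)"]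
            norm_p1[of "\<epsilon> *\<^sub>R y"] norm_p2[of "\<epsilon> *\<^sub>R y"] ny \<epsilon> by auto
      qed
      have Ieq: "I y = (\<integral>x. u x * diff2 \<psi> (p1 (\<epsilon> *\<^sub>R y)) (p2 (\<epsilon> *\<^sub>R y)) x \<partial>lborel) / \<epsilon>\<^sup>2"
        unfolding I_def by (simp add: p1_scale p2_scale)
      have "\<bar>weight i j y * I y\<bar> \<le> 1 / (norm y)\<^sup>2 * \<bar>I y\<bar>"
        unfolding abs_mult by (intro mult_right_mono weight_le) auto
      also have "\<dots> = \<bar>\<integral>x. u x * diff2 \<psi> (p1 (\<epsilon> *\<^sub>R y)) (p2 (\<epsilon> *\<^sub>R y)) x \<partial>lborel\<bar> / (norm (\<epsilon> *\<^sub>R y))\<^sup>2"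
        using \<epsilon> by (simp add: Ieq power_mult_distrib)
      finally have "ennreal \<bar>weight i j y * I y\<bar> \<le> ennreal \<dots>" by (rule ennreal_leI)
      also have "\<dots> \<le> ennreal c0 + ennreal (B * \<beta>) * (h y + h (p2 y - p1 y) + h (p1 y - p2 y) + h (- y))"
        using single_displacement_bound[OF u uV d c B S S0 m m0 A A0 K SK' l eb] 3 \<epsilon>
        by (simp add: c0_def h_def p1_scale p2_scale scaleR_diff_right)
      finally have "ennreal (r y) * ennreal \<bar>weight i j y * I y\<bar> \<le> ennreal (r y) *
          (ennreal c0 + ennreal (B * \<beta>) * (h y + h (p2 y - p1 y) + h (p1 y - p2 y) + h (- y)))"
        by (rule mult_left_mono) simp
      also have "\<dots> = ennreal c0 * ennreal (r y) +
       ennreal (B * \<beta>) * (ennreal (r y) * h y + ennreal (r y) * h (p2 y - p1 y)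
      + ennreal (r y) * h (p1 y - p2 y) + ennreal (r y) * h (- y))"
        by (simp add: distrib_left mult_ac)
      finally show ?thesis
        by (simp add: ennreal_mult[symmetric] kernel_nonneg abs_mult[of "r y"])
    qed
  qed
  also have "\<dots> = ennreal c0 * 1 + ennreal (B * \<beta>) * ((\<integral>\<^sup>+y. ennreal (r y) * h y \<partial>lborel)
     + (\<integral>\<^sup>+y. ennreal (r y) * h (p2 y - p1 y) \<partial>lborel) + (\<integral>\<^sup>+y. ennreal (r y) * h (p1 y - p2 y) \<partial>lborel)
     + (\<integral>\<^sup>+y. ennreal (r y) * h (- y) \<partial>lborel))"
    by (simp add: nn_integral_add nn_integral_cmult kernel_mass)
  also have "\<dots> = ennreal c0 * 1 + ennreal (B * \<beta>) * (4 * (\<integral>\<^sup>+y. ennreal (r y) * h y \<partial>lborel))"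
  proof -
    have 4: "(4::ennreal) * a = a + a + a + a" for a
      by (metis (no_types, opaque_lifting) distrib_right mult_1 numeral_Bit0 numeral_One add.assoc)
    show ?thesis
      unfolding 4 nn_integral_kernel_invariant[OF isometric_involution_flip1 \<open>h \<in> borel_measurable borel\<close>]
        nn_integral_kernel_invariant[OF isometric_involution_flip2 \<open>h \<in> borel_measurable borel\<close>]
        nn_integral_kernel_invariant[OF isometric_involution_uminus \<open>h \<in> borel_measurable borel\<close>] ..
  qed
  also have "\<dots> \<le> ennreal c0 * 1 + ennreal (B * \<beta>) * (4 * ennreal En)"
    using En unfolding h_def by (intro add_mono mult_left_mono) auto
  also have "\<dots> = ennreal (c0 + B * \<beta> * (4 * En))"
  proof -
    have "(4::ennreal) = ennreal 4" by simp
    then show ?thesis using c0 B0 l En0 by (simp add: ennreal_mult ennreal_plus)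
  qed
  finally have "\<bar>averaged i j u \<psi> \<epsilon>\<bar> \<le> c0 + B * \<beta> * (4 * En)"
    using c0 B0 l En0 by (subst (asm) ennreal_le_iff) simp_all
  then show ?thesis by (simp add: c0_def)
qed

end

section \<open>Passage to the limit of small displacements\<close>

lemma dir_deriv_sum:
  fixes g :: "'b \<Rightarrow> 'a::euclidean_space \<Rightarrow> real"
  assumes "\<And>l. g l differentiable_on UNIV"
  shows "dir_deriv v (\<lambda>x. \<Sum>l\<in>L. c l * g l x) x = (\<Sum>l\<in>L. c l * dir_deriv v (g l) x)"
proof -
  have g: "(g l has_derivative frechet_derivative (g l) (at x)) (at x)" for l
    using assms[of l] by (simp add: frechet_derivative_works[symmetric] differentiable_on_def)
  have "((\<lambda>x. \<Sum>l\<in>L. c l * g l x) has_derivative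
      (\<lambda>h. \<Sum>l\<in>L. c l * frechet_derivative (g l) (at x) h)) (at x)"
    by (intro has_derivative_sum has_derivative_mult_right g)
  from frechet_derivative_at[OF this, symmetric] show ?thesis
    by (simp add: dir_deriv_def)
qed

lemma bounded_compact_support:
  fixes g :: "'a::euclidean_space \<Rightarrow> real"
  assumes "continuous_on UNIV g" "compact S" "\<And>x. x \<notin> S \<Longrightarrow> g x = 0"
  obtains M where "0 \<le> M" "\<And>x. \<bar>g x\<bar> \<le> M"
proof -
  have "compact (g ` S)" using assms by (intro compact_continuous_image continuous_on_subset[OF assms(1)]) auto
  then have "bounded (g ` S)" by (rule compact_imp_bounded)
  then obtain M where M: "\<And>x. x \<in> S \<Longrightarrow> \<bar>g x\<bar> \<le> M"
    unfolding bounded_iff by auto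
  have "\<bar>g x\<bar> \<le> \<bar>M\<bar>" for x using M[of x] assms(3)[of x] by (cases "x \<in> S") auto
  then show ?thesis using that[of "\<bar>M\<bar>"] by auto
qed

context split_kernel
begin

lemma dir_deriv2_split:
  fixes \<psi> :: "'a \<Rightarrow> real"
  assumes d: "\<psi> differentiable_on UNIV" and dd: "\<And>w. dir_deriv w \<psi> differentiable_on UNIV"
  shows "dir_deriv (p1 y) (dir_deriv (p2 y) \<psi>) x =
    (\<Sum>k\<in>UNIV. \<Sum>l\<in>UNIV. (y \<bullet> e k) * (y \<bullet> f l) * dir_deriv (e k) (dir_deriv (f l) \<psi>) x)"
proof -
  have 1: "dir_deriv (p2 y) \<psi> = (\<lambda>x. \<Sum>l\<in>UNIV. (y \<bullet> f l) * dir_deriv (f l) \<psi> x)"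
  proof
    fix x
    interpret l: linear "\<lambda>v. dir_deriv v \<psi> x" by (rule dir_deriv_linear[OF d])
    show "dir_deriv (p2 y) \<psi> x = (\<Sum>l\<in>UNIV. (y \<bullet> f l) * dir_deriv (f l) \<psi> x)"
      by (simp add: p2_def l.sum l.scale)
  qed
  interpret l: linear "\<lambda>v. dir_deriv v (dir_deriv (p2 y) \<psi>) x" by (rule dir_deriv_linear[OF dd])
  have "dir_deriv (p1 y) (dir_deriv (p2 y) \<psi>) x = (\<Sum>k\<in>UNIV. (y \<bullet> e k) * dir_deriv (e k) (dir_deriv (p2 y) \<psi>) x)"
    by (simp add: p1_def l.sum l.scale)
  also have "\<dots> = (\<Sum>k\<in>UNIV. \<Sum>l\<in>UNIV. (y \<bullet> e k) * (y \<bullet> f l) * dir_deriv (e k) (dir_deriv (f l) \<psi>) x)"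
    unfolding 1 by (simp add: dir_deriv_sum dd sum_distrib_left mult.assoc)
  finally show ?thesis .
qed

text \<open>As \<open>\<epsilon>\<close> tends to zero, the rescaled second difference of \<open>\<psi>\<close> tends to the Hessian form at \<open>y\<close>,
  boundedly in \<open>x\<close> and with at most quadratic growth in \<open>y\<close>, which the weight compensates.  So
  dominated convergence applies to both integrals.\<close>
lemma averaged_tendsto:
  fixes u \<psi> :: "'a \<Rightarrow> real"
  assumes u: "integrable lborel u"
    and d: "\<psi> differentiable_on UNIV" and dd: "\<And>w. dir_deriv w \<psi> differentiable_on UNIV"
    and cc: "\<And>v w. continuous_on UNIV (dir_deriv v (dir_deriv w \<psi>))"
    and S: "compact S" and S0: "\<And>x. x \<notin> S \<Longrightarrow> \<psi> x = 0"
  shows "(averaged i j u \<psi> \<longlongrightarrow>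
     second_moment (e i) (f j) * (\<integral>x. u x * dir_deriv (e i) (dir_deriv (f j) \<psi>) x \<partial>lborel)) (at_right 0)"
proof -
  define H where "H k l = dir_deriv (e k) (dir_deriv (f l) \<psi>)" for k l
  define Q where "Q y x = (\<Sum>k\<in>UNIV. \<Sum>l\<in>UNIV. (y \<bullet> e k) * (y \<bullet> f l) * H k l x)" for y x
  have [measurable]: "u \<in> borel_measurable borel" using u by auto
  have "continuous_on UNIV \<psi>" using d by (rule differentiable_imp_continuous_on)
  then have \<psi>m[measurable]: "\<psi> \<in> borel_measurable borel" by (rule borel_measurable_continuous_onI)
  have Hm[measurable]: "H k l \<in> borel_measurable borel" for k l
    unfolding H_def by (rule borel_measurable_continuous_onI[OF cc])
  have "\<exists>M. 0 \<le> M \<and> (\<forall>x. \<bar>H k l x\<bar> \<le> M)" for k l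
  proof -
    have "dir_deriv (e k) (dir_deriv (f l) \<psi>) x = 0" if "x \<notin> S" for x
      by (rule dir_deriv_eq_0[OF S _ that], rule dir_deriv_eq_0[OF S], rule S0)
    from bounded_compact_support[OF cc S this] show ?thesis unfolding H_def by metis
  qed
  then obtain M where M: "\<And>k l. 0 \<le> M k l" "\<And>k l x. \<bar>H k l x\<bar> \<le> M k l" by metis
  define N where "N = (\<Sum>k\<in>UNIV. \<Sum>l\<in>UNIV. M k l)"
  have QN: "\<bar>Q y x\<bar> \<le> (norm y)\<^sup>2 * N" for y x
  proof -
    have "\<bar>Q y x\<bar> \<le> (\<Sum>k\<in>UNIV. \<bar>\<Sum>l\<in>UNIV. (y \<bullet> e k) * (y \<bullet> f l) * H k l x\<bar>)" unfolding Q_def by (rule sum_abs)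
    also have "\<dots> \<le> (\<Sum>k\<in>UNIV. \<Sum>l\<in>UNIV. \<bar>(y \<bullet> e k) * (y \<bullet> f l) * H k l x\<bar>)" by (intro sum_mono sum_abs)
    also have "\<dots> \<le> (\<Sum>k\<in>UNIV. \<Sum>l\<in>UNIV. norm y * norm y * M k l)"
      unfolding abs_mult by (intro sum_mono mult_mono inner_sq_le norm_e norm_f M) auto
    also have "\<dots> = (norm y)\<^sup>2 * N" by (simp add: N_def power2_eq_square sum_distrib_left)
    finally show ?thesis .
  qed
  have mv: "\<exists>\<xi> \<eta>. 0 < \<xi> \<and> \<xi> < t \<and> 0 < \<eta> \<and> \<eta> < t \<and>
     diff2 \<psi> (t *\<^sub>R p1 y) (t *\<^sub>R p2 y) x / t\<^sup>2 = Q y (x - \<xi> *\<^sub>R p1 y - \<eta> *\<^sub>R p2 y)" if t: "0 < t" for t y x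
  proof -
    obtain \<xi> \<eta> where b: "0 < \<xi>" "\<xi> < t" "0 < \<eta>" "\<eta> < t" and
      eq: "diff2 \<psi> (t *\<^sub>R p1 y) (t *\<^sub>R p2 y) x = t\<^sup>2 * dir_deriv (p1 y) (dir_deriv (p2 y) \<psi>) (x - \<xi> *\<^sub>R p1 y - \<eta> *\<^sub>R p2 y)"
      by (rule diff2_mean_value[OF d dd t])
    have "diff2 \<psi> (t *\<^sub>R p1 y) (t *\<^sub>R p2 y) x / t\<^sup>2 = Q y (x - \<xi> *\<^sub>R p1 y - \<eta> *\<^sub>R p2 y)"
      unfolding eq Q_def H_def dir_deriv2_split[OF d dd] using t by simp
    with b show ?thesis by blast
  qed
  have D: "\<bar>diff2 \<psi> (t *\<^sub>R p1 y) (t *\<^sub>R p2 y) x / t\<^sup>2\<bar> \<le> (norm y)\<^sup>2 * N" if "0 < t" for t y x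
    using mv[OF that, of y x] QN by metis
  have Qc: "isCont (Q y) x" for y x
  proof -
    have "continuous_on UNIV (Q y)"
      unfolding Q_def[abs_def] H_def by (intro continuous_on_sum continuous_on_mult_left cc)
    then show ?thesis by (simp add: continuous_on_eq_continuous_at)
  qed
  show ?thesis
    unfolding tendsto_at_iff_sequentially
  proof (intro allI impI)
    fix X :: "nat \<Rightarrow> real" assume X: "\<forall>n. X n \<in> {0<..} - {0}" "X \<longlonglongrightarrow> 0"
    then have X0: "0 < X n" for n by auto
    define J where "J n y = (\<integral>x. u x * (diff2 \<psi> (X n *\<^sub>R p1 y) (X n *\<^sub>R p2 y) x / (X n)\<^sup>2) \<partial>lborel)" for n y
    have jm: "(\<lambda>(y, x). u x * (diff2 \<psi> (X n *\<^sub>R p1 y) (X n *\<^sub>R p2 y) x / (X n)\<^sup>2))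
       \<in> borel_measurable (borel \<Otimes>\<^sub>M borel)" for n
      unfolding diff2_def by measurable
    then have jm': "case_prod (\<lambda>y x. u x * (diff2 \<psi> (X n *\<^sub>R p1 y) (X n *\<^sub>R p2 y) x / (X n)\<^sup>2))
       \<in> borel_measurable (borel \<Otimes>\<^sub>M lborel)" for n
      by (simp cong: measurable_cong_sets sets_pair_measure_cong)
    have Jm[measurable]: "J n \<in> borel_measurable borel" for n
      using lborel.borel_measurable_lebesgue_integral[OF jm'[of n]] unfolding J_def[abs_def] .
    have dm: "(\<lambda>x. diff2 \<psi> (X n *\<^sub>R p1 y) (X n *\<^sub>R p2 y) x / (X n)\<^sup>2) \<in> borel_measurable borel" for n y
      unfolding diff2_def by measurable
    have inner: "(\<lambda>n. J n y) \<longlonglongrightarrow> (\<integral>x. u x * Q y x \<partial>lborel)" for y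
      unfolding J_def
    proof (rule integral_dominated_convergence[where w = "\<lambda>x. \<bar>u x\<bar> * ((norm y)\<^sup>2 * N)"])
      show "(\<lambda>x. u x * Q y x) \<in> borel_measurable lborel" unfolding Q_def by measurable
      show "(\<lambda>x. u x * (diff2 \<psi> (X n *\<^sub>R p1 y) (X n *\<^sub>R p2 y) x / (X n)\<^sup>2)) \<in> borel_measurable lborel" for n
        using borel_measurable_times[OF _ dm] by simp
      show "integrable lborel (\<lambda>x. \<bar>u x\<bar> * ((norm y)\<^sup>2 * N))" using u by auto
      show "AE x in lborel. norm (u x * (diff2 \<psi> (X n *\<^sub>R p1 y) (X n *\<^sub>R p2 y) x / (X n)\<^sup>2)) \<le> \<bar>u x\<bar> * ((norm y)\<^sup>2 * N)" for n
        using D[OF X0[of n]] unfolding real_norm_def abs_mult[of "u _"] by (intro AE_I2 mult_left_mono) auto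
      show "AE x in lborel. (\<lambda>n. u x * (diff2 \<psi> (X n *\<^sub>R p1 y) (X n *\<^sub>R p2 y) x / (X n)\<^sup>2)) \<longlonglongrightarrow> u x * Q y x"
      proof (rule AE_I2)
        fix x
        obtain \<xi> \<eta> where b: "\<And>n. 0 < \<xi> n" "\<And>n. \<xi> n < X n" "\<And>n. 0 < \<eta> n" "\<And>n. \<eta> n < X n" and
          eq: "\<And>n. diff2 \<psi> (X n *\<^sub>R p1 y) (X n *\<^sub>R p2 y) x / (X n)\<^sup>2 = Q y (x - \<xi> n *\<^sub>R p1 y - \<eta> n *\<^sub>R p2 y)"
          using mv[OF X0, where y = y and x = x] by metis
        have "\<xi> \<longlonglongrightarrow> 0" "\<eta> \<longlonglongrightarrow> 0"
          by (rule tendsto_sandwich[OF _ _ tendsto_const X(2)]; intro always_eventually allI less_imp_le b)+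
        then have "(\<lambda>n. x - \<xi> n *\<^sub>R p1 y - \<eta> n *\<^sub>R p2 y) \<longlonglongrightarrow> x - 0 *\<^sub>R p1 y - 0 *\<^sub>R p2 y"
          by (intro tendsto_intros)
        then have "(\<lambda>n. Q y (x - \<xi> n *\<^sub>R p1 y - \<eta> n *\<^sub>R p2 y)) \<longlonglongrightarrow> Q y x"
          by (intro isCont_tendsto_compose[of _ "Q y"] Qc) simp
        then show "(\<lambda>n. u x * (diff2 \<psi> (X n *\<^sub>R p1 y) (X n *\<^sub>R p2 y) x / (X n)\<^sup>2)) \<longlonglongrightarrow> u x * Q y x"
          unfolding eq by (intro tendsto_intros)
      qed
    qed
    define U where "U = (\<integral>x. \<bar>u x\<bar> \<partial>lborel)"
    have U0: "0 \<le> U" unfolding U_def by (intro Bochner_Integration.integral_nonneg) auto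
    have N0: "0 \<le> N" unfolding N_def by (intro sum_nonneg M)
    have JU: "\<bar>J n y\<bar> \<le> U * ((norm y)\<^sup>2 * N)" for n y
    proof -
      have "\<bar>J n y\<bar> \<le> (\<integral>x. \<bar>u x\<bar> * ((norm y)\<^sup>2 * N) \<partial>lborel)"
        unfolding J_def real_norm_def[symmetric]
      proof (rule Bochner_Integration.integral_norm_bound_integral)
        show "integrable lborel (\<lambda>x. u x * (diff2 \<psi> (X n *\<^sub>R p1 y) (X n *\<^sub>R p2 y) x / (X n)\<^sup>2))"
          by (rule integrable_mult_bounded[OF u _ D[OF X0]]) (use dm in simp)
        show "integrable lborel (\<lambda>x. norm (u x) * ((norm y)\<^sup>2 * N))" using u by auto
        show "norm (u x * (diff2 \<psi> (X n *\<^sub>R p1 y) (X n *\<^sub>R p2 y) x / (X n)\<^sup>2)) \<le> norm (u x) * ((norm y)\<^sup>2 * N)" for x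
          using D[OF X0[of n]] unfolding real_norm_def abs_mult[of "u _"] by (intro mult_left_mono) auto
      qed
      then show ?thesis by (simp add: U_def)
    qed
    have "(\<lambda>n. \<integral>y. r y * (weight i j y * J n y) \<partial>lborel) \<longlonglongrightarrow> (\<integral>y. r y * (weight i j y * (\<integral>x. u x * Q y x \<partial>lborel)) \<partial>lborel)"
    proof (rule integral_dominated_convergence[where w = "\<lambda>y. r y * (U * N)"])
      show "(\<lambda>y. r y * (weight i j y * (\<integral>x. u x * Q y x \<partial>lborel))) \<in> borel_measurable lborel"
        by (rule borel_measurable_LIMSEQ_real[where u = "\<lambda>n y. r y * (weight i j y * J n y)"])
          (auto intro!: tendsto_intros inner)
      show "(\<lambda>y. r y * (weight i j y * J n y)) \<in> borel_measurable lborel" for n by measurable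
      show "integrable lborel (\<lambda>y. r y * (U * N))" using kernel_integrable by auto
      show "AE y in lborel. (\<lambda>n. r y * (weight i j y * J n y)) \<longlonglongrightarrow> r y * (weight i j y * (\<integral>x. u x * Q y x \<partial>lborel))"
        by (intro AE_I2 tendsto_intros inner)
      show "AE y in lborel. norm (r y * (weight i j y * J n y)) \<le> r y * (U * N)" for n
      proof (rule AE_I2)
        fix y
        have "\<bar>weight i j y * J n y\<bar> \<le> 1 / (norm y)\<^sup>2 * (U * ((norm y)\<^sup>2 * N))"
          unfolding abs_mult by (intro mult_mono weight_le JU) auto
        also have "\<dots> \<le> U * N" using U0 N0 by (cases "y = 0") auto
        finally show "norm (r y * (weight i j y * J n y)) \<le> r y * (U * N)"
          unfolding real_norm_def abs_mult[of "r y"] using kernel_nonneg[of y] by (simp add: mult_left_mono)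
      qed
    qed
    also have "(\<integral>y. r y * (weight i j y * (\<integral>x. u x * Q y x \<partial>lborel)) \<partial>lborel) =
       second_moment (e i) (f j) * (\<integral>x. u x * H i j x \<partial>lborel)"
    proof -
      define h where "h k l = (\<integral>x. u x * H k l x \<partial>lborel)" for k l
      have iu: "integrable lborel (\<lambda>x. u x * H k l x)" for k l
        by (rule integrable_mult_bounded[OF u _ M(2)]) simp
      have 1: "(\<integral>x. u x * Q y x \<partial>lborel) = (\<Sum>k\<in>UNIV. \<Sum>l\<in>UNIV. (y \<bullet> e k) * (y \<bullet> f l) * h k l)" for y
      proof -
        have "(\<integral>x. u x * Q y x \<partial>lborel) = (\<integral>x. (\<Sum>k\<in>UNIV. \<Sum>l\<in>UNIV. (y \<bullet> e k) * (y \<bullet> f l) * (u x * H k l x)) \<partial>lborel)"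
          unfolding Q_def sum_distrib_left by (intro Bochner_Integration.integral_cong sum.cong refl) simp
        also have "\<dots> = (\<Sum>k\<in>UNIV. \<Sum>l\<in>UNIV. (y \<bullet> e k) * (y \<bullet> f l) * h k l)"
          unfolding h_def by (simp add: iu)
        finally show ?thesis .
      qed
      have im: "integrable lborel (\<lambda>y. r y * (weight i j y * ((y \<bullet> e k) * (y \<bullet> f l))))" for k l
        unfolding weight_def by (intro integrable_kernel_mult[OF _ weight_bound]) (auto simp: norm_e norm_f)
      have "(\<integral>y. r y * (weight i j y * (\<integral>x. u x * Q y x \<partial>lborel)) \<partial>lborel) =
        (\<integral>y. (\<Sum>k\<in>UNIV. \<Sum>l\<in>UNIV. (r y * (weight i j y * ((y \<bullet> e k) * (y \<bullet> f l)))) * h k l) \<partial>lborel)"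
        unfolding 1 sum_distrib_left by (intro Bochner_Integration.integral_cong sum.cong refl) simp
      also have "\<dots> = (\<Sum>k\<in>UNIV. \<Sum>l\<in>UNIV. (if k = i \<and> l = j then second_moment (e i) (f j) else 0) * h k l)"
        unfolding moment[symmetric] by (simp add: im)
      also have "\<dots> = (\<Sum>k\<in>UNIV. \<Sum>l\<in>UNIV. if l = j then (if k = i then second_moment (e i) (f j) * h i j else 0) else 0)"
        by (intro sum.cong) auto
      also have "\<dots> = second_moment (e i) (f j) * h i j"
        by simp
      finally show ?thesis unfolding h_def .
    qed
    finally show "(averaged i j u \<psi> \<circ> X) \<longlonglongrightarrow> second_moment (e i) (f j) * (\<integral>x. u x * dir_deriv (e i) (dir_deriv (f j) \<psi>) x \<partial>lborel)"
      unfolding averaged_def J_def H_def o_def .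
  qed
qed

end

section \<open>Pointwise bounds for the excess\<close>

lemma powr_add_le:
  fixes x y s :: real
  assumes "0 \<le> x" "0 \<le> y" "0 < s"
  shows "(x + y) powr s \<le> 2 powr s * (x powr s + y powr s)"
proof -
  have "(x + y) powr s \<le> (2 * max x y) powr s"
    using assms by (intro powr_mono2) auto
  also have "\<dots> = 2 powr s * max x y powr s" using assms by (simp add: powr_mult)
  also have "max x y powr s \<le> x powr s + y powr s" by (simp add: max_def)
  finally show ?thesis by simp
qed

lemma excess_diff_le: "0 \<le> t \<Longrightarrow> \<bar>excess t b' - excess t b\<bar> \<le> \<bar>b' - b\<bar>"
  by (auto simp: excess_def trunc_def)

lemma excess_eq_0: "\<bar>b\<bar> \<le> t \<Longrightarrow> excess t b = 0"
  by (auto simp: excess_def trunc_def)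

lemma abs_diff_le_max: "\<bar>b' - b\<bar> \<le> 2 * max \<bar>b\<bar> \<bar>b'\<bar>" for b b' :: real
proof -
  have "\<bar>b\<bar> \<le> max \<bar>b\<bar> \<bar>b'\<bar>" "\<bar>b'\<bar> \<le> max \<bar>b\<bar> \<bar>b'\<bar>" by simp_all
  then show ?thesis by linarith
qed

text \<open>The key inequality.  The second difference is the difference of the two horizontal edges and
  also of the two vertical ones, so the sum over the corners controls its power \<open>\<theta>1\<close> times
  the power \<open>\<theta>2\<close> of the longer vertical edge.\<close>
lemma corner_products_bound:
  fixes u0 u1 u2 u3 :: real
  assumes "0 < \<theta>1" "0 < \<theta>2"
  shows "\<bar>(u3 - u1) - (u2 - u0)\<bar> powr \<theta>1 * max \<bar>u2 - u0\<bar> \<bar>u3 - u1\<bar> powr \<theta>2 \<le>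
    2 powr \<theta>1 * ((\<bar>u1 - u0\<bar> powr \<theta>1 + \<bar>u3 - u2\<bar> powr \<theta>1) * (\<bar>u2 - u0\<bar> powr \<theta>2 + \<bar>u3 - u1\<bar> powr \<theta>2))"
proof -
  have "\<bar>(u3 - u1) - (u2 - u0)\<bar> powr \<theta>1 \<le> (\<bar>u1 - u0\<bar> + \<bar>u3 - u2\<bar>) powr \<theta>1"
    using assms by (intro powr_mono2) auto
  also have "\<dots> \<le> 2 powr \<theta>1 * (\<bar>u1 - u0\<bar> powr \<theta>1 + \<bar>u3 - u2\<bar> powr \<theta>1)"
    using assms by (intro powr_add_le) auto
  finally have 1: "\<bar>(u3 - u1) - (u2 - u0)\<bar> powr \<theta>1 \<le> 2 powr \<theta>1 * (\<bar>u1 - u0\<bar> powr \<theta>1 + \<bar>u3 - u2\<bar> powr \<theta>1)" .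
  have 2: "max \<bar>u2 - u0\<bar> \<bar>u3 - u1\<bar> powr \<theta>2 \<le> \<bar>u2 - u0\<bar> powr \<theta>2 + \<bar>u3 - u1\<bar> powr \<theta>2"
    by (simp add: max_def)
  show ?thesis
    using mult_mono[OF 1 2] by (simp add: mult.assoc)
qed

text \<open>Without truncation, the second difference is at most twice the longer vertical edge, so its
  power \<open>\<theta>1 + \<theta>2\<close> is controlled.  If the exponent is less than 1, the bound 4 on the second
  difference of a function with values in \<open>{-1..1}\<close> gives the first power.\<close>

lemma excess_bound_subcritical:
  assumes \<theta>: "0 < \<theta>1" "0 < \<theta>2" and V: "\<theta>1 + \<theta>2 = 1 \<or> \<theta>1 + \<theta>2 < 1 \<and> V = {-1..1}"
  shows "excess_bound V \<theta>1 \<theta>2 2 0 0 (4 * 2 powr (\<theta>1 + \<theta>2))"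
  unfolding excess_bound_def
proof (intro ballI allI impI)
  fix u0 u1 u2 u3 t :: real
  assume u: "u0 \<in> V" "u1 \<in> V" "u2 \<in> V" "u3 \<in> V" and t: "0 < t"
  define D where "D = \<bar>(u3 - u1) - (u2 - u0)\<bar>"
  define m where "m = max \<bar>u2 - u0\<bar> \<bar>u3 - u1\<bar>"
  define W where "W = (\<bar>u1 - u0\<bar> powr \<theta>1 + \<bar>u3 - u2\<bar> powr \<theta>1) * (\<bar>u2 - u0\<bar> powr \<theta>2 + \<bar>u3 - u1\<bar> powr \<theta>2)"
  have W0: "0 \<le> W" unfolding W_def by (intro mult_nonneg_nonneg) auto
  have c: "D powr \<theta>1 * m powr \<theta>2 \<le> 2 powr \<theta>1 * W" unfolding D_def m_def W_def by (rule corner_products_bound[OF \<theta>])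
  have Dm: "D \<le> 2 * m" "0 \<le> D" "0 \<le> m" unfolding D_def m_def by (rule abs_diff_le_max) auto
  have "D powr (\<theta>1 + \<theta>2) \<le> 2 powr (\<theta>1 + \<theta>2) * W"
  proof -
    have "D powr (\<theta>1 + \<theta>2) = D powr \<theta>1 * D powr \<theta>2" by (simp add: powr_add)
    also have "\<dots> \<le> D powr \<theta>1 * (2 * m) powr \<theta>2"
      using Dm \<theta> by (intro mult_left_mono powr_mono2) auto
    also have "\<dots> = 2 powr \<theta>2 * (D powr \<theta>1 * m powr \<theta>2)" using Dm by (simp add: powr_mult)
    also have "\<dots> \<le> 2 powr \<theta>2 * (2 powr \<theta>1 * W)" by (intro mult_left_mono c) auto
    finally show ?thesis by (simp add: powr_add mult_ac)
  qed
  moreover have "D \<le> 4 * D powr (\<theta>1 + \<theta>2)"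
  proof (cases "\<theta>1 + \<theta>2 = 1")
    case True then show ?thesis using Dm by simp
  next
    case False
    then have \<theta>': "\<theta>1 + \<theta>2 < 1" and D4: "D \<le> 4" using V u by (auto simp: D_def)
    have "D = D powr (\<theta>1 + \<theta>2) * D powr (1 - (\<theta>1 + \<theta>2))" using Dm by (cases "D = 0") (simp_all add: powr_add[symmetric])
    also have "\<dots> \<le> D powr (\<theta>1 + \<theta>2) * 4 powr (1 - (\<theta>1 + \<theta>2))"
      using Dm D4 \<theta>' by (intro mult_left_mono powr_mono2) auto
    also have "\<dots> \<le> D powr (\<theta>1 + \<theta>2) * 4 powr 1"
      using \<theta> by (intro mult_left_mono powr_mono) auto
    finally show ?thesis by simp
  qed
  ultimately have "D \<le> 4 * 2 powr (\<theta>1 + \<theta>2) * W" by linarith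
  moreover have "\<bar>excess (0 * t) (u3 - u1) - excess (0 * t) (u2 - u0)\<bar> \<le> D"
    unfolding D_def by (rule excess_diff_le) simp
  ultimately have "\<bar>excess (0 * t) (u3 - u1) - excess (0 * t) (u2 - u0)\<bar> / t\<^sup>2 \<le> (4 * 2 powr (\<theta>1 + \<theta>2) * W) / t\<^sup>2"
    by (intro divide_right_mono) auto
  then show "\<bar>excess (0 * t) (u3 - u1) - excess (0 * t) (u2 - u0)\<bar> / t\<^sup>2 \<le> 0 + 4 * 2 powr (\<theta>1 + \<theta>2) *
    ((\<bar>u1 - u0\<bar> powr \<theta>1 + \<bar>u3 - u2\<bar> powr \<theta>1) * (\<bar>u2 - u0\<bar> powr \<theta>2 + \<bar>u3 - u1\<bar> powr \<theta>2) / t powr 2)"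
    unfolding W_def using t by (simp add: powr_realpow[of t 2, simplified])
qed

text \<open>The excess vanishes unless the longer vertical edge is greater than \<open>l * t\<close>.  In that case the
  missing power \<open>1 - \<theta>1\<close> of the second difference is traded for the same power of the longer
  edge, and the superfluous power \<open>\<theta>1 + \<theta>2 - 1\<close> of the edge for a power of \<open>l * t\<close>.\<close>

lemma excess_bound_mixed:
  assumes \<theta>: "0 < \<theta>1" "0 < \<theta>2" "1 \<le> \<theta>1 + \<theta>2" "\<theta>1 \<le> 1" and l: "0 < l"
  shows "excess_bound V \<theta>1 \<theta>2 (1 + (\<theta>1 + \<theta>2)) l 0 (2 * 2 powr \<theta>1 * l powr (1 - (\<theta>1 + \<theta>2)))"
  unfolding excess_bound_def
proof (intro ballI allI impI)
  fix u0 u1 u2 u3 t :: real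
  assume t: "0 < t"
  define D where "D = \<bar>(u3 - u1) - (u2 - u0)\<bar>"
  define m where "m = max \<bar>u2 - u0\<bar> \<bar>u3 - u1\<bar>"
  define W where "W = (\<bar>u1 - u0\<bar> powr \<theta>1 + \<bar>u3 - u2\<bar> powr \<theta>1) * (\<bar>u2 - u0\<bar> powr \<theta>2 + \<bar>u3 - u1\<bar> powr \<theta>2)"
  define X where "X = \<bar>excess (l * t) (u3 - u1) - excess (l * t) (u2 - u0)\<bar>"
  define \<theta> where "\<theta> = \<theta>1 + \<theta>2"
  have W0: "0 \<le> W" unfolding W_def by (intro mult_nonneg_nonneg) auto
  have c: "D powr \<theta>1 * m powr \<theta>2 \<le> 2 powr \<theta>1 * W" unfolding D_def m_def W_def by (rule corner_products_bound[OF \<theta>(1,2)])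
  have Dm: "D \<le> 2 * m" "0 \<le> D" "0 \<le> m" unfolding D_def m_def by (rule abs_diff_le_max) auto
  have XD: "X \<le> D" unfolding D_def X_def using l t by (intro excess_diff_le) simp
  have lt: "0 < l * t" using l t by simp
  have "X \<le> 2 * 2 powr \<theta>1 * (l * t) powr (1 - \<theta>) * W"
  proof (cases "m \<le> l * t")
    case True
    then have "X = 0" unfolding X_def m_def by (simp add: excess_eq_0)
    then show ?thesis using W0 by simp
  next
    case False
    then have mt: "l * t < m" "0 < m" using lt by auto
    have "D = D powr \<theta>1 * D powr (1 - \<theta>1)" using Dm by (cases "D = 0") (simp_all add: powr_add[symmetric])
    also have "\<dots> \<le> D powr \<theta>1 * (2 * m) powr (1 - \<theta>1)"
      using Dm \<theta> by (intro mult_left_mono powr_mono2) auto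
    also have "(2 * m) powr (1 - \<theta>1) = 2 powr (1 - \<theta>1) * (m powr \<theta>2 * m powr (1 - \<theta>))"
      using mt by (simp add: powr_mult powr_add[symmetric] \<theta>_def)
    also have "D powr \<theta>1 * (2 powr (1 - \<theta>1) * (m powr \<theta>2 * m powr (1 - \<theta>))) \<le>
        D powr \<theta>1 * (2 powr 1 * (m powr \<theta>2 * (l * t) powr (1 - \<theta>)))"
      using \<theta> mt lt by (intro mult_left_mono mult_mono powr_mono powr_mono2') (auto simp: \<theta>_def)
    also have "\<dots> = 2 * (l * t) powr (1 - \<theta>) * (D powr \<theta>1 * m powr \<theta>2)" by simp
    also have "\<dots> \<le> 2 * (l * t) powr (1 - \<theta>) * (2 powr \<theta>1 * W)" by (intro mult_left_mono c) auto
    finally show ?thesis using XD by (simp add: mult_ac)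
  qed
  then have "X / t\<^sup>2 \<le> 2 * 2 powr \<theta>1 * (l * t) powr (1 - \<theta>) * W / t\<^sup>2" by (rule divide_right_mono) simp
  also have "\<dots> = 2 * 2 powr \<theta>1 * l powr (1 - \<theta>) * W * (t powr (1 - \<theta>) / t\<^sup>2)"
    using l t by (simp add: powr_mult)
  also have "t powr (1 - \<theta>) / t\<^sup>2 = 1 / t powr (1 + \<theta>)"
  proof -
    have "t powr (1 - \<theta>) / t powr 2 = t powr (- (1 + \<theta>))" by (simp add: powr_diff[symmetric])
    then show ?thesis using t powr_minus_divide[of t "1 + \<theta>"] by (simp add: powr_realpow[of t 2, simplified])
  qed
  finally show "X / t\<^sup>2 \<le> 0 + 2 * 2 powr \<theta>1 * l powr (1 - (\<theta>1 + \<theta>2)) *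
    ((\<bar>u1 - u0\<bar> powr \<theta>1 + \<bar>u3 - u2\<bar> powr \<theta>1) * (\<bar>u2 - u0\<bar> powr \<theta>2 + \<bar>u3 - u1\<bar> powr \<theta>2) / t powr (1 + (\<theta>1 + \<theta>2)))"
    by (simp add: \<theta>_def W_def)
qed

text \<open>Here the second difference appears with the power \<open>\<theta>1 > 1\<close>.  The parameter \<open>k\<close> replaces the
  Hoelder inequality: a number \<open>g\<close> is either at most \<open>k\<close> or at most
  \<open>k powr (1 - \<theta>1) * g powr \<theta>1\<close>.\<close>

lemma excess_bound_supercritical:
  assumes \<theta>: "1 < \<theta>1" "0 < \<theta>2" and l: "0 < l" and k: "0 < k"
  shows "excess_bound V \<theta>1 \<theta>2 (\<theta>1 + (\<theta>1 + \<theta>2)) l k (2 powr \<theta>1 * (k powr (1 - \<theta>1) * l powr (- \<theta>2)))"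
  unfolding excess_bound_def
proof (intro ballI allI impI)
  fix u0 u1 u2 u3 t :: real
  assume t: "0 < t"
  define D where "D = \<bar>(u3 - u1) - (u2 - u0)\<bar>"
  define m where "m = max \<bar>u2 - u0\<bar> \<bar>u3 - u1\<bar>"
  define W where "W = (\<bar>u1 - u0\<bar> powr \<theta>1 + \<bar>u3 - u2\<bar> powr \<theta>1) * (\<bar>u2 - u0\<bar> powr \<theta>2 + \<bar>u3 - u1\<bar> powr \<theta>2)"
  define X where "X = \<bar>excess (l * t) (u3 - u1) - excess (l * t) (u2 - u0)\<bar>"
  have W0: "0 \<le> W" unfolding W_def by (intro mult_nonneg_nonneg) auto
  have c: "D powr \<theta>1 * m powr \<theta>2 \<le> 2 powr \<theta>1 * W" unfolding D_def m_def W_def by (rule corner_products_bound) (use \<theta> in auto)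
  have D0: "0 \<le> D" by (simp add: D_def)
  have XD: "X \<le> D" unfolding D_def X_def using l t by (intro excess_diff_le) simp
  have lt: "0 < l * t" using l t by simp
  have "X / t\<^sup>2 \<le> k + 2 powr \<theta>1 * (k powr (1 - \<theta>1) * l powr (- \<theta>2)) * (W / t powr (\<theta>1 + (\<theta>1 + \<theta>2)))"
  proof (cases "X / t\<^sup>2 \<le> k")
    case True
    then show ?thesis using W0 by (simp add: add_increasing2)
  next
    case False
    define g where "g = X / t\<^sup>2"
    have g: "k < g" using False by (simp add: g_def)
    have m: "l * t < m"
    proof (rule ccontr)
      assume "\<not> l * t < m"
      then have "X = 0" unfolding X_def m_def by (simp add: excess_eq_0)
      then show False using g k by (simp add: g_def)
    qed
    have "g = g powr \<theta>1 * g powr (1 - \<theta>1)" using g k by (simp add: powr_add[symmetric])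
    also have "\<dots> \<le> (D / t powr 2) powr \<theta>1 * k powr (1 - \<theta>1)"
    proof (rule mult_mono)
      have "g \<le> D / t powr 2" unfolding g_def using t XD by (simp add: divide_right_mono powr_realpow[of t 2, simplified])
      then show "g powr \<theta>1 \<le> (D / t powr 2) powr \<theta>1" using g k \<theta> by (intro powr_mono2) auto
      show "g powr (1 - \<theta>1) \<le> k powr (1 - \<theta>1)" using g k \<theta> by (intro powr_mono2') auto
    qed auto
    also have "(D / t powr 2) powr \<theta>1 = D powr \<theta>1 / t powr (2 * \<theta>1)"
      using powr_divide[of D "t powr 2" \<theta>1] D0 powr_powr[of t 2 \<theta>1] by (metis powr_ge_zero)
    also have "D powr \<theta>1 / t powr (2 * \<theta>1) * k powr (1 - \<theta>1) \<le>
        (D powr \<theta>1 / t powr (2 * \<theta>1) * k powr (1 - \<theta>1)) * (m powr \<theta>2 / (l * t) powr \<theta>2)"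
    proof -
      have "(l * t) powr \<theta>2 \<le> m powr \<theta>2" using m lt \<theta> by (intro powr_mono2) auto
      moreover have "0 < (l * t) powr \<theta>2" using lt by (subst powr_gt_zero) auto
      ultimately have "1 \<le> m powr \<theta>2 / (l * t) powr \<theta>2" by (metis le_divide_eq_1_pos)
      then show ?thesis using D0 mult_left_mono[of 1 "m powr \<theta>2 / (l * t) powr \<theta>2" "D powr \<theta>1 / t powr (2 * \<theta>1) * k powr (1 - \<theta>1)"]
        by simp
    qed
    also have "\<dots> = (D powr \<theta>1 * m powr \<theta>2) * (k powr (1 - \<theta>1) * l powr (- \<theta>2)) / t powr (\<theta>1 + (\<theta>1 + \<theta>2))"
    proof -
      have "t powr (\<theta>1 + (\<theta>1 + \<theta>2)) = t powr (2 * \<theta>1) * t powr \<theta>2" by (simp add: powr_add[symmetric])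
      then show ?thesis using l t by (simp add: powr_mult powr_minus divide_simps)
    qed
    also have "\<dots> \<le> (2 powr \<theta>1 * W) * (k powr (1 - \<theta>1) * l powr (- \<theta>2)) / t powr (\<theta>1 + (\<theta>1 + \<theta>2))"
      by (intro divide_right_mono mult_right_mono c) auto
    finally show ?thesis using k by (simp add: g_def mult_ac)
  qed
  then show "X / t\<^sup>2 \<le> k + 2 powr \<theta>1 * (k powr (1 - \<theta>1) * l powr (- \<theta>2)) *
    ((\<bar>u1 - u0\<bar> powr \<theta>1 + \<bar>u3 - u2\<bar> powr \<theta>1) * (\<bar>u2 - u0\<bar> powr \<theta>2 + \<bar>u3 - u1\<bar> powr \<theta>2) / t powr (\<theta>1 + (\<theta>1 + \<theta>2)))"
    unfolding W_def .
qed

section \<open>Optimisation of the parameters\<close>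

lemma optimize_mixed:
  fixes A G \<theta> :: real
  assumes "0 < A" "0 < G" "1 \<le> \<theta>"
  obtains l where "0 < l" "l * A = A powr (1 - 1 / \<theta>) * G powr (1 / \<theta>)" "l powr (1 - \<theta>) * G = A powr (1 - 1 / \<theta>) * G powr (1 / \<theta>)"
proof
  let ?l = "(G / A) powr (1 / \<theta>)"
  have ln: "ln ?l = (ln G - ln A) / \<theta>" using assms by (simp add: ln_powr ln_div)
  show "0 < ?l" using assms by simp
  have 1: "ln (?l * A) = ln (A powr (1 - 1 / \<theta>) * G powr (1 / \<theta>))"
    using assms by (simp add: ln_mult ln_powr ln_div field_simps)
  then show "?l * A = A powr (1 - 1 / \<theta>) * G powr (1 / \<theta>)"
    using assms by (subst (asm) ln_inj_iff) auto
  have 2: "ln (?l powr (1 - \<theta>) * G) = ln (A powr (1 - 1 / \<theta>) * G powr (1 / \<theta>))"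
    using assms by (simp add: ln_mult ln_powr ln_div field_simps)
  then show "?l powr (1 - \<theta>) * G = A powr (1 - 1 / \<theta>) * G powr (1 / \<theta>)"
    using assms by (subst (asm) ln_inj_iff) auto
qed

lemma optimize_supercritical:
  fixes A B E \<theta>1 \<theta>2 :: real
  assumes "0 < A" "0 < B" "0 < E" "0 < \<theta>1" "0 < \<theta>2"
  defines "Q \<equiv> E powr (1 / (\<theta>1 + \<theta>2)) * A powr (\<theta>2 / (\<theta>1 + \<theta>2)) * B powr (\<theta>1 / (\<theta>1 + \<theta>2))"
  obtains l k where "0 < l" "0 < k" "l * A = Q" "B * k = Q" "B * (k powr (1 - \<theta>1) * l powr (- \<theta>2)) * E = Q"
proof
  have Q: "0 < Q" using assms by simp
  then show "0 < Q / A" "0 < Q / B" "Q / A * A = Q" "B * (Q / B) = Q" using assms by auto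
  define s where "s = \<theta>1 + \<theta>2"
  have s: "0 < s" using assms by (simp add: s_def)
  have lQ: "s * ln Q = ln E + \<theta>2 * ln A + \<theta>1 * ln B"
    unfolding Q_def s_def[symmetric] using assms s by (simp add: ln_mult ln_powr field_simps)
  have "ln (B * ((Q / B) powr (1 - \<theta>1) * (Q / A) powr (- \<theta>2)) * E) = ln Q"
    using Q assms(1-5) lQ by (simp add: ln_mult ln_powr ln_div s_def algebra_simps)
  then show "B * ((Q / B) powr (1 - \<theta>1) * (Q / A) powr (- \<theta>2)) * E = Q"
    using Q assms(1-5) by (subst (asm) ln_inj_iff) auto
qed

text \<open>Every estimate is first shown with a strict upper bound \<open>E'\<close> of the energy; this also makes \<open>E'\<close>
  positive, which the choice of the parameters needs.\<close>

lemma le_powr_limit: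
  fixes x C E q R :: real
  assumes "\<And>E'. E < E' \<Longrightarrow> x \<le> C * E' powr q * R" "0 \<le> E" "0 < q"
  shows "x \<le> C * E powr q * R"
proof (rule tendsto_lowerbound)
  have id: "((\<lambda>t. t) \<longlongrightarrow> E) (at_right E)" by (rule tendsto_ident_at)
  show "((\<lambda>E'. C * E' powr q * R) \<longlongrightarrow> C * E powr q * R) (at_right E)"
  proof (intro tendsto_intros tendsto_powr'[OF id tendsto_const])
    have "\<forall>\<^sub>F t in at_right E. 0 \<le> t"
      using assms(2) by (auto intro: eventually_mono[OF eventually_at_right_less[of E]])
    then show "E \<noteq> 0 \<or> 0 < q \<and> (\<forall>\<^sub>F t in at_right E. 0 \<le> t)" using assms(3) by simp
  qed
  show "\<forall>\<^sub>F E' in at_right E. x \<le> C * E' powr q * R"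
    using assms(1) by (auto intro!: eventually_mono[OF eventually_at_right_less[of E]])
qed simp

section \<open>Borel representative of the kernel and orthonormal bases\<close>

lemma AE_lborel_scale:
  fixes c :: real
  assumes "AE x in (lborel :: 'a::euclidean_space measure). P x" and c: "c \<noteq> 0"
  shows "AE x in (lborel :: 'a measure). P (c *\<^sub>R x)"
proof -
  obtain N :: "'a set" where N: "{x \<in> space lborel. \<not> P x} \<subseteq> N" "emeasure lborel N = 0" "N \<in> sets lborel"
    using AE_E[OF assms(1)] by blast
  then have [measurable]: "N \<in> sets borel" by simp
  have "ennreal (\<bar>c\<bar>^DIM('a)) * (\<integral>\<^sup>+x. indicator N (c *\<^sub>R x) \<partial>(lborel :: 'a measure)) = 0"
    using nn_integral_lborel_scale[of "indicator N :: 'a \<Rightarrow> ennreal", OF _ c] N by simp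
  then have "(\<integral>\<^sup>+x. indicator N (c *\<^sub>R x) \<partial>(lborel :: 'a measure)) = 0"
    using c by simp
  then have "AE x in (lborel :: 'a measure). indicator N (c *\<^sub>R x) = (0::ennreal)"
    by (subst (asm) nn_integral_0_iff_AE) auto
  then show ?thesis
  proof eventually_elim
    case (elim x) then show ?case using N(1) by (auto simp: indicator_def split: if_splits)
  qed
qed

lemma AE_lborel_plus:
  fixes c :: "'a::euclidean_space"
  assumes "AE x in lborel. P x"
  shows "AE x in lborel. P (x + c)"
  using AE_distrD[of "(+) c" lborel borel P, unfolded lborel_distr_plus, OF _ assms] by (simp add: add.commute)

lemma radial_kernel_representative:
  fixes \<rho> :: "real^'n \<Rightarrow> real"
  assumes "radial_kernel \<rho>"
  obtains r where "reflection_invariant_kernel r" "AE z in lborel. \<rho> z = r z"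
proof -
  from assms have int: "integrable lebesgue \<rho>" and nonneg: "\<And>z. \<rho> z \<ge> 0" and one: "integral\<^sup>L lebesgue \<rho> = 1"
    and supp: "closure {z. \<rho> z \<noteq> 0} \<subseteq> cball 0 1" by (auto simp: radial_kernel_def)
  from assms obtain g where g: "\<And>z. \<rho> z = g (norm z)" by (auto simp: radial_kernel_def)
  have "\<rho> \<in> borel_measurable (completion lborel)" using int by auto
  from completion_ex_borel_measurable_real[OF this] obtain r0
    where r0: "r0 \<in> borel_measurable lborel" "AE z in lborel. \<rho> z = r0 z" by auto
  have [measurable]: "r0 \<in> borel_measurable borel" using r0 by simp
  define r where "r z = indicator (cball 0 1) z * max 0 (r0 z)" for z
  have [measurable]: "r \<in> borel_measurable borel" unfolding r_def
    by (intro borel_measurable_times borel_measurable_indicator) auto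
  have "\<rho> z = 0" if "z \<notin> cball 0 1" for z
    using that supp closure_subset[of "{z. \<rho> z \<noteq> 0}"] by auto
  with r0(2) have ae: "AE z in lborel. \<rho> z = r z"
    by (auto elim!: eventually_mono simp: r_def indicator_def) (metis max.absorb2 nonneg)
  have "reflection_invariant_kernel r"
  proof
    show "r z \<ge> 0" for z by (simp add: r_def)
    show "r z = 0" if "norm z > 1" for z using that by (simp add: r_def)
    have "(\<integral>\<^sup>+z. ennreal (r z) \<partial>lborel) = (\<integral>\<^sup>+z. ennreal (\<rho> z) \<partial>lborel)"
      using ae by (intro nn_integral_cong_AE) auto
    also have "\<dots> = (\<integral>\<^sup>+z. ennreal (\<rho> z) \<partial>lebesgue)" by (simp add: nn_integral_completion)
    also have "\<dots> = 1" using nn_integral_eq_integral[OF int] nonneg one by simp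
    finally show "(\<integral>\<^sup>+z. ennreal (r z) \<partial>lborel) = 1" .
    fix R :: "real^'n \<Rightarrow> real^'n" assume R: "isometric_involution R"
    then have n: "norm (R z) = norm z" for z by (simp add: isometric_involution_def)
    have "AE z in lborel. \<rho> (R z) = r (R z)"
      using AE_distrD[of R lborel borel "\<lambda>z. \<rho> z = r z", unfolded lborel_distr_isometric_involution[OF R], OF _ ae]
        isometric_involution_measurable[OF R] by simp
    with ae show "AE z in lborel. r (R z) = r z"
      by eventually_elim (simp add: g n)
  qed measurable
  then show ?thesis using ae that by blast
qed

lemma orthonormal_basis_expansion:
  fixes b :: "'i::finite \<Rightarrow> 'a::euclidean_space"
  assumes "orthonormal_basis b X" "x \<in> X"
  shows "x = (\<Sum>i\<in>UNIV. (x \<bullet> b i) *\<^sub>R b i)"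
proof -
  have b: "b i \<bullet> b j = (if i = j then 1 else 0)" for i j
    using assms by (simp add: orthonormal_basis_def)
  have "x \<in> span (range b)" using assms by (simp add: orthonormal_basis_def)
  then show ?thesis
  proof (induction rule: span_induct)
    case base
    show ?case
      by (auto simp: subspace_def inner_add_left scaleR_add_left sum.distrib scaleR_sum_right[symmetric] scaleR_scaleR[symmetric] simp del: scaleR_scaleR)
  next
    case (step x)
    then obtain j where "x = b j" by auto
    then show ?case by (simp add: b if_distrib[of "\<lambda>c. c *\<^sub>R _"] cong: if_cong)
  qed
qed

lemma orthonormal_bases_split:
  fixes e :: "'i::finite \<Rightarrow> 'a::euclidean_space" and f :: "'j::finite \<Rightarrow> 'a"
  assumes e: "orthonormal_basis e X1" and f: "orthonormal_basis f X2"
    and orth: "\<forall>x\<in>X1. \<forall>y\<in>X2. orthogonal x y" and sum: "X1 + X2 = UNIV"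
  shows "orthonormal_split e f"
proof
  have eX: "e i \<in> X1" and fX: "f j \<in> X2" for i j
    using e f by (auto simp: orthonormal_basis_def intro: span_base)
  show "e i \<bullet> e i' = (if i = i' then 1 else 0)" for i i' using e by (simp add: orthonormal_basis_def)
  show "f i \<bullet> f i' = (if i = i' then 1 else 0)" for i i' using f by (simp add: orthonormal_basis_def)
  show ef: "e i \<bullet> f j = 0" for i j using orth eX fX by (auto simp: orthogonal_def)
  fix x
  have "x \<in> X1 + X2" using sum by simp
  then obtain a b where x: "x = a + b" and a: "a \<in> X1" and b: "b \<in> X2" by (auto elim: set_plus_elim)
  have "x \<bullet> e i = a \<bullet> e i" for i
    using orth b eX[of i] by (simp add: x inner_add_left orthogonal_def inner_commute[of b])
  moreover have "x \<bullet> f j = b \<bullet> f j" for j using orth a fX[of j] by (simp add: x inner_add_left orthogonal_def)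
  ultimately show "x = (\<Sum>i\<in>UNIV. (x \<bullet> e i) *\<^sub>R e i) + (\<Sum>j\<in>UNIV. (x \<bullet> f j) *\<^sub>R f j)"
    using orthonormal_basis_expansion[OF e a] orthonormal_basis_expansion[OF f b] x by simp
qed

section \<open>Test functions and Borel representatives\<close>

lemma dir_deriv_bounded_linear:
  assumes L: "bounded_linear L" and f: "f differentiable_on UNIV"
  shows "dir_deriv v (\<lambda>x. L (f x)) = (\<lambda>x. L (dir_deriv v f x))" "(\<lambda>x. L (f x)) differentiable_on UNIV"
proof -
  have "(f has_derivative frechet_derivative f (at x)) (at x)" for x
    using f by (simp add: frechet_derivative_works[symmetric] differentiable_on_def)
  from bounded_linear.has_derivative[OF L this]
  have 1: "((\<lambda>x. L (f x)) has_derivative (\<lambda>h. L (frechet_derivative f (at x) h))) (at x)" for x .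
  show "dir_deriv v (\<lambda>x. L (f x)) = (\<lambda>x. L (dir_deriv v f x))"
    using frechet_derivative_at[OF 1, symmetric] by (simp add: dir_deriv_def fun_eq_iff)
  show "(\<lambda>x. L (f x)) differentiable_on UNIV"
    using 1 by (auto simp: differentiable_on_def differentiable_def)
qed

lemma C_diff_bounded_linear:
  assumes L: "bounded_linear L"
  shows "C_diff k f \<Longrightarrow> C_diff k (\<lambda>x. L (f x))"
proof (induction k arbitrary: f)
  case 0
  then show ?case by (auto intro: bounded_linear.continuous_on[OF L])
next
  case (Suc k)
  then show ?case using dir_deriv_bounded_linear[OF L, of f] by simp
qed

lemma C_diff_2D:
  assumes "C_diff 2 \<psi>"
  shows "\<psi> differentiable_on UNIV" "dir_deriv w \<psi> differentiable_on UNIV"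
    "continuous_on UNIV (dir_deriv w \<psi>)" "continuous_on UNIV (dir_deriv v (dir_deriv w \<psi>))"
  using assms by (auto simp: numeral_2_eq_2 intro: differentiable_imp_continuous_on)

text \<open>A function that is integrable on \<open>K\<close> agrees almost everywhere on \<open>K\<close> with an integrable Borel
  function on the whole space; if its values lie almost everywhere in \<open>{-1..1}\<close>, those of the
  representative lie there everywhere.\<close>

lemma integrable_representative:
  fixes u :: "'a::euclidean_space \<Rightarrow> real"
  assumes K: "compact K" and u: "u absolutely_integrable_on K"
    and V: "V = UNIV \<or> V = {-1..1} \<and> (AE x in lebesgue. x \<in> K \<longrightarrow> \<bar>u x\<bar> \<le> 1)"
  obtains u' where "integrable lborel u'" "\<And>x. u' x \<in> V" "AE x in lborel. x \<in> K \<longrightarrow> u x = u' x"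
    "(\<lambda>x. indicator K x * u x) \<in> borel_measurable lebesgue"
proof -
  have [measurable]: "K \<in> sets borel" using K by (simp add: borel_compact)
  have i: "integrable lebesgue (\<lambda>x. indicator K x * u x)" using u by (simp add: set_integrable_def)
  then have m: "(\<lambda>x. indicator K x * u x) \<in> borel_measurable (completion lborel)" by auto
  from completion_ex_borel_measurable_real[OF this] obtain u0
    where u0: "u0 \<in> borel_measurable lborel" "AE x in lborel. indicator K x * u x = u0 x" by auto
  have [measurable]: "u0 \<in> borel_measurable borel" using u0 by simp
  define T where "T b = (if V = UNIV then b else max (-1) (min 1 b))" for b :: real
  have [measurable]: "T \<in> borel_measurable borel" unfolding T_def by measurable
  define u' where "u' x = indicator K x * T (u0 x)" for x
  have [measurable]: "u' \<in> borel_measurable borel" unfolding u'_def by measurable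
  have TV: "T b \<in> V" "0 \<in> V" for b using V by (auto simp: T_def)
  have ae: "AE x in lborel. x \<in> K \<longrightarrow> u x = u' x"
  proof (cases "V = UNIV")
    case True
    show ?thesis using u0(2) by eventually_elim (auto simp: u'_def T_def True indicator_def)
  next
    case False
    then have "AE x in lborel. x \<in> K \<longrightarrow> \<bar>u x\<bar> \<le> 1" using V by (simp add: AE_completion_iff)
    with u0(2) show ?thesis
      by eventually_elim (auto simp: u'_def T_def False indicator_def split: if_splits)
  qed
  have "AE x in lborel. u' x = indicator K x * u x"
    using ae by eventually_elim (auto simp: u'_def indicator_def)
  moreover have "integrable lebesgue u'"
  proof (rule integrable_cong_AE_imp[OF i])
    show "u' \<in> borel_measurable lebesgue" by (rule measurable_completion) simp
    show "AE x in lebesgue. indicator K x * u x = u' x"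
      using calculation by (intro AE_completion) auto
  qed
  then have "integrable lborel u'" by (subst (asm) integrable_completion) auto
  moreover have "u' x \<in> V" for x using TV by (auto simp: u'_def indicator_def)
  ultimately show ?thesis using that ae m by blast
qed

section \<open>Product domains\<close>

lemma compact_in_open_thickening:
  fixes S U :: "'a::euclidean_space set"
  assumes "compact S" "open U" "S \<subseteq> U"
  obtains \<delta> where "0 < \<delta>" "\<And>x v. x \<in> S \<Longrightarrow> norm v \<le> \<delta> \<Longrightarrow> x + v \<in> U"
proof (cases "S = {}")
  case True
  then show ?thesis using that[of 1] by auto
next
  case False
  from compact_in_open_separated[OF this assms] obtain \<delta> where \<delta>: "\<delta> > 0" "{x. infdist x S \<le> \<delta>} \<subseteq> U" by blast
  show ?thesis
  proof (rule that[OF \<delta>(1)])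
    fix x v :: 'a assume "x \<in> S" "norm v \<le> \<delta>"
    then have "infdist (x + v) S \<le> \<delta>" by (intro infdist_le2[of x]) (auto simp: dist_norm)
    then show "x + v \<in> U" using \<delta> by auto
  qed
qed

text \<open>The domain \<open>\<Omega>1 + \<Omega>2\<close> of the theorem, for orthonormal bases \<open>e\<close> of \<open>X1\<close> and \<open>f\<close> of \<open>X2\<close>, together
  with a Borel representative \<open>r\<close> of the kernel \<open>\<rho>\<close>.\<close>

locale product_domain = split_kernel e f r
  for e :: "'i::finite \<Rightarrow> real^'n" and f :: "'j::finite \<Rightarrow> real^'n" and r :: "real^'n \<Rightarrow> real" +
  fixes X1 X2 \<Omega>1 \<Omega>2 :: "(real^'n) set" and \<rho> :: "real^'n \<Rightarrow> real"
  assumes X1: "X1 = span (range e)" and X2: "X2 = span (range f)"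
    and open1: "openin (top_of_set X1) \<Omega>1" and open2: "openin (top_of_set X2) \<Omega>2"
    and bounded1: "bounded \<Omega>1" and bounded2: "bounded \<Omega>2"
    and kernel_eq: "AE z in lborel. \<rho> z = r z"
begin

lemma p1_in: "p1 x \<in> X1" and p2_in: "p2 x \<in> X2"
  unfolding X1 X2 p1_def p2_def by (rule span_sum, rule span_scale, rule span_base, simp)+

lemma p2_X1: "x \<in> X1 \<Longrightarrow> p2 x = 0"
proof -
  assume "x \<in> X1"
  then show "p2 x = 0" unfolding X1
  proof (induction rule: span_induct)
    case base
    show ?case using linear_subspace_kernel[OF linear_p2] by simp
  next
    case (step x)
    then show ?case by (auto simp: p2_def ef)
  qed
qed

lemma p1_X2: "x \<in> X2 \<Longrightarrow> p1 x = 0"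
proof -
  assume "x \<in> X2"
  then show "p1 x = 0" unfolding X2
  proof (induction rule: span_induct)
    case base
    show ?case using linear_subspace_kernel[OF linear_p1] by simp
  next
    case (step x)
    then show ?case by (auto simp: p1_def fe)
  qed
qed

lemma p1_X1: "x \<in> X1 \<Longrightarrow> p1 x = x" using p1_p2[of x] p2_X1[of x] by simp
lemma p2_X2: "x \<in> X2 \<Longrightarrow> p2 x = x" using p1_p2[of x] p1_X2[of x] by simp

lemma component1: "component X1 X2 z = p1 z"
  unfolding component_def
proof (rule the_equality)
  have "z - p1 z = p2 z" using p1_p2[of z] by (metis add_diff_cancel_left')
  then show "p1 z \<in> X1 \<and> z - p1 z \<in> X2" using p1_in p2_in by simp
  fix x assume x: "x \<in> X1 \<and> z - x \<in> X2"
  then have "p1 (z - x) = 0" by (intro p1_X2) auto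
  then show "x = p1 z" using x p1_X1[of x] by (simp add: p1_diff)
qed

lemma component2: "component X2 X1 z = p2 z"
  unfolding component_def
proof (rule the_equality)
  have "z - p2 z = p1 z" using p1_p2[of z] by (metis add_diff_cancel_right')
  then show "p2 z \<in> X2 \<and> z - p2 z \<in> X1" using p1_in p2_in by simp
  fix x assume x: "x \<in> X2 \<and> z - x \<in> X1"
  then have "p2 (z - x) = 0" by (intro p2_X1) auto
  then show "x = p2 z" using x p2_X2[of x] by (simp add: p2_diff)
qed

lemma \<Omega>1_sub: "\<Omega>1 \<subseteq> X1" and \<Omega>2_sub: "\<Omega>2 \<subseteq> X2"
  using openin_imp_subset[OF open1] openin_imp_subset[OF open2] by auto

lemma mem_domain: "x \<in> \<Omega>1 + \<Omega>2 \<longleftrightarrow> p1 x \<in> \<Omega>1 \<and> p2 x \<in> \<Omega>2"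
proof
  assume "x \<in> \<Omega>1 + \<Omega>2"
  then obtain a b where "x = a + b" "a \<in> \<Omega>1" "b \<in> \<Omega>2" by (auto elim: set_plus_elim)
  then show "p1 x \<in> \<Omega>1 \<and> p2 x \<in> \<Omega>2"
    using \<Omega>1_sub \<Omega>2_sub by (auto simp: p1_add p2_add p1_X1 p2_X2 p1_X2 p2_X1 subset_iff)
next
  assume "p1 x \<in> \<Omega>1 \<and> p2 x \<in> \<Omega>2"
  then show "x \<in> \<Omega>1 + \<Omega>2" using set_plus_intro[of "p1 x" \<Omega>1 "p2 x" \<Omega>2] by (simp add: p1_p2)
qed

lemma open_domain: "open (\<Omega>1 + \<Omega>2)"
proof -
  obtain U1 U2 where U: "open U1" "\<Omega>1 = X1 \<inter> U1" "open U2" "\<Omega>2 = X2 \<inter> U2"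
    using open1 open2 by (auto simp: openin_open)
  have "\<Omega>1 + \<Omega>2 = p1 -` U1 \<inter> p2 -` U2"
    by (intro set_eqI) (simp add: mem_domain, simp add: U p1_in p2_in)
  moreover have "continuous_on UNIV p1" "continuous_on UNIV p2"
    using linear_p1 linear_p2 by (auto intro!: linear_continuous_on simp: linear_conv_bounded_linear)
  ultimately show ?thesis using U by (auto intro!: open_Int open_vimage)
qed

lemma bounded_domain: "bounded (\<Omega>1 + \<Omega>2)"
proof -
  have "\<Omega>1 + \<Omega>2 = (\<Union>x\<in>\<Omega>1. \<Union>y\<in>\<Omega>2. {x + y})" by (auto simp: set_plus_def)
  then show ?thesis using bounded_plus[OF bounded1 bounded2] by (simp add: split_def image_def) (auto elim!: bounded_subset)
qed

lemma shrink_mem: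
  assumes "\<And>v. norm v < \<epsilon> \<Longrightarrow> x + v \<in> \<Omega>1 + \<Omega>2"
  shows "x \<in> shrink X1 \<epsilon> \<Omega>1 + shrink X2 \<epsilon> \<Omega>2"
proof -
  have "p1 x \<in> shrink X1 \<epsilon> \<Omega>1"
    unfolding shrink_def
  proof (intro INT_I)
    fix z assume z: "z \<in> {z \<in> X1. norm z < \<epsilon>}"
    then have "p1 (x + z) \<in> \<Omega>1" using assms[of z] by (simp add: mem_domain)
    then have "p1 x + z \<in> \<Omega>1" using z by (simp add: p1_add p1_X1)
    then show "p1 x \<in> (\<lambda>x. x - z) ` \<Omega>1" by (intro image_eqI[of _ _ "p1 x + z"]) auto
  qed
  moreover have "p2 x \<in> shrink X2 \<epsilon> \<Omega>2"
    unfolding shrink_def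
  proof (intro INT_I)
    fix z assume z: "z \<in> {z \<in> X2. norm z < \<epsilon>}"
    then have "p2 (x + z) \<in> \<Omega>2" using assms[of z] by (simp add: mem_domain)
    then have "p2 x + z \<in> \<Omega>2" using z by (simp add: p2_add p2_X2)
    then show "p2 x \<in> (\<lambda>x. x - z) ` \<Omega>2" by (intro image_eqI[of _ _ "p2 x + z"]) auto
  qed
  ultimately show ?thesis using set_plus_intro[of "p1 x" _ "p2 x"] by (simp add: p1_p2)
qed

text \<open>Only values of \<open>u\<close> on the compact set \<open>K'\<close> enter the energy over \<open>K\<close>, so there \<open>u\<close> may be
  replaced by its Borel representative; the set \<open>K\<close> lies in the domain of integration of the
  energy at scale \<open>\<epsilon>\<close>.\<close>

lemma slice_energy_le_energy_eps:
  fixes u u' :: "real^'n \<Rightarrow> real"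
  assumes \<epsilon>: "0 < \<epsilon>" and [measurable]: "u' \<in> borel_measurable borel" "K \<in> sets borel"
    and K': "K' \<subseteq> \<Omega>1 + \<Omega>2" and KK': "\<And>x v. x \<in> K \<Longrightarrow> norm v \<le> \<epsilon> \<Longrightarrow> x + v \<in> K'"
    and ae: "AE x in lborel. x \<in> K' \<longrightarrow> u x = u' x"
  shows "(\<integral>\<^sup>+y. ennreal (r y) * slice_energy \<theta>1 \<theta>2 p u' K (\<epsilon> *\<^sub>R y) \<partial>lborel) \<le>
     energy_eps X1 X2 \<Omega>1 \<Omega>2 \<rho> \<theta>1 \<theta>2 p \<epsilon> u"
proof -
  let ?G = "slice_energy \<theta>1 \<theta>2 p u' K"
  have Gm[measurable]: "?G \<in> borel_measurable borel" by measurable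
  have "(\<integral>\<^sup>+z. ennreal (r (z /\<^sub>R \<epsilon>) / \<epsilon> ^ CARD('n)) * ?G z \<partial>lborel) =
     ennreal (\<bar>\<epsilon>\<bar> ^ DIM(real^'n)) * (\<integral>\<^sup>+y. ennreal (r ((\<epsilon> *\<^sub>R y) /\<^sub>R \<epsilon>) / \<epsilon> ^ CARD('n)) * ?G (\<epsilon> *\<^sub>R y) \<partial>lborel)"
    using \<epsilon> by (intro nn_integral_lborel_scale) auto
  also have "\<dots> = (\<integral>\<^sup>+y. ennreal (\<epsilon> ^ CARD('n)) * (ennreal (r y / \<epsilon> ^ CARD('n)) * ?G (\<epsilon> *\<^sub>R y)) \<partial>lborel)"
    using \<epsilon> by (subst nn_integral_cmult) auto
  also have "\<dots> = (\<integral>\<^sup>+y. ennreal (r y) * ?G (\<epsilon> *\<^sub>R y) \<partial>lborel)"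
    using \<epsilon> by (intro nn_integral_cong) (simp add: mult.assoc[symmetric] ennreal_mult[symmetric] kernel_nonneg)
  finally have "(\<integral>\<^sup>+y. ennreal (r y) * ?G (\<epsilon> *\<^sub>R y) \<partial>lborel) =
    (\<integral>\<^sup>+z. ennreal (r (z /\<^sub>R \<epsilon>) / \<epsilon> ^ CARD('n)) * ?G z \<partial>lborel)" ..
  also have "\<dots> \<le> energy_eps X1 X2 \<Omega>1 \<Omega>2 \<rho> \<theta>1 \<theta>2 p \<epsilon> u"
    unfolding energy_eps_def nn_integral_completion component1 component2
  proof (rule nn_integral_mono_AE)
    have "AE z in lborel. \<rho> (z /\<^sub>R \<epsilon>) = r (z /\<^sub>R \<epsilon>)"
      using AE_lborel_scale[OF kernel_eq, of "inverse \<epsilon>"] \<epsilon> by simp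
    then show "AE z in lborel. ennreal (r (z /\<^sub>R \<epsilon>) / \<epsilon> ^ CARD('n)) * ?G z \<le>
      ennreal (rescaled_kernel \<rho> \<epsilon> z) * (\<integral>\<^sup>+x\<in>shrink X1 \<epsilon> \<Omega>1 + shrink X2 \<epsilon> \<Omega>2.
         ennreal (\<bar>u (x + p1 z) - u x\<bar> powr \<theta>1 * \<bar>u (x + p2 z) - u x\<bar> powr \<theta>2 / norm z powr p) \<partial>lborel)"
    proof eventually_elim
      case (elim z)
      show ?case
      proof (cases "norm z \<le> \<epsilon>")
        case False
        then have "1 < norm (z /\<^sub>R \<epsilon>)" using \<epsilon> by (simp add: field_simps)
        then show ?thesis by (simp only: kernel_support) simp
      next
        case True
        have "?G z \<le> (\<integral>\<^sup>+x\<in>shrink X1 \<epsilon> \<Omega>1 + shrink X2 \<epsilon> \<Omega>2.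
         ennreal (\<bar>u (x + p1 z) - u x\<bar> powr \<theta>1 * \<bar>u (x + p2 z) - u x\<bar> powr \<theta>2 / norm z powr p) \<partial>lborel)"
          unfolding slice_energy_def edge_product_def
        proof (rule nn_integral_mono_AE)
          show "AE x in lborel. ennreal (\<bar>u' (x + p1 z) - u' x\<bar> powr \<theta>1 * \<bar>u' (x + p2 z) - u' x\<bar> powr \<theta>2 / norm z powr p) * indicator K x
            \<le> ennreal (\<bar>u (x + p1 z) - u x\<bar> powr \<theta>1 * \<bar>u (x + p2 z) - u x\<bar> powr \<theta>2 / norm z powr p) *
              indicator (shrink X1 \<epsilon> \<Omega>1 + shrink X2 \<epsilon> \<Omega>2) x"
            using ae AE_lborel_plus[OF ae, of "p1 z"] AE_lborel_plus[OF ae, of "p2 z"]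
          proof eventually_elim
            case (elim x)
            show ?case
            proof (cases "x \<in> K")
              case x: True
              have "x \<in> K'" "x + p1 z \<in> K'" "x + p2 z \<in> K'"
                using KK'[OF x, of 0] KK'[OF x, of "p1 z"] KK'[OF x, of "p2 z"] norm_p1[of z] norm_p2[of z] True \<epsilon> by auto
              moreover have "x \<in> shrink X1 \<epsilon> \<Omega>1 + shrink X2 \<epsilon> \<Omega>2"
                using K' KK'[OF x] by (intro shrink_mem) auto
              ultimately show ?thesis using elim x by simp
            qed simp
          qed
        qed
        then show ?thesis unfolding rescaled_kernel_def elim by (rule mult_left_mono) simp
      qed
    qed
  qed
  finally show ?thesis .
qed

lemma test_function_component:
  fixes \<phi> :: "real^'n \<Rightarrow> real^'j^'i"
  assumes \<phi>: "test_function \<Omega> \<phi>"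
  defines "S \<equiv> closure {x. \<phi> x \<noteq> 0}"
  shows "compact S" "S \<subseteq> \<Omega>" "C_diff 2 (\<lambda>x. \<phi> x $ i $ j)" "\<And>x. x \<notin> S \<Longrightarrow> \<phi> x = 0"
    "dir_deriv v (\<lambda>x. \<phi> x $ i $ j) x = dir_deriv v \<phi> x $ i $ j"
proof -
  have bl: "bounded_linear (\<lambda>M :: real^'j^'i. M $ i $ j)"
    using bounded_linear_compose[OF bounded_linear_vec_nth bounded_linear_vec_nth] .
  have C: "C_diff k \<phi>" for k using \<phi> by (simp add: test_function_def)
  show "compact S" "S \<subseteq> \<Omega>" using \<phi> by (auto simp: test_function_def S_def)
  show "C_diff 2 (\<lambda>x. \<phi> x $ i $ j)" by (rule C_diff_bounded_linear[OF bl C])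
  show "\<phi> x = 0" if "x \<notin> S" for x
    using that closure_subset[of "{x. \<phi> x \<noteq> 0}"] by (auto simp: S_def)
  have "\<phi> differentiable_on UNIV" using C[of 1] by simp
  from dir_deriv_bounded_linear(1)[OF bl this]
  show "dir_deriv v (\<lambda>x. \<phi> x $ i $ j) x = dir_deriv v \<phi> x $ i $ j" by simp
qed

end

section \<open>The estimate for one entry of the distribution\<close>

lemma continuous_integral_eq_0:
  fixes g :: "'a::euclidean_space \<Rightarrow> real"
  assumes c: "continuous_on UNIV g" and int: "integrable lborel g" and g: "\<And>x. 0 \<le> g x" and 0: "integral\<^sup>L lborel g = 0"
  shows "g x = 0"
proof -
  have "AE x in lborel. g x = 0" using integral_nonneg_eq_0_iff_AE[OF int] g 0 by simp
  moreover have o: "open {x. g x \<noteq> 0}" using open_Collect_neq[OF c continuous_on_const[of UNIV 0]] by simp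
  ultimately have "{x. g x \<noteq> 0} \<in> null_sets lborel" using AE_iff_null_sets[of "{x. g x \<noteq> 0}" lborel] by simp
  then have "negligible {x. g x \<noteq> 0}" by (simp add: negligible_iff_null_sets null_sets_completionI)
  then have "{x. g x \<noteq> 0} = {}" using open_not_negligible[OF o] by blast
  then show ?thesis by auto
qed

lemma integrable_compact_support:
  fixes g :: "'a::euclidean_space \<Rightarrow> real"
  assumes "continuous_on UNIV g" "compact S" "\<And>x. x \<notin> S \<Longrightarrow> g x = 0"
  shows "integrable lborel g"
proof -
  have "indicator S x *\<^sub>R g x = g x" for x using assms(3)[of x] by (cases "x \<in> S") auto
  then have "(\<lambda>x. indicator S x *\<^sub>R g x) = g" by (rule ext)
  then show ?thesis using borel_integrable_compact[OF assms(2) continuous_on_subset[OF assms(1)]] by simp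
qed

context product_domain
begin

lemma grad_L1_norm_eq:
  fixes \<phi> :: "real^'n \<Rightarrow> real^'j^'i"
  assumes \<phi>: "test_function (\<Omega>1 + \<Omega>2) \<phi>"
  defines "g \<equiv> \<lambda>x. sqrt (\<Sum>k\<in>UNIV. (norm (dir_deriv (e k) \<phi> x))\<^sup>2)"
  shows "continuous_on UNIV g" "integrable lborel g" "grad_L1_norm (\<Omega>1 + \<Omega>2) e \<phi> = integral\<^sup>L lborel g"
    "\<And>x. 0 \<le> g x"
proof -
  define S where "S = closure {x. \<phi> x \<noteq> 0}"
  note S = test_function_component[OF \<phi>, folded S_def]
  have C: "C_diff (Suc 0) \<phi>" using \<phi> by (simp add: test_function_def)
  show c: "continuous_on UNIV g" unfolding g_def using C by (intro continuous_intros) auto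
  have 0: "g x = 0" if "x \<notin> S" for x unfolding g_def using dir_deriv_eq_0[OF S(1) S(4) that] by simp
  show int: "integrable lborel g" by (rule integrable_compact_support[OF c S(1) 0])
  show "0 \<le> g x" for x unfolding g_def by (simp add: sum_nonneg)
  have [measurable]: "g \<in> borel_measurable borel" by (rule borel_measurable_continuous_onI[OF c])
  have "grad_L1_norm (\<Omega>1 + \<Omega>2) e \<phi> = integral\<^sup>L lebesgue g"
    unfolding grad_L1_norm_def set_lebesgue_integral_def g_def[symmetric]
    by (rule Bochner_Integration.integral_cong) (use 0 S(2) in \<open>auto simp: indicator_def\<close>)
  then show "grad_L1_norm (\<Omega>1 + \<Omega>2) e \<phi> = integral\<^sup>L lborel g"
    by (simp add: integral_completion)
qed

lemma sup_norm_bound: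
  fixes \<phi> :: "real^'n \<Rightarrow> real^'j^'i"
  assumes \<phi>: "test_function (\<Omega>1 + \<Omega>2) \<phi>" and ne: "\<Omega>1 + \<Omega>2 \<noteq> {}"
  shows "norm (\<phi> x) \<le> sup_norm (\<Omega>1 + \<Omega>2) \<phi>" "0 \<le> sup_norm (\<Omega>1 + \<Omega>2) \<phi>"
proof -
  define S where "S = closure {x. \<phi> x \<noteq> 0}"
  note S = test_function_component[OF \<phi>, folded S_def]
  have "C_diff 0 \<phi>" using \<phi> unfolding test_function_def by blast
  then have "continuous_on UNIV (\<lambda>x. norm (\<phi> x))" by (intro continuous_intros) simp
  then obtain M where M': "\<And>x. \<bar>norm (\<phi> x)\<bar> \<le> M"
    by (rule bounded_compact_support[OF _ S(1)]) (auto simp: S(4))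
  then have M: "norm (\<phi> x) \<le> M" for x using M'[of x] by simp
  have bdd: "bdd_above ((\<lambda>x. norm (\<phi> x)) ` (\<Omega>1 + \<Omega>2))" using M by (intro bdd_aboveI2) auto
  have 1: "norm (\<phi> x) \<le> sup_norm (\<Omega>1 + \<Omega>2) \<phi>" if "x \<in> \<Omega>1 + \<Omega>2" for x
    unfolding sup_norm_def by (rule cSUP_upper[OF that bdd])
  obtain x0 where "x0 \<in> \<Omega>1 + \<Omega>2" using ne by blast
  from order_trans[OF norm_ge_zero 1[OF this]] show 0: "0 \<le> sup_norm (\<Omega>1 + \<Omega>2) \<phi>" .
  show "norm (\<phi> x) \<le> sup_norm (\<Omega>1 + \<Omega>2) \<phi>"
    using 1[of x] 0 S(4)[of x] S(2) by (cases "x \<in> S") auto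
qed

text \<open>The estimate for the entry \<open>(i, j)\<close> in terms of the free parameters.  The liminf in the energy
  enters by contradiction: if the claim failed, then for all small \<open>\<epsilon>\<close> the averages would exceed
  the bound, and so the energy at scale \<open>\<epsilon>\<close> would be at least \<open>E\<close>.\<close>

lemma pairing_bound:
  fixes u :: "real^'n \<Rightarrow> real" and \<phi> :: "real^'n \<Rightarrow> real^'j^'i"
  assumes u: "L1loc (\<Omega>1 + \<Omega>2) u" and \<phi>: "test_function (\<Omega>1 + \<Omega>2) \<phi>" and ne: "\<Omega>1 + \<Omega>2 \<noteq> {}"
    and V: "V = UNIV \<or> V = {-1..1} \<and> (AE x in lebesgue. x \<in> \<Omega>1 + \<Omega>2 \<longrightarrow> \<bar>u x\<bar> \<le> 1)"
    and l: "0 \<le> l" "0 \<le> \<alpha>" "0 \<le> \<beta>" and eb: "excess_bound V \<theta>1 \<theta>2 p l \<alpha> \<beta>"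
    and E: "energy X1 X2 \<Omega>1 \<Omega>2 \<rho> \<theta>1 \<theta>2 p u < ennreal E" and E0: "0 \<le> E"
  shows "second_moment (e i) (f j) * deriv2_distr (\<Omega>1 + \<Omega>2) u (e i) (f j) (\<lambda>x. \<phi> x $ i $ j) \<le>
     l * grad_L1_norm (\<Omega>1 + \<Omega>2) e \<phi> + sup_norm (\<Omega>1 + \<Omega>2) \<phi> * \<alpha> * measure lborel (\<Omega>1 + \<Omega>2) +
     sup_norm (\<Omega>1 + \<Omega>2) \<phi> * \<beta> * (4 * E)"
proof -
  define \<Omega> where "\<Omega> = \<Omega>1 + \<Omega>2"
  note [folded \<Omega>_def] = u \<phi> ne V open_domain bounded_domain
  define S where "S = closure {x. \<phi> x \<noteq> 0}"
  note S = test_function_component[OF \<phi>, folded S_def \<Omega>_def]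
  define \<psi> where "\<psi> x = \<phi> x $ i $ j" for x
  have C: "C_diff 2 \<psi>" unfolding \<psi>_def by (rule S(3))
  note d = C_diff_2D[OF C]
  have \<psi>0: "\<psi> x = 0" if "x \<notin> S" for x using S(4)[OF that] by (simp add: \<psi>_def)
  define H where "H = dir_deriv (e i) (dir_deriv (f j) \<psi>)"
  have H0: "H x = 0" if "x \<notin> S" for x unfolding H_def
    by (rule dir_deriv_eq_0[OF S(1) _ that], rule dir_deriv_eq_0[OF S(1)], rule \<psi>0)
  have Hm[measurable]: "H \<in> borel_measurable borel" unfolding H_def by (rule borel_measurable_continuous_onI[OF d(4)])
  obtain \<delta>' where \<delta>': "0 < \<delta>'" "\<And>x v. x \<in> S \<Longrightarrow> norm v \<le> \<delta>' \<Longrightarrow> x + v \<in> \<Omega>"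
    using compact_in_open_thickening[OF S(1) _ S(2)] open_domain unfolding \<Omega>_def by metis
  \<comment> \<open>Two thickenings of \<open>S\<close>: corners of rectangles with a corner in \<open>S\<close> lie in \<open>K\<close>, and their
    neighbours, at which \<open>u\<close> is evaluated, lie in \<open>K'\<close>.\<close>
  define \<delta> where "\<delta> = \<delta>' / 2"
  have \<delta>: "0 < \<delta>" using \<delta>' by (simp add: \<delta>_def)
  define K where "K = {x + v | x v. x \<in> S \<and> v \<in> cball 0 \<delta>}"
  define K' where "K' = {x + v | x v. x \<in> K \<and> v \<in> cball 0 \<delta>}"
  have cK: "compact K" unfolding K_def by (intro compact_sums S(1)) auto
  then have cK': "compact K'" unfolding K'_def by (intro compact_sums) auto
  have Kb[measurable]: "K \<in> sets borel" using cK by (simp add: borel_compact)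
  have Sb[measurable]: "S \<in> sets borel" using S(1) by (simp add: borel_compact)
  have SK: "x + v \<in> K" if "x \<in> S" "norm v \<le> \<delta>" for x v unfolding K_def using that by auto
  have KK': "x + v \<in> K'" if "x \<in> K" "norm v \<le> \<delta>" for x v unfolding K'_def using that by auto
  have SK': "S \<subseteq> K'"
    using KK'[OF SK, of _ 0 0] \<delta> by auto
  have K'\<Omega>: "K' \<subseteq> \<Omega>"
  proof
    fix x assume "x \<in> K'"
    then obtain y v w where x: "x = y + v + w" "y \<in> S" "norm v \<le> \<delta>" "norm w \<le> \<delta>"
      unfolding K'_def K_def by auto
    have "norm (v + w) \<le> \<delta>'" using norm_triangle_ineq[of v w] x by (simp add: \<delta>_def)
    from \<delta>'(2)[OF x(2) this] show "x \<in> \<Omega>" by (simp add: x add.assoc)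
  qed
  have uK: "u absolutely_integrable_on K'" using u cK' K'\<Omega> unfolding L1loc_def \<Omega>_def by blast
  have V': "V = UNIV \<or> V = {-1..1} \<and> (AE x in lebesgue. x \<in> K' \<longrightarrow> \<bar>u x\<bar> \<le> 1)"
    using V K'\<Omega> unfolding \<Omega>_def[symmetric] by (auto elim!: eventually_mono)
  obtain u' where u': "integrable lborel u'" "\<And>x. u' x \<in> V" and ae: "AE x in lborel. x \<in> K' \<longrightarrow> u x = u' x"
    and um: "(\<lambda>x. indicator K' x * u x) \<in> borel_measurable lebesgue"
    by (rule integrable_representative[OF cK' uK V'], rule that)
  have u'm[measurable]: "u' \<in> borel_measurable borel" using u' by auto
  define B where "B = sup_norm \<Omega> \<phi>"
  have B: "\<bar>\<psi> x\<bar> \<le> B" for x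
  proof -
    have "norm (\<phi> x $ i $ j) \<le> norm (\<phi> x $ i)" by (rule Finite_Cartesian_Product.norm_nth_le)
    also have "\<dots> \<le> norm (\<phi> x)" by (rule Finite_Cartesian_Product.norm_nth_le)
    also have "\<dots> \<le> B" unfolding B_def \<Omega>_def by (rule sup_norm_bound[OF \<phi> ne])
    finally show ?thesis by (simp add: \<psi>_def)
  qed
  define m where "m = measure lborel \<Omega>"
  have m0: "0 \<le> m" unfolding m_def by (rule measure_nonneg)
  have "emeasure lborel \<Omega> < top" using emeasure_bounded_finite[OF bounded_domain] by (simp add: \<Omega>_def)
  then have "emeasure lborel \<Omega> = ennreal m" unfolding m_def by (intro emeasure_eq_ennreal_measure) auto
  then have m: "emeasure lborel S \<le> ennreal m"
    using emeasure_mono[OF S(2), of lborel] open_domain unfolding \<Omega>_def by (metis borel_open sets_lborel)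
  define A where "A = grad_L1_norm \<Omega> e \<phi>"
  define g where "g x = sqrt (\<Sum>k\<in>UNIV. (norm (dir_deriv (e k) \<phi> x))\<^sup>2)" for x
  note g = grad_L1_norm_eq[OF \<phi>, folded \<Omega>_def g_def[abs_def], folded A_def]
  have g0: "0 \<le> g x" for x by (simp add: g_def sum_nonneg)
  have A0: "0 \<le> A" unfolding g(3) using g0 by (intro Bochner_Integration.integral_nonneg) auto
  have "(\<integral>\<^sup>+x. ennreal (sqrt (\<Sum>k\<in>UNIV. (dir_deriv (e k) \<psi> x)\<^sup>2)) \<partial>lborel) \<le> (\<integral>\<^sup>+x. ennreal (g x) \<partial>lborel)"
  proof (intro nn_integral_mono ennreal_leI)
    fix x
    have "\<bar>dir_deriv (e k) \<psi> x\<bar> \<le> norm (dir_deriv (e k) \<phi> x)" for k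
      unfolding \<psi>_def S(5) by (metis Finite_Cartesian_Product.norm_nth_le order_trans real_norm_def)
    then show "sqrt (\<Sum>k\<in>UNIV. (dir_deriv (e k) \<psi> x)\<^sup>2) \<le> g x"
      unfolding g_def by (intro real_sqrt_le_mono sum_mono) (simp add: abs_le_square_iff[symmetric])
  qed
  also have "\<dots> = ennreal A" unfolding g(3) using g(2) g0 by (intro nn_integral_eq_integral) auto
  finally have A: "(\<integral>\<^sup>+x. ennreal (sqrt (\<Sum>k\<in>UNIV. (dir_deriv (e k) \<psi> x)\<^sup>2)) \<partial>lborel) \<le> ennreal A" .
  have H': "deriv2_distr \<Omega> u (e i) (f j) \<psi> = (\<integral>x. u' x * H x \<partial>lborel)"
  proof -
    have eq: "indicator \<Omega> x *\<^sub>R (u x * H x) = indicator K' x * u x * H x" for x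
      using H0[of x] SK' K'\<Omega> by (cases "x \<in> S") (auto simp: indicator_def)
    have "H \<in> borel_measurable lebesgue" by (rule measurable_completion) simp
    have "(\<lambda>x. u' x * H x) \<in> borel_measurable lebesgue" by (rule measurable_completion) simp
    have "deriv2_distr \<Omega> u (e i) (f j) \<psi> = (\<integral>x. indicator K' x * u x * H x \<partial>lebesgue)"
      unfolding deriv2_distr_def set_lebesgue_integral_def H_def[symmetric] eq ..
    also have "\<dots> = (\<integral>x. u' x * H x \<partial>lebesgue)"
    proof (rule integral_cong_AE)
      show "(\<lambda>x. indicator K' x * u x * H x) \<in> borel_measurable lebesgue"
        by (intro borel_measurable_times um) fact
      show "AE x in lebesgue. indicator K' x * u x * H x = u' x * H x"
        using AE_completion[OF ae]
      proof eventually_elim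
        case (elim x)
        then show ?case using H0[of x] SK' by (cases "x \<in> S") (auto simp: indicator_def)
      qed
    qed fact
    also have "\<dots> = (\<integral>x. u' x * H x \<partial>lborel)" by (rule integral_completion) simp
    finally show ?thesis .
  qed
  have lim: "(averaged i j u' \<psi> \<longlongrightarrow> second_moment (e i) (f j) * (\<integral>x. u' x * H x \<partial>lborel)) (at_right 0)"
    unfolding H_def by (rule averaged_tendsto[OF u'(1) d(1,2,4) S(1) \<psi>0])
  have "second_moment (e i) (f j) * (\<integral>x. u' x * H x \<partial>lborel) \<le> l * A + B * \<alpha> * m + B * \<beta> * (4 * E)"
  proof (rule ccontr)
    assume "\<not> ?thesis"
    then have "\<forall>\<^sub>F \<epsilon> in at_right 0. l * A + B * \<alpha> * m + B * \<beta> * (4 * E) < averaged i j u' \<psi> \<epsilon>"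
      using order_tendstoD(1)[OF lim] by simp
    then have "\<forall>\<^sub>F \<epsilon> in at_right 0. ennreal E \<le> energy_eps X1 X2 \<Omega>1 \<Omega>2 \<rho> \<theta>1 \<theta>2 p \<epsilon> u"
      using eventually_at_right_real[OF \<delta>]
    proof eventually_elim
      case (elim \<epsilon>)
      then have \<epsilon>: "0 < \<epsilon>" "\<epsilon> \<le> \<delta>" by auto
      show ?case
      proof (rule ccontr)
        assume "\<not> ?case"
        then have "energy_eps X1 X2 \<Omega>1 \<Omega>2 \<rho> \<theta>1 \<theta>2 p \<epsilon> u \<le> ennreal E" by simp
        with slice_energy_le_energy_eps[OF \<epsilon>(1) u'm Kb K'\<Omega>[unfolded \<Omega>_def] KK' ae, of \<theta>1 \<theta>2 p] \<epsilon>
        have En: "(\<integral>\<^sup>+y. ennreal (r y) * slice_energy \<theta>1 \<theta>2 p u' K (\<epsilon> *\<^sub>R y) \<partial>lborel) \<le> ennreal E"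
          by (meson order_trans)
        have SK\<epsilon>: "x + v \<in> K" if "x \<in> S" "norm v \<le> \<epsilon>" for x v using SK that \<epsilon> by auto
        have "\<bar>averaged i j u' \<psi> \<epsilon>\<bar> \<le> l * A + B * \<alpha> * m + B * \<beta> * (4 * E)"
          by (rule averaged_bound[OF u' d(1) d(3) B Sb \<psi>0 m m0 A A0 Kb SK\<epsilon> \<epsilon>(1) l eb En E0])
        then show False using elim by linarith
      qed
    qed
    then have "ennreal E \<le> energy X1 X2 \<Omega>1 \<Omega>2 \<rho> \<theta>1 \<theta>2 p u" unfolding energy_def by (rule Liminf_bounded)
    then show False using E by simp
  qed
  then show ?thesis unfolding H'[symmetric] A_def B_def m_def \<Omega>_def \<psi>_def .
qed

text \<open>If a factor on the right-hand side vanishes, then \<open>\<phi> = 0\<close>: a function with zero horizontal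
  gradient is constant along lines that leave its support.  This case must be treated separately,
  as \<open>0 powr 0 = 0\<close> and so for \<open>\<theta>1 + \<theta>2 = 1\<close> a vanishing gradient makes the right-hand side of
  (b) zero.\<close>
lemma mu_pairing_eq_0:
  fixes \<phi> :: "real^'n \<Rightarrow> real^'j^'i"
  assumes \<phi>: "test_function (\<Omega>1 + \<Omega>2) \<phi>" and ne: "\<Omega>1 + \<Omega>2 \<noteq> {}"
    and 0: "grad_L1_norm (\<Omega>1 + \<Omega>2) e \<phi> = 0 \<or> sup_norm (\<Omega>1 + \<Omega>2) \<phi> = 0"
  shows "mu_pairing (\<Omega>1 + \<Omega>2) e f u \<phi> = 0"
proof -
  define S where "S = closure {x. \<phi> x \<noteq> 0}"
  note S = test_function_component[OF \<phi>, folded S_def]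
  have \<phi>0: "\<phi> x $ i $ j = 0" for x i j
  proof (cases "sup_norm (\<Omega>1 + \<Omega>2) \<phi> = 0")
    case True
    then show ?thesis using sup_norm_bound(1)[OF \<phi> ne, of x] by simp
  next
    case False
    then have A: "grad_L1_norm (\<Omega>1 + \<Omega>2) e \<phi> = 0" using 0 by simp
    note g = grad_L1_norm_eq[OF \<phi>]
    have "dir_deriv (e k) \<phi> y = 0" for k y
    proof -
      have "sqrt (\<Sum>k\<in>UNIV. (norm (dir_deriv (e k) \<phi> y))\<^sup>2) = 0"
        using continuous_integral_eq_0[OF g(1,2) g(4)] A unfolding g(3) by simp
      then show ?thesis by (simp add: sum_nonneg_eq_0_iff)
    qed
    then have z: "dir_deriv (e k) (\<lambda>x. \<phi> x $ i $ j) y = 0" for k y unfolding S(5) by simp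
    fix k :: 'i
    obtain N where N: "\<And>y. y \<in> S \<Longrightarrow> norm y \<le> N" using compact_imp_bounded[OF S(1)] by (auto simp: bounded_iff)
    have "\<forall>t. ((\<lambda>t. \<phi> (x + t *\<^sub>R e k) $ i $ j) has_real_derivative 0) (at t)"
      using has_real_derivative_dir_deriv[OF C_diff_2D(1)[OF S(3)[where i = i and j = j]], where x = x and v = "e k"] by (simp add: z)
    from DERIV_isconst_all[OF this, of 0 "N + norm x + 1"]
    have "\<phi> x $ i $ j = \<phi> (x + (N + norm x + 1) *\<^sub>R e k) $ i $ j" by simp
    also have "x + (N + norm x + 1) *\<^sub>R e k \<notin> S"
    proof
      assume "x + (N + norm x + 1) *\<^sub>R e k \<in> S"
      from N[OF this] have "norm ((N + norm x + 1) *\<^sub>R e k) \<le> N + norm x"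
        using norm_triangle_ineq4[of "x + (N + norm x + 1) *\<^sub>R e k" x] by simp
      then show False by (simp add: norm_e)
    qed
    then have "\<phi> (x + (N + norm x + 1) *\<^sub>R e k) $ i $ j = 0" by (simp add: S(4))
    finally show ?thesis .
  qed
  have dz: "dir_deriv v (\<lambda>x. 0 :: real) = (\<lambda>x. 0)" for v :: "real^'n" by (simp add: dir_deriv_def fun_eq_iff)
  show ?thesis unfolding mu_pairing_def deriv2_distr_def \<phi>0 dz by (simp add: set_lebesgue_integral_def)
qed

end

section \<open>The three estimates\<close>

context product_domain
begin

context
  fixes c :: real and u :: "real^'n \<Rightarrow> real" and \<phi> :: "real^'n \<Rightarrow> real^'j^'i"
  assumes u: "L1loc (\<Omega>1 + \<Omega>2) u" and \<phi>: "test_function (\<Omega>1 + \<Omega>2) \<phi>" and ne: "\<Omega>1 + \<Omega>2 \<noteq> {}"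
    and c: "0 < c" "\<And>i j. second_moment (e i) (f j) = c"
begin

lemma mu_pairing_bound:
  assumes V: "V = UNIV \<or> V = {-1..1} \<and> (AE x in lebesgue. x \<in> \<Omega>1 + \<Omega>2 \<longrightarrow> \<bar>u x\<bar> \<le> 1)"
    and l: "0 \<le> l" "0 \<le> \<alpha>" "0 \<le> \<beta>" and eb: "excess_bound V \<theta>1 \<theta>2 p l \<alpha> \<beta>"
    and E: "energy X1 X2 \<Omega>1 \<Omega>2 \<rho> \<theta>1 \<theta>2 p u < \<infinity>" and E': "enn2real (energy X1 X2 \<Omega>1 \<Omega>2 \<rho> \<theta>1 \<theta>2 p u) < E'"
  shows "mu_pairing (\<Omega>1 + \<Omega>2) e f u \<phi> \<le> real (CARD('i) * CARD('j)) / c *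
    (l * grad_L1_norm (\<Omega>1 + \<Omega>2) e \<phi> + sup_norm (\<Omega>1 + \<Omega>2) \<phi> * \<alpha> * measure lborel (\<Omega>1 + \<Omega>2) +
     sup_norm (\<Omega>1 + \<Omega>2) \<phi> * \<beta> * (4 * E'))" (is "_ \<le> _ * ?R")
proof -
  have E0: "0 \<le> E'" using E' enn2real_nonneg less_imp_le order_trans by blast
  have "energy X1 X2 \<Omega>1 \<Omega>2 \<rho> \<theta>1 \<theta>2 p u < ennreal E'"
    using E E' by (metis ennreal_enn2real ennreal_lessI enn2real_nonneg le_less_trans infinity_ennreal_def)
  from pairing_bound[OF u \<phi> ne V l eb this E0]
  have 1: "deriv2_distr (\<Omega>1 + \<Omega>2) u (e i) (f j) (\<lambda>x. \<phi> x $ i $ j) \<le> ?R / c" for i j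
    using c by (simp add: pos_le_divide_eq mult.commute)
  have "mu_pairing (\<Omega>1 + \<Omega>2) e f u \<phi> \<le> (\<Sum>i\<in>(UNIV :: 'i set). \<Sum>j\<in>(UNIV :: 'j set). ?R / c)"
    unfolding mu_pairing_def by (intro sum_mono 1)
  then show ?thesis by (simp add: mult.assoc)
qed

lemma estimate_subcritical:
  assumes \<theta>: "0 < \<theta>1" "0 < \<theta>2"
    and V: "\<theta>1 + \<theta>2 = 1 \<or> \<theta>1 + \<theta>2 < 1 \<and> (AE x in lebesgue. x \<in> \<Omega>1 + \<Omega>2 \<longrightarrow> \<bar>u x\<bar> \<le> 1)"
    and E: "energy X1 X2 \<Omega>1 \<Omega>2 \<rho> \<theta>1 \<theta>2 2 u < \<infinity>"
  shows "mu_pairing (\<Omega>1 + \<Omega>2) e f u \<phi> \<le> real (CARD('i) * CARD('j)) / c * (16 * 2 powr (\<theta>1 + \<theta>2)) *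
    enn2real (energy X1 X2 \<Omega>1 \<Omega>2 \<rho> \<theta>1 \<theta>2 2 u) * sup_norm (\<Omega>1 + \<Omega>2) \<phi>"
proof -
  let ?E = "enn2real (energy X1 X2 \<Omega>1 \<Omega>2 \<rho> \<theta>1 \<theta>2 2 u)"
  define V where "V = (if \<theta>1 + \<theta>2 = 1 then UNIV else {-1..1::real})"
  have V1: "V = UNIV \<or> V = {-1..1} \<and> (AE x in lebesgue. x \<in> \<Omega>1 + \<Omega>2 \<longrightarrow> \<bar>u x\<bar> \<le> 1)"
    and V2: "\<theta>1 + \<theta>2 = 1 \<or> \<theta>1 + \<theta>2 < 1 \<and> V = {-1..1}"
    using V by (auto simp: V_def)
  have "mu_pairing (\<Omega>1 + \<Omega>2) e f u \<phi> \<le> real (CARD('i) * CARD('j)) / c * (16 * 2 powr (\<theta>1 + \<theta>2)) *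
      ?E powr 1 * sup_norm (\<Omega>1 + \<Omega>2) \<phi>"
  proof (rule le_powr_limit)
    fix E' assume E': "?E < E'"
    then have "0 \<le> E'" using enn2real_nonneg less_imp_le order_trans by blast
    with mu_pairing_bound[OF V1 _ _ _ excess_bound_subcritical[OF \<theta> V2] E E']
    show "mu_pairing (\<Omega>1 + \<Omega>2) e f u \<phi> \<le> real (CARD('i) * CARD('j)) / c * (16 * 2 powr (\<theta>1 + \<theta>2)) *
      E' powr 1 * sup_norm (\<Omega>1 + \<Omega>2) \<phi>" by (simp add: mult_ac)
  qed simp_all
  then show ?thesis by simp
qed

lemma estimate_mixed:
  assumes \<theta>: "0 < \<theta>1" "0 < \<theta>2" "1 \<le> \<theta>1 + \<theta>2" "\<theta>1 \<le> 1"
    and E: "energy X1 X2 \<Omega>1 \<Omega>2 \<rho> \<theta>1 \<theta>2 (1 + (\<theta>1 + \<theta>2)) u < \<infinity>"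
  shows "mu_pairing (\<Omega>1 + \<Omega>2) e f u \<phi> \<le> real (CARD('i) * CARD('j)) / c * (1 + 8 * 2 powr \<theta>1) *
    enn2real (energy X1 X2 \<Omega>1 \<Omega>2 \<rho> \<theta>1 \<theta>2 (1 + (\<theta>1 + \<theta>2)) u) powr (1 / (\<theta>1 + \<theta>2)) *
    (grad_L1_norm (\<Omega>1 + \<Omega>2) e \<phi> powr (1 - 1 / (\<theta>1 + \<theta>2)) * sup_norm (\<Omega>1 + \<Omega>2) \<phi> powr (1 / (\<theta>1 + \<theta>2)))"
proof -
  let ?E = "enn2real (energy X1 X2 \<Omega>1 \<Omega>2 \<rho> \<theta>1 \<theta>2 (1 + (\<theta>1 + \<theta>2)) u)"
  define A where "A = grad_L1_norm (\<Omega>1 + \<Omega>2) e \<phi>"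
  define B where "B = sup_norm (\<Omega>1 + \<Omega>2) \<phi>"
  have A0: "0 \<le> A" unfolding A_def grad_L1_norm_eq(3)[OF \<phi>]
    using grad_L1_norm_eq(4)[OF \<phi>] by (rule Bochner_Integration.integral_nonneg)
  have B0: "0 \<le> B" unfolding B_def by (rule sup_norm_bound(2)[OF \<phi> ne])
  show ?thesis
    unfolding A_def[symmetric] B_def[symmetric]
  proof (cases "A = 0 \<or> B = 0")
    case True
    then show "mu_pairing (\<Omega>1 + \<Omega>2) e f u \<phi> \<le> real (CARD('i) * CARD('j)) / c * (1 + 8 * 2 powr \<theta>1) *
      ?E powr (1 / (\<theta>1 + \<theta>2)) * (A powr (1 - 1 / (\<theta>1 + \<theta>2)) * B powr (1 / (\<theta>1 + \<theta>2)))"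
      using mu_pairing_eq_0[OF \<phi> ne, of u] c unfolding A_def B_def by simp
  next
    case False
    then have AB: "0 < A" "0 < B" using A0 B0 by auto
    show "mu_pairing (\<Omega>1 + \<Omega>2) e f u \<phi> \<le> real (CARD('i) * CARD('j)) / c * (1 + 8 * 2 powr \<theta>1) *
      ?E powr (1 / (\<theta>1 + \<theta>2)) * (A powr (1 - 1 / (\<theta>1 + \<theta>2)) * B powr (1 / (\<theta>1 + \<theta>2)))"
    proof (rule le_powr_limit)
      fix E' assume E': "?E < E'"
      then have E0: "0 < E'" using enn2real_nonneg le_less_trans by blast
      obtain l where l: "0 < l" "l * A = A powr (1 - 1 / (\<theta>1 + \<theta>2)) * (E' * B) powr (1 / (\<theta>1 + \<theta>2))"
        "l powr (1 - (\<theta>1 + \<theta>2)) * (E' * B) = A powr (1 - 1 / (\<theta>1 + \<theta>2)) * (E' * B) powr (1 / (\<theta>1 + \<theta>2))"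
        by (rule optimize_mixed[OF AB(1) _ \<theta>(3), of "E' * B"]) (use E0 AB in auto)
      define Q where "Q = A powr (1 - 1 / (\<theta>1 + \<theta>2)) * (E' * B) powr (1 / (\<theta>1 + \<theta>2))"
      have "mu_pairing (\<Omega>1 + \<Omega>2) e f u \<phi> \<le> real (CARD('i) * CARD('j)) / c *
        (l * A + B * 0 * measure lborel (\<Omega>1 + \<Omega>2) + B * (2 * 2 powr \<theta>1 * l powr (1 - (\<theta>1 + \<theta>2))) * (4 * E'))"
        unfolding A_def B_def
        by (rule mu_pairing_bound[OF disjI1[OF refl] _ _ _ excess_bound_mixed[OF \<theta> l(1)] E E']) (use l(1) in auto)
      also have "l * A + B * 0 * measure lborel (\<Omega>1 + \<Omega>2) + B * (2 * 2 powr \<theta>1 * l powr (1 - (\<theta>1 + \<theta>2))) * (4 * E') =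
        l * A + 8 * 2 powr \<theta>1 * (l powr (1 - (\<theta>1 + \<theta>2)) * (E' * B))" by simp
      also have "\<dots> = (1 + 8 * 2 powr \<theta>1) * Q" unfolding l(2,3) Q_def[symmetric] by (simp add: algebra_simps)
      also have "Q = E' powr (1 / (\<theta>1 + \<theta>2)) * (A powr (1 - 1 / (\<theta>1 + \<theta>2)) * B powr (1 / (\<theta>1 + \<theta>2)))"
        using E0 AB by (simp add: Q_def powr_mult)
      finally show "mu_pairing (\<Omega>1 + \<Omega>2) e f u \<phi> \<le> real (CARD('i) * CARD('j)) / c * (1 + 8 * 2 powr \<theta>1) *
        E' powr (1 / (\<theta>1 + \<theta>2)) * (A powr (1 - 1 / (\<theta>1 + \<theta>2)) * B powr (1 / (\<theta>1 + \<theta>2)))"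
        by (simp only: mult.assoc)
    qed (use \<theta> in simp_all)
  qed
qed

lemma estimate_supercritical:
  assumes \<theta>: "1 < \<theta>1" "0 < \<theta>2"
    and E: "energy X1 X2 \<Omega>1 \<Omega>2 \<rho> \<theta>1 \<theta>2 (\<theta>1 + (\<theta>1 + \<theta>2)) u < \<infinity>"
  shows "mu_pairing (\<Omega>1 + \<Omega>2) e f u \<phi> \<le>
    real (CARD('i) * CARD('j)) / c * (1 + measure lborel (\<Omega>1 + \<Omega>2) + 4 * 2 powr \<theta>1) *
    enn2real (energy X1 X2 \<Omega>1 \<Omega>2 \<rho> \<theta>1 \<theta>2 (\<theta>1 + (\<theta>1 + \<theta>2)) u) powr (1 / (\<theta>1 + \<theta>2)) *
    (grad_L1_norm (\<Omega>1 + \<Omega>2) e \<phi> powr (\<theta>2 / (\<theta>1 + \<theta>2)) * sup_norm (\<Omega>1 + \<Omega>2) \<phi> powr (\<theta>1 / (\<theta>1 + \<theta>2)))"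
proof -
  let ?E = "enn2real (energy X1 X2 \<Omega>1 \<Omega>2 \<rho> \<theta>1 \<theta>2 (\<theta>1 + (\<theta>1 + \<theta>2)) u)"
  define A where "A = grad_L1_norm (\<Omega>1 + \<Omega>2) e \<phi>"
  define B where "B = sup_norm (\<Omega>1 + \<Omega>2) \<phi>"
  define m where "m = measure lborel (\<Omega>1 + \<Omega>2)"
  have m0: "0 \<le> m" unfolding m_def by (rule measure_nonneg)
  have A0: "0 \<le> A" unfolding A_def grad_L1_norm_eq(3)[OF \<phi>]
    using grad_L1_norm_eq(4)[OF \<phi>] by (rule Bochner_Integration.integral_nonneg)
  have B0: "0 \<le> B" unfolding B_def by (rule sup_norm_bound(2)[OF \<phi> ne])
  show ?thesis
    unfolding A_def[symmetric] B_def[symmetric] m_def[symmetric]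
  proof (cases "A = 0 \<or> B = 0")
    case True
    then show "mu_pairing (\<Omega>1 + \<Omega>2) e f u \<phi> \<le> real (CARD('i) * CARD('j)) / c * (1 + m + 4 * 2 powr \<theta>1) *
      ?E powr (1 / (\<theta>1 + \<theta>2)) * (A powr (\<theta>2 / (\<theta>1 + \<theta>2)) * B powr (\<theta>1 / (\<theta>1 + \<theta>2)))"
      using mu_pairing_eq_0[OF \<phi> ne, of u] c m0 unfolding A_def B_def by simp
  next
    case False
    then have AB: "0 < A" "0 < B" using A0 B0 by auto
    show "mu_pairing (\<Omega>1 + \<Omega>2) e f u \<phi> \<le> real (CARD('i) * CARD('j)) / c * (1 + m + 4 * 2 powr \<theta>1) *
      ?E powr (1 / (\<theta>1 + \<theta>2)) * (A powr (\<theta>2 / (\<theta>1 + \<theta>2)) * B powr (\<theta>1 / (\<theta>1 + \<theta>2)))"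
    proof (rule le_powr_limit)
      fix E' assume E': "?E < E'"
      then have E0: "0 < E'" using enn2real_nonneg le_less_trans by blast
      define Q where "Q = E' powr (1 / (\<theta>1 + \<theta>2)) * A powr (\<theta>2 / (\<theta>1 + \<theta>2)) * B powr (\<theta>1 / (\<theta>1 + \<theta>2))"
      obtain l k where l: "0 < l" "0 < k" "l * A = Q" "B * k = Q" "B * (k powr (1 - \<theta>1) * l powr (- \<theta>2)) * E' = Q"
        unfolding Q_def by (rule optimize_supercritical[OF AB E0, of \<theta>1 \<theta>2]) (use \<theta> in auto)
      have "mu_pairing (\<Omega>1 + \<Omega>2) e f u \<phi> \<le> real (CARD('i) * CARD('j)) / c *
        (l * A + B * k * m + B * (2 powr \<theta>1 * (k powr (1 - \<theta>1) * l powr (- \<theta>2))) * (4 * E'))"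
        unfolding A_def B_def m_def
        by (rule mu_pairing_bound[OF disjI1[OF refl] _ _ _ excess_bound_supercritical[OF \<theta> l(1,2)] E E']) (use l in auto)
      also have "l * A + B * k * m + B * (2 powr \<theta>1 * (k powr (1 - \<theta>1) * l powr (- \<theta>2))) * (4 * E') =
        l * A + B * k * m + 4 * 2 powr \<theta>1 * (B * (k powr (1 - \<theta>1) * l powr (- \<theta>2)) * E')" by simp
      also have "\<dots> = (1 + m + 4 * 2 powr \<theta>1) * Q" unfolding l(3,4,5) by (simp add: algebra_simps)
      finally show "mu_pairing (\<Omega>1 + \<Omega>2) e f u \<phi> \<le> real (CARD('i) * CARD('j)) / c * (1 + m + 4 * 2 powr \<theta>1) *
        E' powr (1 / (\<theta>1 + \<theta>2)) * (A powr (\<theta>2 / (\<theta>1 + \<theta>2)) * B powr (\<theta>1 / (\<theta>1 + \<theta>2)))"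
        by (simp only: Q_def mult.assoc)
    qed (use \<theta> in simp_all)
  qed
qed

end

end

lemma unit_vector_in_subspace:
  fixes X :: "'a::euclidean_space set"
  assumes "subspace X" "1 \<le> dim X"
  obtains a where "a \<in> X" "norm a = 1"
proof -
  have "\<not> X \<subseteq> {0}" using assms(2) dim_eq_0[of X] by linarith
  then obtain x where "x \<in> X" "x \<noteq> 0" by blast
  then show ?thesis using assms(1) that[of "x /\<^sub>R norm x"] by (simp add: subspace_scale)
qed

theorem proposition13:
  fixes X1 X2 \<Omega>1 \<Omega>2 \<Omega> :: "(real^'n) set"
    and \<rho> :: "real^'n \<Rightarrow> real"
    and \<theta>1 \<theta>2 \<theta> :: real
    and \<E> :: "(real^'n \<Rightarrow> real) \<Rightarrow> ennreal"
  assumes "subspace X1" and "subspace X2"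
    and "\<forall>x\<in>X1. \<forall>y\<in>X2. orthogonal x y" and "X1 + X2 = UNIV"
    and "dim X1 \<ge> 1" and "dim X2 \<ge> 1"
    and "openin (top_of_set X1) \<Omega>1" and "bounded \<Omega>1" and "connected \<Omega>1" and "\<Omega>1 \<noteq> {}"
    and "openin (top_of_set X2) \<Omega>2" and "bounded \<Omega>2" and "connected \<Omega>2" and "\<Omega>2 \<noteq> {}"
    and "\<Omega> = \<Omega>1 + \<Omega>2"
    and "radial_kernel \<rho>"
    and "\<theta>1 > 0" and "\<theta>2 > 0" and "\<theta> = \<theta>1 + \<theta>2"
    and "\<E> = energy X1 X2 \<Omega>1 \<Omega>2 \<rho> \<theta>1 \<theta>2 (crit_exp \<theta>1 \<theta>2)"
  shows "\<exists>C\<ge>0. \<forall>(e :: 'n1::finite \<Rightarrow> real^'n) (f :: 'n2::finite \<Rightarrow> real^'n) u (\<phi> :: real^'n \<Rightarrow> real^'n2^'n1).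
      orthonormal_basis e X1 \<and> orthonormal_basis f X2 \<and> L1loc \<Omega> u \<and> test_function \<Omega> \<phi> \<and>
      \<E> u < \<infinity> \<longrightarrow>
        (\<theta> = 1 \<or> \<theta> < 1 \<and> (AE x in lebesgue. x \<in> \<Omega> \<longrightarrow> \<bar>u x\<bar> \<le> 1) \<longrightarrow>
           mu_pairing \<Omega> e f u \<phi> \<le> C * enn2real (\<E> u) * sup_norm \<Omega> \<phi>) \<and>
        (\<theta> \<ge> 1 \<and> \<theta>1 \<le> 1 \<longrightarrow>
           mu_pairing \<Omega> e f u \<phi> \<le> C * enn2real (\<E> u) powr (1 / \<theta>) *
             grad_L1_norm \<Omega> e \<phi> powr (1 - 1 / \<theta>) * sup_norm \<Omega> \<phi> powr (1 / \<theta>)) \<and>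
        (\<theta>1 > 1 \<and> \<theta>2 > 1 \<and> \<theta>1 \<le> \<theta>2 \<longrightarrow>
           mu_pairing \<Omega> e f u \<phi> \<le> C * enn2real (\<E> u) powr (1 / \<theta>) *
             grad_L1_norm \<Omega> e \<phi> powr (\<theta>2 / \<theta>) * sup_norm \<Omega> \<phi> powr (\<theta>1 / \<theta>))"
proof -
  obtain r where r: "reflection_invariant_kernel r" and \<rho>r: "AE z in lborel. \<rho> z = r z"
    using radial_kernel_representative[OF \<open>radial_kernel \<rho>\<close>] .
  interpret K: reflection_invariant_kernel r by (rule r)
  obtain a where a: "a \<in> X1" "norm a = 1" by (rule unit_vector_in_subspace[OF assms(1,5)])
  obtain b where b: "b \<in> X2" "norm b = 1" by (rule unit_vector_in_subspace[OF assms(2,6)])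
  \<comment> \<open>The constant is fixed before the bases, so it is computed from an arbitrary pair of unit
    vectors.\<close>
  define c where "c = K.second_moment a b"
  have c0: "0 < c" unfolding c_def using a b by (intro K.second_moment_pos)
  define k where "k = real (CARD('n1) * CARD('n2)) / c"
  have k0: "0 \<le> k" unfolding k_def using c0 by simp
  define m where "m = measure lborel \<Omega>"
  have m0: "0 \<le> m" unfolding m_def by (rule measure_nonneg)
  define C where "C = k * (1 + m + 16 * 2 powr \<theta> + 8 * 2 powr \<theta>1)"
  have C0: "0 \<le> C" unfolding C_def using k0 m0 by simp
  have Ca: "k * (16 * 2 powr \<theta>) \<le> C" and Cb: "k * (1 + 8 * 2 powr \<theta>1) \<le> C"
    and Cc: "k * (1 + m + 4 * 2 powr \<theta>1) \<le> C"
    unfolding C_def using m0 by (intro mult_left_mono k0; simp add: add_nonneg_nonneg)+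
  show ?thesis
  proof (intro exI[of _ C] conjI[OF C0] allI impI)
    fix e :: "'n1 \<Rightarrow> real^'n" and f :: "'n2 \<Rightarrow> real^'n" and u and \<phi> :: "real^'n \<Rightarrow> real^'n2^'n1"
    assume *: "orthonormal_basis e X1 \<and> orthonormal_basis f X2 \<and> L1loc \<Omega> u \<and> test_function \<Omega> \<phi> \<and> \<E> u < \<infinity>"
    then have e: "orthonormal_basis e X1" and f: "orthonormal_basis f X2" by auto
    interpret orthonormal_split e f by (rule orthonormal_bases_split[OF e f assms(3,4)])
    interpret D: product_domain e f r X1 X2 \<Omega>1 \<Omega>2 \<rho>
      by unfold_locales (use e f assms \<rho>r in \<open>auto simp: orthonormal_basis_def\<close>)
    have ex: "e i \<in> X1" "f j \<in> X2" for i j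
      using e f by (auto simp: orthonormal_basis_def intro: span_base)
    have c: "K.second_moment (e i) (f j) = c" for i j
      unfolding c_def using ex a b assms(3)
      by (intro K.second_moment_eq) (auto simp: D.norm_e D.norm_f orthogonal_def)
    have ne: "\<Omega>1 + \<Omega>2 \<noteq> {}" using assms(10,14) by (auto simp: set_plus_def)
    have u: "L1loc (\<Omega>1 + \<Omega>2) u" and \<phi>: "test_function (\<Omega>1 + \<Omega>2) \<phi>" and E: "\<E> u < \<infinity>"
      using * assms(15) by auto
    note est = D.estimate_subcritical[OF u \<phi> ne c0 c \<open>0 < \<theta>1\<close> \<open>0 < \<theta>2\<close>, folded k_def]
      D.estimate_mixed[OF u \<phi> ne c0 c \<open>0 < \<theta>1\<close> \<open>0 < \<theta>2\<close>, folded k_def]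
      D.estimate_supercritical[where ?\<theta>1.0 = \<theta>1, OF u \<phi> ne c0 c _ \<open>0 < \<theta>2\<close>, folded k_def]
    note fold = assms(15)[symmetric] \<open>\<theta> = \<theta>1 + \<theta>2\<close>[symmetric]
    have B0: "0 \<le> sup_norm \<Omega> \<phi>" using D.sup_norm_bound(2)[OF \<phi> ne] by (simp add: fold)
    show "(\<theta> = 1 \<or> \<theta> < 1 \<and> (AE x in lebesgue. x \<in> \<Omega> \<longrightarrow> \<bar>u x\<bar> \<le> 1) \<longrightarrow>
           mu_pairing \<Omega> e f u \<phi> \<le> C * enn2real (\<E> u) * sup_norm \<Omega> \<phi>) \<and>
        (\<theta> \<ge> 1 \<and> \<theta>1 \<le> 1 \<longrightarrow>
           mu_pairing \<Omega> e f u \<phi> \<le> C * enn2real (\<E> u) powr (1 / \<theta>) *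
             grad_L1_norm \<Omega> e \<phi> powr (1 - 1 / \<theta>) * sup_norm \<Omega> \<phi> powr (1 / \<theta>)) \<and>
        (\<theta>1 > 1 \<and> \<theta>2 > 1 \<and> \<theta>1 \<le> \<theta>2 \<longrightarrow>
           mu_pairing \<Omega> e f u \<phi> \<le> C * enn2real (\<E> u) powr (1 / \<theta>) *
             grad_L1_norm \<Omega> e \<phi> powr (\<theta>2 / \<theta>) * sup_norm \<Omega> \<phi> powr (\<theta>1 / \<theta>))"
    proof (intro conjI impI)
      assume 1: "\<theta> = 1 \<or> \<theta> < 1 \<and> (AE x in lebesgue. x \<in> \<Omega> \<longrightarrow> \<bar>u x\<bar> \<le> 1)"
      then have p: "crit_exp \<theta>1 \<theta>2 = 2" using assms(19) by (auto simp: crit_exp_def)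
      have eu: "\<E> u = energy X1 X2 \<Omega>1 \<Omega>2 \<rho> \<theta>1 \<theta>2 2 u" by (simp add: assms(20) p)
      have "mu_pairing \<Omega> e f u \<phi> \<le> k * (16 * 2 powr \<theta>) * enn2real (\<E> u) * sup_norm \<Omega> \<phi>"
        unfolding eu by (rule est(1)[unfolded fold, OF 1 E[unfolded eu]])
      also have "\<dots> \<le> C * enn2real (\<E> u) * sup_norm \<Omega> \<phi>"
        by (intro mult_right_mono Ca B0) auto
      finally show "mu_pairing \<Omega> e f u \<phi> \<le> C * enn2real (\<E> u) * sup_norm \<Omega> \<phi>" .
    next
      assume 2: "\<theta> \<ge> 1 \<and> \<theta>1 \<le> 1"
      then have p: "crit_exp \<theta>1 \<theta>2 = 1 + \<theta>" using assms(19) by (auto simp: crit_exp_def)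
      have eu: "\<E> u = energy X1 X2 \<Omega>1 \<Omega>2 \<rho> \<theta>1 \<theta>2 (1 + \<theta>) u" by (simp add: assms(20) p)
      have "mu_pairing \<Omega> e f u \<phi> \<le> k * (1 + 8 * 2 powr \<theta>1) * enn2real (\<E> u) powr (1 / \<theta>) *
          (grad_L1_norm \<Omega> e \<phi> powr (1 - 1 / \<theta>) * sup_norm \<Omega> \<phi> powr (1 / \<theta>))"
        unfolding eu using 2 by (intro est(2)[unfolded fold] E[unfolded eu]) auto
      also have "\<dots> \<le> C * enn2real (\<E> u) powr (1 / \<theta>) *
          (grad_L1_norm \<Omega> e \<phi> powr (1 - 1 / \<theta>) * sup_norm \<Omega> \<phi> powr (1 / \<theta>))"
        by (intro mult_right_mono Cb) auto
      finally show "mu_pairing \<Omega> e f u \<phi> \<le> C * enn2real (\<E> u) powr (1 / \<theta>) *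
             grad_L1_norm \<Omega> e \<phi> powr (1 - 1 / \<theta>) * sup_norm \<Omega> \<phi> powr (1 / \<theta>)"
        by (simp only: mult.assoc)
    next
      assume 3: "\<theta>1 > 1 \<and> \<theta>2 > 1 \<and> \<theta>1 \<le> \<theta>2"
      then have p: "crit_exp \<theta>1 \<theta>2 = \<theta>1 + \<theta>" using assms(19) by (auto simp: crit_exp_def)
      have eu: "\<E> u = energy X1 X2 \<Omega>1 \<Omega>2 \<rho> \<theta>1 \<theta>2 (\<theta>1 + \<theta>) u" by (simp add: assms(20) p)
      have "mu_pairing \<Omega> e f u \<phi> \<le> k * (1 + m + 4 * 2 powr \<theta>1) * enn2real (\<E> u) powr (1 / \<theta>) *
          (grad_L1_norm \<Omega> e \<phi> powr (\<theta>2 / \<theta>) * sup_norm \<Omega> \<phi> powr (\<theta>1 / \<theta>))"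
        unfolding eu m_def using 3 by (intro est(3)[unfolded fold] E[unfolded eu]) auto
      also have "\<dots> \<le> C * enn2real (\<E> u) powr (1 / \<theta>) *
          (grad_L1_norm \<Omega> e \<phi> powr (\<theta>2 / \<theta>) * sup_norm \<Omega> \<phi> powr (\<theta>1 / \<theta>))"
        by (intro mult_right_mono Cc) auto
      finally show "mu_pairing \<Omega> e f u \<phi> \<le> C * enn2real (\<E> u) powr (1 / \<theta>) *
             grad_L1_norm \<Omega> e \<phi> powr (\<theta>2 / \<theta>) * sup_norm \<Omega> \<phi> powr (\<theta>1 / \<theta>)"
        by (simp only: mult.assoc)
    qed
  qed
qed

end
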